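(* Let $G$ be a connected unicyclic graph that is not a cycle, and let $C_n$ be its unique cycle (of length $n$). Then $\operatorname{reg}(I(G))=\nu(G)+1$ if and only if $n\equiv 0$ or $1 \pmod 3$, or $\nu(G\setminus\Gamma(G))<\nu(G)$.
   Context: All graphs are finite and simple. A graph is unicyclic if it contains exactly one cycle. For a graph $G$ with vertex set $\{x_1,\ldots,x_m\}$ and a field $K$, the edge ideal $I(G)\subseteq R=K[x_1,\ldots,x_m]$ is generated by the monomials $x_ix_j$ with $\{x_i,x_j\}\in E(G)$. The regularity of a finitely generated graded $R$-module $M$ is $\operatorname{reg}(M)=\max\{j-i \mid \operatorname{Tor}_i^R(M,K)_j\neq 0\}$. An induced matching in $G$ is a set of pairwise disjoint edges which are exactly the edges of the induced subgraph of $G$ on the union of their vertices; $\nu(G)$ denotes the largest size of an induced matching in $G$. For a connected unicyclic graph $G$ with cycle $C_n$, $\Gamma(G)$ denotes the set of all vertices of $G$ that are not on $C_n$ but are adjacent to some vertex of $C_n$. $G\setminus\Gamma(G)$ is the induced subgraph of $G$ on $V(G)\setminus\Gamma(G)$. *)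

theory Defs
  imports "HOL-Library.Poly_Mapping" "Graph_Theory.Graph_Theory"
begin

section \<open>Graphs, cycles and induced matchings\<close>

text \<open>
  Finite simple graphs are the symmetric digraphs of locale \<^locale>\<open>graph\<close> (finite, no loops, no
  parallel arcs). Each undirected edge is a pair of opposite arcs; \<open>uedges\<close> forgets the orientation.
\<close>

definition uedges :: "('v, 'e) pre_digraph \<Rightarrow> 'v set set" where
  "uedges G = {{u, v} | u v. u \<rightarrow>\<^bsub>G\<^esub> v}"

text \<open>
  An undirected cycle is represented by its edge set, which determines it as a subgraph: its
  vertex set is the union of its edges and its length is their number. In a symmetric digraph the
  closed walk \<open>u, v, u\<close> also satisfies \<open>pre_digraph.cycle\<close>, hence the bound on the length. The choice
  of base point and orientation of the walk does not matter for the edge set.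
\<close>

definition graph_cycles :: "('v, 'e) pre_digraph \<Rightarrow> 'v set set set" where
  "graph_cycles G =
     {(\<lambda>e. {tail G e, head G e}) ` set p | p. pre_digraph.cycle G p \<and> 3 \<le> length p}"

definition unicyclic :: "('v, 'e) pre_digraph \<Rightarrow> bool" where
  "unicyclic G \<longleftrightarrow> (\<exists>!C. C \<in> graph_cycles G)"

definition is_cycle_graph :: "('v, 'e) pre_digraph \<Rightarrow> bool" where
  "is_cycle_graph G \<longleftrightarrow> (\<exists>C \<in> graph_cycles G. uedges G = C \<and> verts G = \<Union>C)"

definition induced_matching :: "('v, 'e) pre_digraph \<Rightarrow> 'v set set \<Rightarrow> bool" where
  "induced_matching G M \<longleftrightarrow>
     M \<subseteq> uedges G \<and> pairwise disjnt M \<and> uedges (G \<restriction> \<Union>M) = M"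

definition induced_matching_number :: "('v, 'e) pre_digraph \<Rightarrow> nat" where
  "induced_matching_number G = Max {card M | M. induced_matching G M}"

definition cycle_nbrs :: "('v, 'e) pre_digraph \<Rightarrow> 'v set set \<Rightarrow> 'v set" where
  "cycle_nbrs G C = {v \<in> verts G. v \<notin> \<Union>C \<and> (\<exists>u \<in> \<Union>C. u \<rightarrow>\<^bsub>G\<^esub> v)}"

definition delete_verts :: "('v, 'e) pre_digraph \<Rightarrow> 'v set \<Rightarrow> ('v, 'e) pre_digraph" where
  "delete_verts G S = G \<restriction> (verts G - S)"


section \<open>Polynomial rings and edge ideals\<close>

type_synonym 'v monom = "'v \<Rightarrow>\<^sub>0 nat"
type_synonym ('v, 'k) mpoly = "'v monom \<Rightarrow>\<^sub>0 'k"

text \<open>The polynomial ring in the variables \<open>x\<^sub>v\<close> for \<open>v \<in> V\<close>.\<close>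

definition poly_ring :: "'v set \<Rightarrow> ('v, 'k::field) mpoly set" where
  "poly_ring V = {p. \<forall>m \<in> Poly_Mapping.keys p. Poly_Mapping.keys m \<subseteq> V}"

definition monom_deg :: "'v monom \<Rightarrow> nat" where
  "monom_deg m = (\<Sum>v \<in> Poly_Mapping.keys m. Poly_Mapping.lookup m v)"

text \<open>Degrees are integers, so that twists can be expressed; the components of negative degree
  of the polynomial ring are zero.\<close>

definition hom_comp :: "'v set \<Rightarrow> int \<Rightarrow> ('v, 'k::field) mpoly set" where
  "hom_comp V d = {p \<in> poly_ring V. \<forall>m \<in> Poly_Mapping.keys p. int (monom_deg m) = d}"

definition pvar :: "'v \<Rightarrow> ('v, 'k::field) mpoly" where
  "pvar v = Poly_Mapping.single (Poly_Mapping.single v 1) 1"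

definition is_ideal :: "('v, 'k::field) mpoly set \<Rightarrow> ('v, 'k) mpoly set \<Rightarrow> bool" where
  "is_ideal R I \<longleftrightarrow> I \<subseteq> R \<and> 0 \<in> I \<and> (\<forall>x \<in> I. \<forall>y \<in> I. x + y \<in> I) \<and> (\<forall>r \<in> R. \<forall>x \<in> I. r * x \<in> I)"

definition edge_ideal :: "('v, 'e) pre_digraph \<Rightarrow> ('v, 'k::field) mpoly set" where
  "edge_ideal G = is_ideal (poly_ring (verts G)) hull {pvar u * pvar v | u v. u \<rightarrow>\<^bsub>G\<^esub> v}"


section \<open>Graded free resolutions, Tor and regularity\<close>

text \<open>
  Let \<open>R = poly_ring V\<close>. A graded \<open>R\<close>-module is given by its scalar multiplication \<open>s\<close> and the family
  \<open>M :: int \<Rightarrow> 'm set\<close> of its homogeneous components. A record \<open>F\<close> of the following type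
  stores a sequence of finitely generated graded free modules
  \<open>\<dots> \<rightarrow> F\<^sub>1 \<rightarrow> F\<^sub>0 \<rightarrow> M\<close>: the module \<open>F\<^sub>i\<close> has basis elements \<open>b < rk F i\<close> of degrees \<open>bdeg F i b\<close>,
  the map \<open>F\<^sub>i\<^sub>+\<^sub>1 \<rightarrow> F\<^sub>i\<close> has the matrix \<open>dmat F i\<close> (row index first), and \<open>F\<^sub>0 \<rightarrow> M\<close> maps the basis
  element \<open>b\<close> to \<open>aug F b\<close>. Matrix entries outside the ranks are irrelevant.
\<close>

record (overloaded) ('v, 'k, 'm) free_cpx =
  rk :: "nat \<Rightarrow> nat"
  bdeg :: "nat \<Rightarrow> nat \<Rightarrow> int"
  aug :: "nat \<Rightarrow> 'm"
  dmat :: "nat \<Rightarrow> nat \<Rightarrow> nat \<Rightarrow> ('v, 'k) mpoly"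

definition free_comp ::
  "'v set \<Rightarrow> ('v, 'k::field, 'm) free_cpx \<Rightarrow> nat \<Rightarrow> int \<Rightarrow> (nat \<Rightarrow> ('v, 'k) mpoly) set" where
  "free_comp V F i d =
     {f. (\<forall>b < rk F i. f b \<in> hom_comp V (d - bdeg F i b)) \<and> (\<forall>b \<ge> rk F i. f b = 0)}"

definition free_map ::
  "('v, 'k::field, 'm) free_cpx \<Rightarrow> nat \<Rightarrow> (nat \<Rightarrow> ('v, 'k) mpoly) \<Rightarrow> nat \<Rightarrow> ('v, 'k) mpoly" where
  "free_map F i f = (\<lambda>b. if b < rk F i then \<Sum>c < rk F (Suc i). dmat F i b c * f c else 0)"

definition aug_map ::
  "(('v, 'k::field) mpoly \<Rightarrow> 'm \<Rightarrow> 'm) \<Rightarrow> ('v, 'k, 'm::ab_group_add) free_cpx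
     \<Rightarrow> (nat \<Rightarrow> ('v, 'k) mpoly) \<Rightarrow> 'm" where
  "aug_map s F f = (\<Sum>b < rk F 0. s (f b) (aug F b))"

text \<open>All maps are homogeneous of degree \<open>0\<close>, so exactness is exactness in every degree \<open>d\<close>.\<close>

definition graded_free_resolution ::
  "'v set \<Rightarrow> (('v, 'k::field) mpoly \<Rightarrow> 'm \<Rightarrow> 'm) \<Rightarrow> (int \<Rightarrow> 'm set)
     \<Rightarrow> ('v, 'k, 'm::ab_group_add) free_cpx \<Rightarrow> bool" where
  "graded_free_resolution V s M F \<longleftrightarrow>
     (\<forall>b < rk F 0. aug F b \<in> M (bdeg F 0 b)) \<and>
     (\<forall>i. \<forall>b < rk F i. \<forall>c < rk F (Suc i).
        dmat F i b c \<in> hom_comp V (bdeg F (Suc i) c - bdeg F i b)) \<and>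
     (\<forall>d. aug_map s F ` free_comp V F 0 d = M d) \<and>
     (\<forall>d. {f \<in> free_comp V F 0 d. aug_map s F f = 0} = free_map F 0 ` free_comp V F 1 d) \<and>
     (\<forall>i d. {f \<in> free_comp V F (Suc i) d. free_map F i f = (\<lambda>_. 0)}
        = free_map F (Suc i) ` free_comp V F (Suc (Suc i)) d)"

text \<open>
  Here \<open>K = R / (x\<^sub>v | v \<in> V)\<close>. The tensor product of \<open>F\<^sub>i\<close> with \<open>K\<close> has a \<open>K\<close>-basis consisting of the
  basis elements of \<open>F\<^sub>i\<close>, in the same degrees, and the induced maps are given by the constant terms
  of the matrix entries. The augmentation is dropped, as usual for derived functors.
\<close>

definition tensor_comp ::
  "('v, 'k::field, 'm) free_cpx \<Rightarrow> nat \<Rightarrow> int \<Rightarrow> (nat \<Rightarrow> 'k) set" where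
  "tensor_comp F i j = {f. \<forall>b. f b \<noteq> 0 \<longrightarrow> b < rk F i \<and> bdeg F i b = j}"

definition tensor_map ::
  "('v, 'k::field, 'm) free_cpx \<Rightarrow> nat \<Rightarrow> (nat \<Rightarrow> 'k) \<Rightarrow> nat \<Rightarrow> 'k" where
  "tensor_map F i f =
     (\<lambda>b. if b < rk F i then \<Sum>c < rk F (Suc i). Poly_Mapping.lookup (dmat F i b c) 0 * f c
          else 0)"

definition tensor_cycles ::
  "('v, 'k::field, 'm) free_cpx \<Rightarrow> nat \<Rightarrow> int \<Rightarrow> (nat \<Rightarrow> 'k) set" where
  "tensor_cycles F i j =
     {f \<in> tensor_comp F i j. case i of 0 \<Rightarrow> True | Suc i' \<Rightarrow> tensor_map F i' f = (\<lambda>_. 0)}"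

definition tensor_boundaries ::
  "('v, 'k::field, 'm) free_cpx \<Rightarrow> nat \<Rightarrow> int \<Rightarrow> (nat \<Rightarrow> 'k) set" where
  "tensor_boundaries F i j = tensor_map F i ` tensor_comp F (Suc i) j"

definition tensor_homology ::
  "('v, 'k::field, 'm) free_cpx \<Rightarrow> nat \<Rightarrow> int \<Rightarrow> (nat \<Rightarrow> 'k) set set" where
  "tensor_homology F i j = tensor_cycles F i j //
     {(f, g). f \<in> tensor_cycles F i j \<and> g \<in> tensor_cycles F i j \<and>
              (\<lambda>b. f b - g b) \<in> tensor_boundaries F i j}"

text \<open>
  The degree \<open>j\<close> component of \<open>Tor\<^sub>i(M, K)\<close>, as the set of homology classes, computed from a chosen
  graded free resolution of the finitely generated graded module \<open>M\<close>. It does not depend on the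
  choice up to isomorphism. Being a vector space, it is nonzero iff it has more than one element.
\<close>

definition Tor ::
  "'v set \<Rightarrow> (('v, 'k::field) mpoly \<Rightarrow> 'm \<Rightarrow> 'm) \<Rightarrow> (int \<Rightarrow> 'm::ab_group_add set)
     \<Rightarrow> nat \<Rightarrow> int \<Rightarrow> (nat \<Rightarrow> 'k) set set" where
  "Tor V s M i j = tensor_homology (SOME F. graded_free_resolution V s M F) i j"

definition Tor_nonzero ::
  "'v set \<Rightarrow> (('v, 'k::field) mpoly \<Rightarrow> 'm \<Rightarrow> 'm) \<Rightarrow> (int \<Rightarrow> 'm::ab_group_add set)
     \<Rightarrow> nat \<Rightarrow> int \<Rightarrow> bool" where
  "Tor_nonzero V s M i j \<longleftrightarrow> (\<exists>a \<in> Tor V s M i j. \<exists>b \<in> Tor V s M i j. a \<noteq> b)"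

definition regularity ::
  "'v set \<Rightarrow> (('v, 'k::field) mpoly \<Rightarrow> 'm \<Rightarrow> 'm) \<Rightarrow> (int \<Rightarrow> 'm::ab_group_add set) \<Rightarrow> int" where
  "regularity V s M = Max {j - int i | i j. Tor_nonzero V s M i j}"

definition ideal_regularity :: "'v set \<Rightarrow> ('v, 'k::field) mpoly set \<Rightarrow> int" where
  "ideal_regularity V I = regularity V (*) (\<lambda>d. I \<inter> hom_comp V d)"

end

theory Submission
  imports Defs
begin

text \<open>
  Let \<open>E\<close> be the edge set of \<open>G\<close>. The Taylor resolution computes \<open>Tor\<^sub>i(I(G), K)\<close> in the squarefree
  multidegree \<open>S\<close> as the homology, at sets of \<open>i + 1\<close> edges, of the complex of edge sets of the induced
  subgraph \<open>G[S]\<close> that cover \<open>S\<close>, whose differential removes one edge. Hence \<open>reg(I(G)) - 1\<close> is the maximum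
  of \<open>|S| - d\<close> over the \<open>S\<close> and \<open>d\<close> for which \<open>d\<close>-element covers have nonzero homology.

  Splitting a complex of covers according to whether a given edge is used gives a long exact
  sequence. It shows that for a leaf \<open>u\<close> of \<open>G[S]\<close> with neighbour \<open>v\<close>, deleting \<open>v\<close> and all its
  neighbours keeps the homology and lowers \<open>|S| - d\<close> by one; the edges \<open>uv\<close> chosen in this way form an
  induced matching. In a unicyclic graph the reduction ends with the empty set, where \<open>|S| - d\<close> is
  the size of an induced matching, or with the cycle \<open>C\<^sub>n\<close>, and then the matching avoids both \<open>C\<^sub>n\<close> and
  \<open>\<Gamma>(G)\<close>. Covers of \<open>C\<^sub>n\<close> have homology with \<open>n - d\<close> at most \<open>\<nu>(C\<^sub>n) = \<lfloor>n/3\<rfloor>\<close>, except for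
  \<open>n \<equiv> 2 (mod 3)\<close>, when it is at \<open>n - d = \<lfloor>n/3\<rfloor> + 1\<close>. So \<open>\<nu>(G) + 1\<close> is exceeded exactly when
  \<open>n \<equiv> 2 (mod 3)\<close> and \<open>\<nu>(G - \<Gamma>(G)) = \<nu>(G)\<close>.
\<close>

section \<open>Homology of complexes of covers\<close>

text \<open>A cover complex is the chain complex of a simplex modulo the subcomplex of the edge sets
  that miss a vertex of \<open>S\<close>. Three moves derived from the exact sequence carry all
  computations: an edge disjoint from \<open>S\<close> makes the complex acyclic, an edge that alone
  reaches some vertex of \<open>S\<close> can be used up, and an edge that covers at least as much
  of \<open>S\<close> as another one can be deleted. For a leaf \<open>u\<close> at
  \<open>v\<close>, covering \<open>u\<close> covers \<open>v\<close>; so an edge \<open>vw\<close>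
  only has to cover \<open>w\<close>, every other edge at \<open>w\<close> is deletable, and
  \<open>vw\<close> becomes forced. Along a path the same moves consume three vertices at the cost
  of two edges, which is the source of the residues mod 3. \<open>Tor\<close> is defined from an
  arbitrarily chosen resolution. The Taylor resolution can stand in for it only after a comparison
  theorem, proved by chain maps in both directions and a homotopy, read modulo the irrelevant ideal.
  Since the ideal and not its quotient ring is resolved, homological degree \<open>i\<close> belongs
  to covers with \<open>i + 1\<close> edges, so only \<open>d \<ge> 1\<close> counts.\<close>

definition rem_sign :: "nat \<Rightarrow> nat set \<Rightarrow> 'k::field" where
  "rem_sign a B = (- 1) ^ card {b \<in> B. b < a}"

definition cov_chain :: "(nat \<Rightarrow> 'v set) \<Rightarrow> nat set \<Rightarrow> 'v set \<Rightarrow> int \<Rightarrow> (nat set \<Rightarrow> 'k::field) set" where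
  "cov_chain g I S n = {c. \<forall>A. c A \<noteq> 0 \<longrightarrow> A \<subseteq> I \<and> S \<subseteq> \<Union> (g ` A) \<and> int (card A) = n}"

text \<open>Chains are coefficient functions, so the boundary appears in transposed form:
  \<open>B\<close> collects the coefficients of the covers from which removing one edge gives
  \<open>B\<close>.\<close>

definition cov_bd :: "(nat \<Rightarrow> 'v set) \<Rightarrow> nat set \<Rightarrow> 'v set \<Rightarrow> (nat set \<Rightarrow> 'k::field) \<Rightarrow> nat set \<Rightarrow> 'k" where
  "cov_bd g I S c = (\<lambda>B. if B \<subseteq> I \<and> S \<subseteq> \<Union> (g ` B)
     then \<Sum>a \<in> I - B. rem_sign a B * c (insert a B) else 0)"

text \<open>
  Nonvanishing homology at \<open>n\<close>-element covers of \<open>S\<close>. The first argument only fixes the field;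
  the integer degree allows the shift by \<open>-1\<close> at the empty cover.
\<close>

definition cov_hom :: "'k::field itself \<Rightarrow> (nat \<Rightarrow> 'v set) \<Rightarrow> nat set \<Rightarrow> 'v set \<Rightarrow> int \<Rightarrow> bool" where
  "cov_hom _ g I S n \<longleftrightarrow> (\<exists>c \<in> (cov_chain g I S n :: (nat set \<Rightarrow> 'k) set).
     cov_bd g I S c = (\<lambda>_. 0) \<and> c \<notin> cov_bd g I S ` cov_chain g I S (n + 1))"

section \<open>Signs, linearity and degenerate cover complexes\<close>

lemma rem_sign_sq [simp]: "rem_sign a B * rem_sign a B = (1 :: 'k::field)"
  unfolding rem_sign_def power_mult_distrib[symmetric] by simp

lemma rem_sign_sq' [simp]: "rem_sign a B * (rem_sign a B * x) = (x :: 'k::field)"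
  by (simp only: mult.assoc[symmetric] rem_sign_sq mult_1_left)

lemma rem_sign_insert:
  assumes "finite B" "b \<notin> B"
  shows "rem_sign a (insert b B) = (if b < a then - rem_sign a B else (rem_sign a B :: 'k::field))"
proof -
  have "{x \<in> insert b B. x < a} = (if b < a then insert b {x \<in> B. x < a} else {x \<in> B. x < a})" by auto
  then show ?thesis using assms by (auto simp: rem_sign_def)
qed

text \<open>The two orders of removing \<open>a\<close> and \<open>b\<close> carry opposite signs;
  this is the cancellation behind \<open>taylor_diff_diff\<close> and the minus sign in
  \<open>part1_bd\<close>.\<close>

lemma rem_sign_swap:
  assumes "finite B" "a \<notin> B" "b \<notin> B" "a \<noteq> b"
  shows "rem_sign a (insert b B) * rem_sign b B = - (rem_sign b (insert a B) * rem_sign a B :: 'k::field)"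
  using assms by (auto simp: rem_sign_insert)

lemma cov_bd_zero [simp]: "cov_bd g I S (\<lambda>_. 0) = (\<lambda>_. 0)"
  by (auto simp: cov_bd_def)

lemma cov_bd_add: "cov_bd g I S (\<lambda>A. c A + d A) = (\<lambda>A. cov_bd g I S c A + cov_bd g I S d A)"
  by (auto simp: cov_bd_def algebra_simps sum.distrib)

lemma cov_bd_uminus: "cov_bd g I S (\<lambda>A. - c A) = (\<lambda>A. - cov_bd g I S c A)"
  by (auto simp: cov_bd_def sum_negf)

lemma cov_chain_zero [simp]: "(\<lambda>_. 0) \<in> cov_chain g I S n"
  by (auto simp: cov_chain_def)

lemma cov_chain_add: "c \<in> cov_chain g I S n \<Longrightarrow> d \<in> cov_chain g I S n \<Longrightarrow> (\<lambda>A. c A + d A) \<in> cov_chain g I S n"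
  unfolding cov_chain_def mem_Collect_eq by (metis add.right_neutral diff_zero)

lemma cov_chain_uminus: "c \<in> cov_chain g I S n \<Longrightarrow> (\<lambda>A. - c A) \<in> cov_chain g I S n"
  unfolding cov_chain_def by simp

lemma cov_chain_outside: "c \<in> cov_chain g I S n \<Longrightarrow> \<not> A \<subseteq> I \<Longrightarrow> c A = 0"
  unfolding cov_chain_def by blast

lemma cov_hom_cong:
  fixes T :: "'k::field itself"
  assumes "\<And>A. A \<subseteq> I \<Longrightarrow> S \<subseteq> \<Union> (g ` A) \<longleftrightarrow> S' \<subseteq> \<Union> (g ` A)"
  shows "cov_hom T g I S n \<longleftrightarrow> cov_hom T g I S' n"
proof -
  have 1: "cov_chain g I S m = cov_chain g I S' m" for m
    unfolding cov_chain_def using assms by (intro Collect_cong) metis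
  have 2: "cov_bd g I S = (cov_bd g I S' :: (nat set \<Rightarrow> 'k) \<Rightarrow> _)"
    unfolding cov_bd_def using assms by (intro ext if_cong conj_cong refl) simp_all
  show ?thesis unfolding cov_hom_def by (simp only: 1 2)
qed

lemma cov_bd_nonzero:
  assumes "c \<notin> cov_bd g I S ` cov_chain g I S n"
  obtains A where "c A \<noteq> 0"
proof (cases "\<exists>A. c A \<noteq> 0")
  case False
  then have "c = cov_bd g I S (\<lambda>_. 0)" by auto
  then show ?thesis using assms cov_chain_zero by blast
qed (use that in blast)

text \<open>There are no covers at all, hence no nonzero chains.\<close>

lemma cov_hom_uncovered:
  fixes T :: "'k::field itself"
  assumes "x \<in> S" "\<And>a. a \<in> I \<Longrightarrow> x \<notin> g a"
  shows "\<not> cov_hom T g I S n"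
proof
  assume "cov_hom T g I S n"
  then obtain c :: "nat set \<Rightarrow> 'k" where c: "c \<in> cov_chain g I S n" "c \<notin> cov_bd g I S ` cov_chain g I S (n + 1)"
    unfolding cov_hom_def by blast
  from c(2) obtain A where "c A \<noteq> 0" by (rule cov_bd_nonzero)
  with c(1) assms show False unfolding cov_chain_def by blast
qed

lemma cov_hom_empty:
  fixes T :: "'k::field itself"
  shows "cov_hom T g {} {} n \<longleftrightarrow> n = 0"
proof
  assume "cov_hom T g {} {} n"
  then obtain c :: "nat set \<Rightarrow> 'k" where c: "c \<in> cov_chain g {} {} n" "c \<notin> cov_bd g {} {} ` cov_chain g {} {} (n + 1)"
    unfolding cov_hom_def by blast
  from c(2) obtain A where "c A \<noteq> 0" by (rule cov_bd_nonzero)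
  then show "n = 0" using c(1) by (auto simp: cov_chain_def)
next
  assume "n = 0"
  let ?c = "\<lambda>A. if A = {} then 1 else 0 :: 'k"
  have "?c \<in> cov_chain g {} {} 0" by (auto simp: cov_chain_def)
  moreover have bd: "cov_bd g {} {} c = (\<lambda>_. 0)" for c :: "nat set \<Rightarrow> 'k" by (auto simp: cov_bd_def)
  moreover have "?c \<noteq> (\<lambda>_. 0)" by (auto dest: fun_cong[of _ _ "{}"])
  ultimately show "cov_hom T g {} {} n" unfolding cov_hom_def \<open>n = 0\<close> by (auto simp: bd)
qed

text \<open>
  A chain is split into its part on covers without \<open>e\<close> and its part on covers with \<open>e\<close>. With the sign in
  \<open>part1\<close> the complex becomes the mapping cone of the restriction from covers of \<open>S - g e\<close> to covers of \<open>S\<close>.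
\<close>

definition part0 :: "nat \<Rightarrow> (nat set \<Rightarrow> 'k::field) \<Rightarrow> nat set \<Rightarrow> 'k" where
  "part0 e c = (\<lambda>A. if e \<in> A then 0 else c A)"

definition part1 :: "nat \<Rightarrow> (nat set \<Rightarrow> 'k::field) \<Rightarrow> nat set \<Rightarrow> 'k" where
  "part1 e c = (\<lambda>A. if e \<in> A then 0 else rem_sign e A * c (insert e A))"

definition glue :: "nat \<Rightarrow> (nat set \<Rightarrow> 'k::field) \<Rightarrow> (nat set \<Rightarrow> 'k) \<Rightarrow> nat set \<Rightarrow> 'k" where
  "glue e c d = (\<lambda>A. if e \<in> A then rem_sign e (A - {e}) * d (A - {e}) else c A)"

definition cov_restr :: "(nat \<Rightarrow> 'v set) \<Rightarrow> 'v set \<Rightarrow> (nat set \<Rightarrow> 'k::field) \<Rightarrow> nat set \<Rightarrow> 'k" where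
  "cov_restr g S c = (\<lambda>A. if S \<subseteq> \<Union> (g ` A) then c A else 0)"

context
  fixes g :: "nat \<Rightarrow> 'v set" and I :: "nat set" and e :: nat
  assumes fin: "finite I" and e: "e \<in> I"
begin

lemma part0_chain: "c \<in> cov_chain g I S n \<Longrightarrow> part0 e c \<in> cov_chain g (I - {e}) S n"
  by (auto simp: cov_chain_def part0_def)

lemma card_insert_int:
  assumes "A \<subseteq> I" "x \<notin> A" shows "int (card (insert x A)) = int (card A) + 1"
  using assms fin finite_subset by fastforce

lemma part1_chain: 
  assumes "c \<in> cov_chain g I S n" shows "part1 e c \<in> cov_chain g (I - {e}) (S - g e) (n - 1)"
  unfolding cov_chain_def
proof (safe)
  fix A assume "part1 e c A \<noteq> 0"
  then have A: "e \<notin> A" "c (insert e A) \<noteq> 0" by (auto simp: part1_def split: if_splits)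
  then have *: "insert e A \<subseteq> I" "S \<subseteq> \<Union> (g ` insert e A)" "int (card (insert e A)) = n"
    using assms unfolding cov_chain_def by blast+
  show "int (card A) = n - 1" using * A card_insert_int[of A e] by auto
  show "\<And>x. x \<in> A \<Longrightarrow> x \<in> I" using * by auto
  show "e \<in> A \<Longrightarrow> False" using A by auto
  show "\<And>x. x \<in> S \<Longrightarrow> x \<notin> g e \<Longrightarrow> x \<in> \<Union> (g ` A)" using * by auto
qed

lemma glue_chain:
  assumes "c \<in> cov_chain g (I - {e}) S n" "d \<in> cov_chain g (I - {e}) (S - g e) (n - 1)"
  shows "glue e c d \<in> cov_chain g I S n"
  unfolding cov_chain_def
proof (intro CollectI allI impI)
  fix A assume nz: "glue e c d A \<noteq> 0"
  show "A \<subseteq> I \<and> S \<subseteq> \<Union> (g ` A) \<and> int (card A) = n"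
  proof (cases "e \<in> A")
    case False
    then show ?thesis using nz assms(1) by (auto simp: glue_def cov_chain_def)
  next
    case True
    then have "d (A - {e}) \<noteq> 0" using nz by (auto simp: glue_def)
    then have *: "A - {e} \<subseteq> I - {e}" "S - g e \<subseteq> \<Union> (g ` (A - {e}))" "int (card (A - {e})) = n - 1"
      using assms(2) unfolding cov_chain_def by auto
    then show ?thesis using True e card_insert_int[of "A - {e}" e] by (auto simp: insert_absorb)
  qed
qed

lemma part0_zero [simp]: "part0 e (\<lambda>_. 0) = (\<lambda>_. 0)"
  by (auto simp: part0_def)

lemma part1_zero [simp]: "part1 e (\<lambda>_. 0) = (\<lambda>_. 0)"
  by (auto simp: part1_def)

lemma part0_glue: "c \<in> cov_chain g (I - {e}) S n \<Longrightarrow> part0 e (glue e c d) = c"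
  by (rule ext) (auto simp: part0_def glue_def dest: cov_chain_outside)

lemma part1_glue: "d \<in> cov_chain g (I - {e}) S n \<Longrightarrow> part1 e (glue e c d) = d"
  by (rule ext) (auto simp: part1_def glue_def dest: cov_chain_outside)

lemma glue_parts: "glue e (part0 e c) (part1 e c) = c"
  by (rule ext) (auto simp: part1_def part0_def glue_def insert_absorb)

lemma eq_by_parts: "part0 e c = part0 e d \<Longrightarrow> part1 e c = part1 e d \<Longrightarrow> c = d"
  by (metis glue_parts)

text \<open>A cover without \<open>e\<close> arises by removing some other edge from a cover without
  \<open>e\<close>, or by removing \<open>e\<close> itself; the second source is the connecting map
  of the cone.\<close>

lemma part0_bd:
  assumes "c \<in> cov_chain g I S n"
  shows "part0 e (cov_bd g I S c) = (\<lambda>A. cov_bd g (I - {e}) S (part0 e c) A + cov_restr g S (part1 e c) A)"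
proof
  fix B
  show "part0 e (cov_bd g I S c) B = cov_bd g (I - {e}) S (part0 e c) B + cov_restr g S (part1 e c) B"
  proof (cases "e \<notin> B \<and> B \<subseteq> I \<and> S \<subseteq> \<Union> (g ` B)")
    case True
    have "I - B = insert e (I - {e} - B)" using True e by auto
    then have "(\<Sum>a\<in>I - B. rem_sign a B * c (insert a B)) = rem_sign e B * c (insert e B) + (\<Sum>a\<in>I - {e} - B. rem_sign a B * c (insert a B))"
      using fin by simp
    also have "(\<Sum>a\<in>I - {e} - B. rem_sign a B * c (insert a B)) = (\<Sum>a\<in>I - {e} - B. rem_sign a B * part0 e c (insert a B))"
      by (rule sum.cong) (use True in \<open>auto simp: part0_def\<close>)
    moreover have "part0 e (cov_bd g I S c) B = (\<Sum>a\<in>I - B. rem_sign a B * c (insert a B))"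
      unfolding part0_def cov_bd_def using True by simp
    moreover have "cov_bd g (I - {e}) S (part0 e c) B = (\<Sum>a\<in>I - {e} - B. rem_sign a B * part0 e c (insert a B))"
      unfolding cov_bd_def using True by auto
    moreover have "cov_restr g S (part1 e c) B = rem_sign e B * c (insert e B)"
      using True by (simp add: cov_restr_def part1_def)
    ultimately show ?thesis by simp
  next
    case False
    have "c (insert e B) = 0" if "\<not> B \<subseteq> I" using assms that cov_chain_outside by blast
    then show ?thesis using False by (auto simp: part0_def part1_def cov_bd_def cov_restr_def)
  qed
qed

text \<open>Removing \<open>e\<close> and removing another edge anticommute, which gives the minus
  sign of a shifted complex.\<close>

lemma part1_bd:
  fixes c :: "nat set \<Rightarrow> 'k::field"
  shows "part1 e (cov_bd g I S c) = (\<lambda>A. - cov_bd g (I - {e}) (S - g e) (part1 e c) A)"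
proof
  fix B
  show "part1 e (cov_bd g I S c) B = - cov_bd g (I - {e}) (S - g e) (part1 e c) B"
  proof (cases "e \<notin> B \<and> B \<subseteq> I \<and> S - g e \<subseteq> \<Union> (g ` B)")
    case True
    then have finB: "finite B" using fin finite_subset by blast
    have *: "insert e B \<subseteq> I \<and> S \<subseteq> \<Union> (g ` insert e B)" using True e by auto
    have "part1 e (cov_bd g I S c) B = rem_sign e B * (\<Sum>a\<in>I - insert e B. rem_sign a (insert e B) * c (insert a (insert e B)))"
      unfolding part1_def cov_bd_def using True * by simp
    also have "\<dots> = (\<Sum>a\<in>I - insert e B. rem_sign e B * rem_sign a (insert e B) * c (insert a (insert e B)))"
      by (simp add: sum_distrib_left mult.assoc)
    also have "\<dots> = (\<Sum>a\<in>I - {e} - B. - (rem_sign a B * part1 e c (insert a B)))"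
    proof (rule sum.cong)
      fix a assume "a \<in> I - {e} - B"
      then have a: "a \<notin> B" "a \<noteq> e" by auto
      have "rem_sign e B * rem_sign a (insert e B) = - (rem_sign a B * rem_sign e (insert a B) :: 'k)"
        using rem_sign_swap[of B a e] finB True a by (simp add: mult.commute)
      then show "rem_sign e B * rem_sign a (insert e B) * c (insert a (insert e B)) = - (rem_sign a B * part1 e c (insert a B))"
        using a True by (simp add: part1_def insert_commute)
    qed auto
    also have "\<dots> = - cov_bd g (I - {e}) (S - g e) (part1 e c) B"
      using True by (auto simp: cov_bd_def sum_negf)
    finally show ?thesis .
  next
    case False
    then show ?thesis using e by (auto simp: part1_def cov_bd_def)
  qed
qed

text \<open>Supersets of covers are covers, so the boundary at a cover of \<open>S\<close> only sees
  coefficients at covers of \<open>S\<close>.\<close>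

lemma cov_restr_bd:
  assumes "S' \<subseteq> S"
  shows "cov_restr g S (cov_bd g J S' c) = cov_bd g J S (cov_restr g S c)"
proof
  fix B
  show "cov_restr g S (cov_bd g J S' c) B = cov_bd g J S (cov_restr g S c) B"
  proof (cases "S \<subseteq> \<Union> (g ` B)")
    case True
    then have "S \<subseteq> \<Union> (g ` insert a B)" for a by auto
    then show ?thesis using True assms by (auto simp: cov_restr_def cov_bd_def)
  qed (auto simp: cov_restr_def cov_bd_def)
qed

lemma cov_restr_chain: "c \<in> cov_chain g J S' n \<Longrightarrow> cov_restr g S c \<in> cov_chain g J S n"
  by (auto simp: cov_chain_def cov_restr_def split: if_splits)

section \<open>The exact sequence of an edge and the moves derived from it\<close>

lemma not_cov_homD:
  "\<not> cov_hom T g J S n \<Longrightarrow> c \<in> cov_chain g J S n \<Longrightarrow> cov_bd g J S c = (\<lambda>_. 0)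
    \<Longrightarrow> \<exists>d \<in> cov_chain g J S (n + 1). c = cov_bd g J S d" for T :: "'k::field itself" and c :: "nat set \<Rightarrow> 'k"
  unfolding cov_hom_def by blast

text \<open>Exactness at the middle term. If both outer terms vanish, the part of a cycle that uses
  \<open>e\<close> is bounded by some \<open>y\<close>, the other part corrected by \<open>y\<close>
  is bounded by some \<open>z\<close>, and \<open>z\<close> and \<open>- y\<close> are
  glued.\<close>

lemma cov_hom_les:
  fixes T :: "'k::field itself"
  assumes "cov_hom T g I S n"
  shows "cov_hom T g (I - {e}) S n \<or> cov_hom T g (I - {e}) (S - g e) (n - 1)"
proof (rule ccontr)
  assume "\<not> ?thesis"
  then have ac0: "\<not> cov_hom T g (I - {e}) S n" and ac1: "\<not> cov_hom T g (I - {e}) (S - g e) (n - 1)" by auto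
  obtain c :: "nat set \<Rightarrow> 'k" where c: "c \<in> cov_chain g I S n" "cov_bd g I S c = (\<lambda>_. 0)"
     "c \<notin> cov_bd g I S ` cov_chain g I S (n + 1)"
    using assms unfolding cov_hom_def by blast
  have p1: "(\<lambda>A. - cov_bd g (I - {e}) (S - g e) (part1 e c) A) = (\<lambda>_. 0)"
    using part1_bd[of S c] unfolding c(2) by simp
  then have "cov_bd g (I - {e}) (S - g e) (part1 e c) = (\<lambda>_. 0)" by (simp add: fun_eq_iff)
  then obtain y where y: "y \<in> cov_chain g (I - {e}) (S - g e) n" "part1 e c = cov_bd g (I - {e}) (S - g e) y"
    using not_cov_homD[OF ac1 part1_chain[OF c(1)]] by auto
  have p0: "cov_bd g (I - {e}) S (part0 e c) A + cov_restr g S (part1 e c) A = 0" for A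
    using fun_cong[OF part0_bd[OF c(1)], of A] unfolding c(2) by simp
  \<comment> \<open>The part without \<open>e\<close> is not a cycle by itself; its boundary is
    cancelled by that of the restricted \<open>y\<close>.\<close>
  let ?w = "\<lambda>A. part0 e c A + cov_restr g S y A"
  have "cov_bd g (I - {e}) S ?w = (\<lambda>_. 0)"
    using p0 y(2) by (simp add: cov_bd_add cov_restr_bd[of "S - g e" S, symmetric])
  moreover have "?w \<in> cov_chain g (I - {e}) S n"
    using part0_chain[OF c(1)] cov_restr_chain[OF y(1)] by (rule cov_chain_add)
  ultimately obtain z where z: "z \<in> cov_chain g (I - {e}) S (n + 1)" "?w = cov_bd g (I - {e}) S z"
    using not_cov_homD[OF ac0] by blast
  let ?y = "\<lambda>A. - y A"
  let ?d = "glue e z ?y"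
  have ych: "?y \<in> cov_chain g (I - {e}) (S - g e) (n + 1 - 1)" using cov_chain_uminus[OF y(1)] by simp
  have d: "?d \<in> cov_chain g I S (n + 1)" by (rule glue_chain[OF z(1) ych])
  have "c = cov_bd g I S ?d"
  proof (rule eq_by_parts)
    show "part0 e c = part0 e (cov_bd g I S ?d)"
      unfolding part0_bd[OF d] part0_glue[OF z(1)] part1_glue[OF ych] z(2)[symmetric]
      by (auto simp: cov_restr_def)
    show "part1 e c = part1 e (cov_bd g I S ?d)"
      unfolding part1_bd part1_glue[OF ych] y(2) by (simp add: cov_bd_uminus)
  qed
  with d c(3) show False by blast
qed

text \<open>When the covers that use \<open>e\<close> contribute nothing, including the covers that
  avoid \<open>e\<close> is an isomorphism on homology.\<close>

lemma cov_hom_sub: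
  fixes T :: "'k::field itself"
  assumes ac: "\<And>m. \<not> cov_hom T g (I - {e}) (S - g e) m"
  shows "cov_hom T g I S n \<longleftrightarrow> cov_hom T g (I - {e}) S n"
proof
  assume "cov_hom T g I S n"
  then show "cov_hom T g (I - {e}) S n" using cov_hom_les ac by blast
next
  assume "cov_hom T g (I - {e}) S n"
  then obtain c :: "nat set \<Rightarrow> 'k" where c: "c \<in> cov_chain g (I - {e}) S n" "cov_bd g (I - {e}) S c = (\<lambda>_. 0)"
     "c \<notin> cov_bd g (I - {e}) S ` cov_chain g (I - {e}) S (n + 1)"
    unfolding cov_hom_def by blast
  let ?z = "\<lambda>_::nat set. 0 :: 'k"
  let ?c = "glue e c ?z"
  have ch: "?c \<in> cov_chain g I S n" by (rule glue_chain[OF c(1)]) simp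
  have p1: "part1 e ?c = ?z" by (rule part1_glue[of _ UNIV 0]) simp
  have "cov_bd g I S ?c = ?z"
    by (rule eq_by_parts)
      (auto simp: part0_bd[OF ch] part1_bd p1 part0_glue[OF c(1)] c(2) cov_restr_def)
  moreover have "?c \<notin> cov_bd g I S ` cov_chain g I S (n + 1)"
  proof
    assume "?c \<in> cov_bd g I S ` cov_chain g I S (n + 1)"
    then obtain d where d: "d \<in> cov_chain g I S (n + 1)" "?c = cov_bd g I S d" by blast
    have d1ch: "part1 e d \<in> cov_chain g (I - {e}) (S - g e) n" using part1_chain[OF d(1)] by simp
    have "(\<lambda>A. - cov_bd g (I - {e}) (S - g e) (part1 e d) A) = ?z"
      using part1_bd[of S d] p1 unfolding d(2)[symmetric] by simp
    then have "cov_bd g (I - {e}) (S - g e) (part1 e d) = ?z" by (simp add: fun_eq_iff)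
    then obtain y where y: "y \<in> cov_chain g (I - {e}) (S - g e) (n + 1)" "part1 e d = cov_bd g (I - {e}) (S - g e) y"
      using not_cov_homD[OF ac d1ch] by blast
    have "c = part0 e ?c" using part0_glue[OF c(1)] by simp
    also have "\<dots> = cov_bd g (I - {e}) S (\<lambda>A. part0 e d A + cov_restr g S y A)"
      unfolding d(2) part0_bd[OF d(1)] y(2) by (simp add: cov_bd_add cov_restr_bd)
    finally have "c = cov_bd g (I - {e}) S (\<lambda>A. part0 e d A + cov_restr g S y A)" .
    with c(3) cov_chain_add[OF part0_chain[OF d(1)] cov_restr_chain[OF y(1)]] show False by blast
  qed
  ultimately show "cov_hom T g I S n" unfolding cov_hom_def using ch by blast
qed

text \<open>The opposite case: when the covers that avoid \<open>e\<close> are acyclic, passing to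
  the part with \<open>e\<close> is an isomorphism that lowers the degree by one.\<close>

lemma cov_hom_quot:
  fixes T :: "'k::field itself"
  assumes ac: "\<And>m. \<not> cov_hom T g (I - {e}) S m"
  shows "cov_hom T g I S n \<longleftrightarrow> cov_hom T g (I - {e}) (S - g e) (n - 1)"
proof
  assume "cov_hom T g I S n"
  then show "cov_hom T g (I - {e}) (S - g e) (n - 1)" using cov_hom_les ac by blast
next
  assume "cov_hom T g (I - {e}) (S - g e) (n - 1)"
  then obtain c :: "nat set \<Rightarrow> 'k" where c: "c \<in> cov_chain g (I - {e}) (S - g e) (n - 1)"
     "cov_bd g (I - {e}) (S - g e) c = (\<lambda>_. 0)"
     "c \<notin> cov_bd g (I - {e}) (S - g e) ` cov_chain g (I - {e}) (S - g e) (n - 1 + 1)"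
    unfolding cov_hom_def by blast
  \<comment> \<open>The obstruction to completing \<open>c\<close> to a cycle of the whole complex;
    acyclicity of the covers that avoid \<open>e\<close> makes it a boundary.\<close>
  let ?r = "\<lambda>A. - cov_restr g S c A"
  have "?r \<in> cov_chain g (I - {e}) S (n - 1)" by (rule cov_chain_uminus[OF cov_restr_chain[OF c(1)]])
  moreover have "cov_bd g (I - {e}) S ?r = (\<lambda>_. 0)"
    by (simp add: cov_bd_uminus cov_restr_bd[of "S - g e" S, symmetric] c(2)) (simp add: cov_restr_def)
  ultimately obtain z where z: "z \<in> cov_chain g (I - {e}) S n" "?r = cov_bd g (I - {e}) S z"
    using not_cov_homD[OF ac] by force
  let ?c = "glue e z c"
  have ch: "?c \<in> cov_chain g I S n" by (rule glue_chain[OF z(1) c(1)])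
  have "cov_bd g I S ?c = (\<lambda>_. 0)"
    by (rule eq_by_parts)
      (auto simp: part0_bd[OF ch] part1_bd part0_glue[OF z(1)] part1_glue[OF c(1)] c(2) z(2)[symmetric])
  moreover have "?c \<notin> cov_bd g I S ` cov_chain g I S (n + 1)"
  proof
    assume "?c \<in> cov_bd g I S ` cov_chain g I S (n + 1)"
    then obtain d where d: "d \<in> cov_chain g I S (n + 1)" "?c = cov_bd g I S d" by blast
    have "c = part1 e ?c" using part1_glue[OF c(1)] by simp
    also have "\<dots> = cov_bd g (I - {e}) (S - g e) (\<lambda>A. - part1 e d A)"
      unfolding d(2) part1_bd by (simp add: cov_bd_uminus)
    finally show False using c(3) cov_chain_uminus[OF part1_chain[OF d(1)]] by auto
  qed
  ultimately show "cov_hom T g I S n" unfolding cov_hom_def using ch by blast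
qed

text \<open>Whether \<open>e\<close> belongs to a set does not affect covering \<open>S\<close>, so
  adding \<open>e\<close> is a contracting homotopy.\<close>

lemma cov_hom_useless:
  fixes T :: "'k::field itself"
  assumes disj: "g e \<inter> S = {}"
  shows "\<not> cov_hom T g I S n"
proof
  assume "cov_hom T g I S n"
  then obtain c :: "nat set \<Rightarrow> 'k" where c: "c \<in> cov_chain g I S n" "cov_bd g I S c = (\<lambda>_. 0)"
     "c \<notin> cov_bd g I S ` cov_chain g I S (n + 1)"
    unfolding cov_hom_def by blast
  have S: "S - g e = S" using disj by auto
  have r: "cov_restr g S d = d" if "d \<in> cov_chain g J S m" for d :: "nat set \<Rightarrow> 'k" and J m
    using that unfolding cov_restr_def cov_chain_def by (intro ext) auto
  have p0: "cov_bd g (I - {e}) S (part0 e c) A + part1 e c A = 0" for A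
    using fun_cong[OF part0_bd[OF c(1)], of A] r[OF part1_chain[OF c(1), unfolded S]] unfolding c(2) by simp
  have zch: "part0 e c \<in> cov_chain g (I - {e}) (S - g e) (n + 1 - 1)" using part0_chain[OF c(1)] S by simp
  let ?d = "glue e (\<lambda>_. 0) (part0 e c)"
  have ch: "?d \<in> cov_chain g I S (n + 1)" by (rule glue_chain[OF cov_chain_zero zch])
  have "c = cov_bd g I S ?d"
  proof (rule eq_by_parts)
    show "part0 e c = part0 e (cov_bd g I S ?d)"
      unfolding part0_bd[OF ch] part0_glue[OF cov_chain_zero] part1_glue[OF zch]
      using r[OF zch[unfolded S]] by simp
    show "part1 e c = part1 e (cov_bd g I S ?d)"
      unfolding part1_bd part1_glue[OF zch] S using p0 by (auto simp: eq_neg_iff_add_eq_0 add.commute)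
  qed
  with ch c(3) show False by blast
qed

text \<open>Every cover contains \<open>e\<close>, so the covers that avoid \<open>e\<close> form
  the zero complex.\<close>

lemma cov_hom_forced:
  assumes "x \<in> S" "\<And>a. a \<in> I \<Longrightarrow> x \<in> g a \<Longrightarrow> a = e"
  shows "cov_hom T g I S n \<longleftrightarrow> cov_hom T g (I - {e}) (S - g e) (n - 1)"
  by (rule cov_hom_quot, rule cov_hom_uncovered[of x]) (use assms in auto)

end

text \<open>Once \<open>f\<close> is used, \<open>e\<close> meets nothing that remains to be
  covered; so the covers with \<open>f\<close> are acyclic and \<open>f\<close> can be
  deleted.\<close>

lemma cov_hom_dominated:
  assumes "finite I" "e \<in> I" "F \<subseteq> I - {e}" "\<And>f. f \<in> F \<Longrightarrow> g e \<inter> S \<subseteq> g f"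
  shows "cov_hom T g I S n \<longleftrightarrow> cov_hom T g (I - F) S n"
proof -
  have "finite F" using assms(1,3) finite_subset by blast
  then show ?thesis using assms(3,4)
  proof (induction F)
    case (insert f F)
    have "cov_hom T g (I - F) S n \<longleftrightarrow> cov_hom T g (I - F - {f}) S n"
    proof (rule cov_hom_sub)
      show "\<not> cov_hom T g (I - F - {f}) (S - g f) m" for m
        by (rule cov_hom_useless[of _ e]) (use insert assms(1,2) in auto)
    qed (use assms(1) insert.hyps insert.prems(1) in auto)
    moreover have "cov_hom T g I S n \<longleftrightarrow> cov_hom T g (I - F) S n"
      by (rule insert.IH) (use insert.prems in auto)
    moreover have "I - insert f F = I - F - {f}" by auto
    ultimately show ?case by (simp only:)
  qed simp
qed

section \<open>Covers of paths and cycles\<close>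

lemma div_3_shift:
  fixes m :: nat
  assumes "m mod 3 = r" "(m + k) mod 3 = r'" "r + k = r' + 3 * j"
  shows "(m + k) div 3 = m div 3 + j"
  using assms div_mult_mod_eq[of m 3] div_mult_mod_eq[of "m + k" 3] by linarith

text \<open>Only the \<open>m\<close> inner vertices of the path have to be covered. The first edge
  then covers just \<open>x (a + 1)\<close>, so it makes the second edge deletable and is forced
  afterwards; now \<open>\<epsilon> (a + 2)\<close> is forced at \<open>x (a + 2)\<close>. Its far
  end is covered too, so the same problem remains with \<open>m - 3\<close> inner vertices and
  degree \<open>n - 2\<close>.\<close>

lemma cov_hom_path:
  fixes T :: "'k::field itself"
  assumes "inj_on x {a..a + m + 1}" "inj_on \<epsilon> {a..a + m}"
    and "\<And>i. i \<in> {a..a + m} \<Longrightarrow> g (\<epsilon> i) = {x i, x (Suc i)}"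
  shows "cov_hom T g (\<epsilon> ` {a..a + m}) (x ` {a + 1..a + m}) n \<longleftrightarrow>
    m mod 3 = 1 \<and> n = 2 * int (m div 3) + 1 \<or> m mod 3 = 2 \<and> n = 2 * int (m div 3) + 2"
  using assms
proof (induction m arbitrary: a n rule: less_induct)
  case (less m)
  note injx = inj_on_eq_iff[OF less.prems(1)] and inje = inj_on_eq_iff[OF less.prems(2)] and g = less.prems(3)
  note xdiff = inj_on_image_set_diff[OF less.prems(1), symmetric] and ediff = inj_on_image_set_diff[OF less.prems(2), symmetric]
  let ?I = "\<epsilon> ` {a..a + m}" and ?S = "x ` {a + 1..a + m}"
  show ?case
  proof (cases "m = 0")
    case True
    then have "\<not> cov_hom T g ?I ?S n"
      by (intro cov_hom_useless[of _ "\<epsilon> a"]) auto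
    then show ?thesis using True by simp
  next
    case False
    let ?J = "?I - {\<epsilon> (a + 1)}"
    have "cov_hom T g ?I ?S n \<longleftrightarrow> cov_hom T g ?J ?S n"
    proof (rule cov_hom_dominated)
      show "\<epsilon> a \<in> ?I" "{\<epsilon> (a + 1)} \<subseteq> ?I - {\<epsilon> a}" using False inje[of "a + 1" a] by auto
      have "x a \<notin> ?S"
      proof
        assume "x a \<in> ?S"
        then obtain i where "i \<in> {a + 1..a + m}" "x a = x i" by blast
        then show False using injx[of a i] by auto
      qed
      then show "g (\<epsilon> a) \<inter> ?S \<subseteq> g f" if "f \<in> {\<epsilon> (a + 1)}" for f
        using g[of a] g[of "a + 1"] False that by auto
    qed simp
    also have "\<dots> \<longleftrightarrow> cov_hom T g (?J - {\<epsilon> a}) (?S - g (\<epsilon> a)) (n - 1)"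
    proof (rule cov_hom_forced[of _ _ "x (a + 1)"])
      show "\<epsilon> a \<in> ?J" using False inje[of a "a + 1"] by auto
      show "x (a + 1) \<in> ?S" using False by auto
      fix e assume "e \<in> ?J" "x (a + 1) \<in> g e"
      then obtain i where i: "i \<in> {a..a + m}" "e = \<epsilon> i" "e \<noteq> \<epsilon> (a + 1)" "x (a + 1) \<in> {x i, x (Suc i)}"
        using g by auto
      then have "i = a" using injx[of "a + 1" i] injx[of "a + 1" "Suc i"] by auto
      then show "e = \<epsilon> a" using i by simp
    qed simp
    also have "?J - {\<epsilon> a} = \<epsilon> ` {a + 2..a + m}"
    proof -
      have "?J - {\<epsilon> a} = ?I - \<epsilon> ` {a, a + 1}" by auto
      also have "\<dots> = \<epsilon> ` ({a..a + m} - {a, a + 1})" by (rule ediff) (use False in auto)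
      also have "{a..a + m} - {a, a + 1} = {a + 2..a + m}" by auto
      finally show ?thesis .
    qed
    also have "?S - g (\<epsilon> a) = x ` {a + 2..a + m}"
    proof -
      have "?S - g (\<epsilon> a) = ?S - x ` {a, a + 1}" using g[of a] by auto
      also have "\<dots> = x ` ({a + 1..a + m} - {a, a + 1})" by (rule xdiff) (use False in auto)
      also have "{a + 1..a + m} - {a, a + 1} = {a + 2..a + m}" by auto
      finally show ?thesis .
    qed
    finally have 1: "cov_hom T g ?I ?S n \<longleftrightarrow> cov_hom T g (\<epsilon> ` {a + 2..a + m}) (x ` {a + 2..a + m}) (n - 1)" .
    \<comment> \<open>For \<open>m = 1\<close>, and below for \<open>m = 2\<close>, the forced edges
      exhaust the path and the empty cover fixes the degree.\<close>
    show ?thesis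
    proof (cases "m = 1")
      case True
      then show ?thesis using 1 by (auto simp: cov_hom_empty)
    next
      case m: False
      let ?I = "\<epsilon> ` {a + 2..a + m}" and ?S = "x ` {a + 2..a + m}"
      have "cov_hom T g ?I ?S (n - 1) \<longleftrightarrow> cov_hom T g (?I - {\<epsilon> (a + 2)}) (?S - g (\<epsilon> (a + 2))) (n - 1 - 1)"
      proof (rule cov_hom_forced[of _ _ "x (a + 2)"])
        fix e assume "e \<in> ?I" "x (a + 2) \<in> g e"
        then obtain i where i: "i \<in> {a + 2..a + m}" "e = \<epsilon> i" "x (a + 2) \<in> {x i, x (Suc i)}"
          using g by auto
        then have "i = a + 2" using injx[of "a + 2" i] injx[of "a + 2" "Suc i"] by auto
        then show "e = \<epsilon> (a + 2)" using i by simp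
      qed (use m False in auto)
      also have "?I - {\<epsilon> (a + 2)} = \<epsilon> ` {a + 3..a + m}"
      proof -
        have "?I - {\<epsilon> (a + 2)} = ?I - \<epsilon> ` {a + 2}" by auto
        also have "\<dots> = \<epsilon> ` ({a + 2..a + m} - {a + 2})" by (rule ediff) (use m False in auto)
        also have "{a + 2..a + m} - {a + 2} = {a + 3..a + m}" by auto
        finally show ?thesis .
      qed
      also have "?S - g (\<epsilon> (a + 2)) = x ` {a + 4..a + m}"
      proof -
        have "?S - g (\<epsilon> (a + 2)) = ?S - x ` {a + 2, a + 3}"
          using g[of "a + 2"] m False by (auto simp: numeral_3_eq_3)
        also have "\<dots> = x ` ({a + 2..a + m} - {a + 2, a + 3})" by (rule xdiff) (use m False in auto)
        also have "{a + 2..a + m} - {a + 2, a + 3} = {a + 4..a + m}" by auto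
        finally show ?thesis .
      qed
      finally have 2: "cov_hom T g ?I ?S (n - 1) \<longleftrightarrow> cov_hom T g (\<epsilon> ` {a + 3..a + m}) (x ` {a + 4..a + m}) (n - 2)"
        by simp
      show ?thesis
      proof (cases "m = 2")
        case True
        then show ?thesis using 1 2 by (auto simp: cov_hom_empty)
      next
        case m2: False
        with m False obtain k where k: "m = k + 3" using that[of "m - 3"] by simp
        have "cov_hom T g (\<epsilon> ` {a + 3..a + 3 + k}) (x ` {a + 3 + 1..a + 3 + k}) (n - 2) \<longleftrightarrow>
          k mod 3 = 1 \<and> n - 2 = 2 * int (k div 3) + 1 \<or> k mod 3 = 2 \<and> n - 2 = 2 * int (k div 3) + 2"
          using k by (intro less.IH inj_on_subset[OF less.prems(1)] inj_on_subset[OF less.prems(2)] g) auto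
        moreover have "{a + 3..a + m} = {a + 3..a + 3 + k}" "{a + 4..a + m} = {a + 3 + 1..a + 3 + k}" using k by auto
        moreover have "m mod 3 = k mod 3" "m div 3 = k div 3 + 1" using k by auto
        ultimately show ?thesis using 1 2 by (simp add: algebra_simps)
      qed
    qed
  qed
qed

section \<open>Cycles, opened at the edge \<open>\<epsilon> 0\<close>\<close>

context
  fixes T :: "'k::field itself" and c :: "nat \<Rightarrow> 'v" and \<epsilon> :: "nat \<Rightarrow> nat" and n :: nat and g :: "nat \<Rightarrow> 'v set"
  assumes n3: "n \<ge> 3" and injc: "inj_on c {..<n}" and inje: "inj_on \<epsilon> {..<n}"
    and g: "\<And>i. i < n \<Longrightarrow> g (\<epsilon> i) = {c i, c (Suc i mod n)}"
begin

text \<open>Without \<open>\<epsilon> 0\<close> each of its ends \<open>c 1\<close> and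
  \<open>c 0\<close> lies on one edge only, and these two edges are forced. They leave a path with
  \<open>n - 4\<close> inner vertices, or nothing at all if \<open>n = 3\<close>.\<close>

lemma cycle_minus_edge: "cov_hom T g (\<epsilon> ` {..<n} - {\<epsilon> 0}) (c ` {..<n}) d \<longleftrightarrow>
    n mod 3 = 2 \<and> d = 2 * int (n div 3) + 1 \<or> n mod 3 = 0 \<and> d = 2 * int (n div 3)"
proof -
  note injx = inj_on_eq_iff[OF injc]
  note xdiff = inj_on_image_set_diff[OF injc, symmetric] and ediff = inj_on_image_set_diff[OF inje, symmetric]
  let ?I = "\<epsilon> ` {..<n} - {\<epsilon> 0}"
  have I: "?I = \<epsilon> ` {1..<n}"
  proof -
    have "?I = \<epsilon> ` {..<n} - \<epsilon> ` {0}" by auto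
    also have "\<dots> = \<epsilon> ` ({..<n} - {0})" by (rule ediff) (use n3 in auto)
    also have "{..<n} - {0} = {1..<n}" by auto
    finally show ?thesis .
  qed
  have "cov_hom T g (\<epsilon> ` {1..<n}) (c ` {..<n}) d \<longleftrightarrow> cov_hom T g (\<epsilon> ` {1..<n} - {\<epsilon> 1}) (c ` {..<n} - g (\<epsilon> 1)) (d - 1)"
  proof (rule cov_hom_forced[of _ _ "c 1"])
    fix e assume "e \<in> \<epsilon> ` {1..<n}" "c 1 \<in> g e"
    then obtain i where i: "i \<in> {1..<n}" "e = \<epsilon> i" "c 1 \<in> {c i, c (Suc i mod n)}" using g by auto
    then have "i = 1" using injx[of 1 i] injx[of 1 "Suc i mod n"] n3
      by (cases "Suc i = n") auto
    then show "e = \<epsilon> 1" using i by simp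
  qed (use n3 in auto)
  also have "\<epsilon> ` {1..<n} - {\<epsilon> 1} = \<epsilon> ` {2..<n}"
  proof -
    have "\<epsilon> ` {1..<n} - {\<epsilon> 1} = \<epsilon> ` {1..<n} - \<epsilon> ` {1}" by auto
    also have "\<dots> = \<epsilon> ` ({1..<n} - {1})" by (rule ediff) (use n3 in auto)
    also have "{1..<n} - {1} = {2..<n}" by auto
    finally show ?thesis .
  qed
  also have "c ` {..<n} - g (\<epsilon> 1) = c ` ({..<n} - {1, 2})"
  proof -
    have "c ` {..<n} - g (\<epsilon> 1) = c ` {..<n} - c ` {1, 2}" using g[of 1] n3 by (simp add: numeral_2_eq_2)
    also have "\<dots> = c ` ({..<n} - {1, 2})" by (rule xdiff) (use n3 in auto)
    finally show ?thesis .
  qed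
  also have "cov_hom T g (\<epsilon> ` {2..<n}) (c ` ({..<n} - {1, 2})) (d - 1) \<longleftrightarrow>
      cov_hom T g (\<epsilon> ` {2..<n} - {\<epsilon> (n - 1)}) (c ` ({..<n} - {1, 2}) - g (\<epsilon> (n - 1))) (d - 1 - 1)"
  proof (rule cov_hom_forced[of _ _ "c 0"])
    fix e assume "e \<in> \<epsilon> ` {2..<n}" "c 0 \<in> g e"
    then obtain i where i: "i \<in> {2..<n}" "e = \<epsilon> i" "c 0 \<in> {c i, c (Suc i mod n)}" using g by auto
    then have "Suc i mod n = 0" using injx[of 0 i] injx[of 0 "Suc i mod n"] n3 by auto
    then have "i = n - 1" using i(1) by (auto simp: mod_Suc split: if_splits)
    then show "e = \<epsilon> (n - 1)" using i by simp
  qed (use n3 in auto)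
  also have "\<epsilon> ` {2..<n} - {\<epsilon> (n - 1)} = \<epsilon> ` {2..<n - 1}"
  proof -
    have "\<epsilon> ` {2..<n} - {\<epsilon> (n - 1)} = \<epsilon> ` {2..<n} - \<epsilon> ` {n - 1}" by auto
    also have "\<dots> = \<epsilon> ` ({2..<n} - {n - 1})" by (rule ediff) (use n3 in auto)
    also have "{2..<n} - {n - 1} = {2..<n - 1}" by auto
    finally show ?thesis .
  qed
  also have "c ` ({..<n} - {1, 2}) - g (\<epsilon> (n - 1)) = c ` {3..<n - 1}"
  proof -
    have "c ` ({..<n} - {1, 2}) - g (\<epsilon> (n - 1)) = c ` ({..<n} - {1, 2}) - c ` {n - 1, 0}" using g[of "n - 1"] n3 by simp
    also have "\<dots> = c ` ({..<n} - {1, 2} - {n - 1, 0})" by (rule xdiff) (use n3 in auto)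
    also have "{..<n} - {1, 2} - {n - 1, 0} = {3..<n - 1}" by auto
    finally show ?thesis .
  qed
  finally have 1: "cov_hom T g ?I (c ` {..<n}) d \<longleftrightarrow> cov_hom T g (\<epsilon> ` {2..<n - 1}) (c ` {3..<n - 1}) (d - 2)"
    unfolding I by simp
  show ?thesis
  proof (cases "n = 3")
    case True
    then show ?thesis using 1 by (auto simp: cov_hom_empty)
  next
    case False
    then obtain m where m: "n = m + 4" using n3 that[of "n - 4"] by simp
    have "cov_hom T g (\<epsilon> ` {2..2 + m}) (c ` {2 + 1..2 + m}) (d - 2) \<longleftrightarrow>
      m mod 3 = 1 \<and> d - 2 = 2 * int (m div 3) + 1 \<or> m mod 3 = 2 \<and> d - 2 = 2 * int (m div 3) + 2"
      using m by (intro cov_hom_path inj_on_subset[OF injc] inj_on_subset[OF inje]) (auto simp: g)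
    moreover have "{2..<n - 1} = {2..2 + m}" "{3..<n - 1} = {2 + 1..2 + m}" using m by auto
    ultimately have e: "cov_hom T g ?I (c ` {..<n}) d \<longleftrightarrow>
      m mod 3 = 1 \<and> d - 2 = 2 * int (m div 3) + 1 \<or> m mod 3 = 2 \<and> d - 2 = 2 * int (m div 3) + 2"
      using 1 by (simp only:)
    consider "m mod 3 = 0" "n mod 3 = 1" | "m mod 3 = 1" "n mod 3 = 2" "n div 3 = m div 3 + 1"
      | "m mod 3 = 2" "n mod 3 = 0" "n div 3 = m div 3 + 2"
    proof -
      have "m mod 3 = 0 \<and> (m + 4) mod 3 = 1 \<or> m mod 3 = 1 \<and> (m + 4) mod 3 = 2 \<or> m mod 3 = 2 \<and> (m + 4) mod 3 = 0"
        by presburger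
      then show ?thesis using that div_3_shift[of m 1 4 2 1] div_3_shift[of m 2 4 0 2] unfolding m by fastforce
    qed
    then show ?thesis unfolding e by cases auto
  qed
qed

text \<open>Once \<open>\<epsilon> 0\<close> is used, the other edges form a path whose two ends are
  already covered, with \<open>n - 2\<close> inner vertices.\<close>

lemma cycle_quot: "cov_hom T g (\<epsilon> ` {..<n} - {\<epsilon> 0}) (c ` {..<n} - g (\<epsilon> 0)) d \<longleftrightarrow>
    n mod 3 = 0 \<and> d = 2 * int (n div 3) - 1 \<or> n mod 3 = 1 \<and> d = 2 * int (n div 3)"
proof -
  obtain m where m: "n = m + 2" using n3 that[of "n - 2"] by simp
  \<comment> \<open>Reduction mod \<open>n\<close> lets the path run up to index \<open>n\<close>,
    which stands for \<open>c 0\<close>.\<close>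
  let ?x = "\<lambda>i. c (i mod n)"
  have "\<epsilon> ` {..<n} - {\<epsilon> 0} = \<epsilon> ` {..<n} - \<epsilon> ` {0}" by auto
  also have "\<dots> = \<epsilon> ` ({..<n} - {0})" by (rule inj_on_image_set_diff[OF inje, symmetric]) (use n3 in auto)
  also have "{..<n} - {0} = {1..1 + m}" using m by auto
  finally have I: "\<epsilon> ` {..<n} - {\<epsilon> 0} = \<epsilon> ` {1..1 + m}" .
  have "c ` {..<n} - g (\<epsilon> 0) = c ` {..<n} - c ` {0, 1}" using g[of 0] n3 by simp
  also have "\<dots> = c ` ({..<n} - {0, 1})" by (rule inj_on_image_set_diff[OF injc, symmetric]) (use n3 in auto)
  also have "{..<n} - {0, 1} = {1 + 1..1 + m}" using m by auto
  also have "c ` {1 + 1..1 + m} = ?x ` {1 + 1..1 + m}" using m by (intro image_cong) auto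
  finally have S: "c ` {..<n} - g (\<epsilon> 0) = ?x ` {1 + 1..1 + m}" .
  have "inj_on (\<lambda>i. i mod n) {1..1 + m + 1}"
  proof (rule inj_onI)
    fix i j assume "i \<in> {1..1 + m + 1}" "j \<in> {1..1 + m + 1}" "i mod n = j mod n"
    moreover have "k mod n = (if k = n then 0 else k)" if "k \<in> {1..1 + m + 1}" for k using that m by auto
    ultimately show "i = j" by (auto split: if_splits)
  qed
  then have "inj_on ?x {1..1 + m + 1}" using injc n3
    by (intro comp_inj_on[of "\<lambda>i. i mod n" _ c, unfolded comp_def]) (auto intro: inj_on_subset)
  moreover have "inj_on \<epsilon> {1..1 + m}" by (rule inj_on_subset[OF inje]) (use m in auto)
  moreover have "g (\<epsilon> i) = {?x i, ?x (Suc i)}" if "i \<in> {1..1 + m}" for i using g[of i] that m by auto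
  ultimately have "cov_hom T g (\<epsilon> ` {1..1 + m}) (?x ` {1 + 1..1 + m}) d \<longleftrightarrow>
     m mod 3 = 1 \<and> d = 2 * int (m div 3) + 1 \<or> m mod 3 = 2 \<and> d = 2 * int (m div 3) + 2"
    by (rule cov_hom_path)
  then have e: "cov_hom T g (\<epsilon> ` {..<n} - {\<epsilon> 0}) (c ` {..<n} - g (\<epsilon> 0)) d \<longleftrightarrow>
     m mod 3 = 1 \<and> d = 2 * int (m div 3) + 1 \<or> m mod 3 = 2 \<and> d = 2 * int (m div 3) + 2"
    unfolding I S by (simp only:)
  consider "m mod 3 = 0" "n mod 3 = 2" | "m mod 3 = 1" "n mod 3 = 0" "n div 3 = m div 3 + 1"
    | "m mod 3 = 2" "n mod 3 = 1" "n div 3 = m div 3 + 1"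
  proof -
    have "m mod 3 = 0 \<and> (m + 2) mod 3 = 2 \<or> m mod 3 = 1 \<and> (m + 2) mod 3 = 0 \<or> m mod 3 = 2 \<and> (m + 2) mod 3 = 1"
      by presburger
    then show ?thesis using that div_3_shift[of m 1 2 0 1] div_3_shift[of m 2 2 1 1] unfolding m by fastforce
  qed
  then show ?thesis unfolding e by cases auto
qed

text \<open>Both outer terms of the exact sequence are known. Only the covers that avoid
  \<open>\<epsilon> 0\<close>, with \<open>n mod 3 = 2\<close>, reach a value above
  \<open>n div 3\<close>.\<close>

lemma cov_hom_cycle_le:
  assumes "cov_hom T g (\<epsilon> ` {..<n}) (c ` {..<n}) d"
  shows "int n - d \<le> int (n div 3) + (if n mod 3 = 2 then 1 else 0)"
proof -
  have "cov_hom T g (\<epsilon> ` {..<n} - {\<epsilon> 0}) (c ` {..<n}) d \<or> cov_hom T g (\<epsilon> ` {..<n} - {\<epsilon> 0}) (c ` {..<n} - g (\<epsilon> 0)) (d - 1)"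
    by (rule cov_hom_les) (use assms n3 in auto)
  moreover have "int n = 3 * int (n div 3) + int (n mod 3)"
    by (metis of_nat_add of_nat_mult of_nat_numeral mult_div_mod_eq)
  ultimately show ?thesis unfolding cycle_minus_edge cycle_quot by auto
qed

text \<open>For this residue the covers that use \<open>\<epsilon> 0\<close> are acyclic, so the
  class of the opened cycle survives; its degree \<open>2 * (n div 3) + 1\<close> is
  rewritten.\<close>

lemma cov_hom_cycle:
  assumes "n mod 3 = 2"
  shows "cov_hom T g (\<epsilon> ` {..<n}) (c ` {..<n}) (int n - int (n div 3) - 1)"
proof -
  have "cov_hom T g (\<epsilon> ` {..<n}) (c ` {..<n}) d \<longleftrightarrow> cov_hom T g (\<epsilon> ` {..<n} - {\<epsilon> 0}) (c ` {..<n}) d" for d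
    by (rule cov_hom_sub) (use assms n3 cycle_quot in auto)
  moreover have "int n = 3 * int (n div 3) + int (n mod 3)"
    by (metis of_nat_add of_nat_mult of_nat_numeral mult_div_mod_eq)
  ultimately show ?thesis unfolding cycle_minus_edge using assms by auto
qed

end

section \<open>Induced subgraphs and leaves\<close>

text \<open>Edges carry natural numbers as labels because the signs of the boundary need a linear
  order.\<close>

locale edge_family =
  fixes I :: "nat set" and g :: "nat \<Rightarrow> 'v set" and E :: "'v set set"
  assumes fin_I: "finite I" and inj_g: "inj_on g I" and g_image: "g ` I = E"
    and edge_pair: "e \<in> E \<Longrightarrow> \<exists>u v. u \<noteq> v \<and> e = {u, v}"
begin

definition edges_in :: "'v set \<Rightarrow> nat set" where
  "edges_in S = {a \<in> I. g a \<subseteq> S}"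

definition nbrs :: "'v set \<Rightarrow> 'v \<Rightarrow> 'v set" where
  "nbrs S u = {v \<in> S. {u, v} \<in> E}"

definition ind_hom :: "'k::field itself \<Rightarrow> 'v set \<Rightarrow> int \<Rightarrow> bool" where
  "ind_hom T S n = cov_hom T g (edges_in S) S n"

definition ind_match :: "'v set set \<Rightarrow> bool" where
  "ind_match M \<longleftrightarrow> M \<subseteq> E \<and> pairwise disjnt M \<and> (\<forall>e \<in> E. e \<subseteq> \<Union> M \<longrightarrow> e \<in> M)"

definition ind_match_num :: "'v set \<Rightarrow> nat" where
  "ind_match_num X = Max {card M | M. ind_match M \<and> \<Union> M \<subseteq> X}"

lemma fin_edges_in: "finite (edges_in S)"
  using fin_I by (simp add: edges_in_def)

lemma not_loop: "{u, v} \<in> E \<Longrightarrow> u \<noteq> v"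
  using edge_pair[of "{u, v}"] by (auto simp: doubleton_eq_iff)

lemma singleton_not_edge [simp]: "{v} \<notin> E"
  using not_loop[of v v] by auto

lemma edge_sym: "{u, v} \<in> E \<Longrightarrow> {v, u} \<in> E"
  by (simp add: insert_commute)

lemma edge_finite: "e \<in> E \<Longrightarrow> finite e"
  using edge_pair by fastforce

lemma edge_card: "e \<in> E \<Longrightarrow> card e = 2"
  using edge_pair card_2_iff by metis

lemma empty_not_edge [simp]: "{} \<notin> E"
  using edge_card by fastforce

lemma edge_other:
  assumes "e \<in> E" "u \<in> e"
  obtains v where "e = {u, v}" "v \<noteq> u"
  using edge_pair[OF assms(1)] assms(2) by (metis insertE insert_commute singletonD)

lemma edge_index:
  assumes "e \<in> E"
  obtains a where "a \<in> I" "g a = e"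
  using assms g_image by auto

lemma g_in_E: "a \<in> I \<Longrightarrow> g a \<in> E"
  using g_image by auto

lemma g_inj: "a \<in> I \<Longrightarrow> b \<in> I \<Longrightarrow> g a = g b \<Longrightarrow> a = b"
  using inj_g by (auto dest: inj_onD)

section \<open>Isolated vertices and leaves of induced subgraphs\<close>

lemma ind_hom_isolated:
  assumes "u \<in> S" "nbrs S u = {}"
  shows "\<not> ind_hom T S n"
  unfolding ind_hom_def
proof (rule cov_hom_uncovered[OF assms(1)])
  fix a assume a: "a \<in> edges_in S"
  show "u \<notin> g a"
  proof
    assume "u \<in> g a"
    moreover have "g a \<in> E" "g a \<subseteq> S" using a g_in_E by (auto simp: edges_in_def)
    ultimately obtain v where "g a = {u, v}" using edge_other by metis
    then have "v \<in> nbrs S u" using \<open>g a \<in> E\<close> \<open>g a \<subseteq> S\<close> by (auto simp: nbrs_def)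
    then show False using assms(2) by simp
  qed
qed

lemma leaf_edge:
  assumes "nbrs S u = {v}" "a \<in> edges_in S" "u \<in> g a"
  shows "g a = {u, v}"
proof -
  have "g a \<in> E" "g a \<subseteq> S" using assms(2) g_in_E by (auto simp: edges_in_def)
  then obtain x where x: "g a = {u, x}" using edge_other assms(3) by metis
  then have "x \<in> nbrs S u" using \<open>g a \<in> E\<close> \<open>g a \<subseteq> S\<close> by (auto simp: nbrs_def)
  then show ?thesis using assms(1) x by simp
qed

text \<open>The neighbour \<open>v\<close> of a leaf \<open>u\<close> is covered as soon as \<open>u\<close> is.\<close>

lemma leaf_drop:
  assumes "u \<in> S" "v \<in> S" "nbrs S u = {v}"
  shows "ind_hom T S n \<longleftrightarrow> cov_hom T g (edges_in S) (S - {v}) n"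
  unfolding ind_hom_def
proof (rule cov_hom_cong)
  fix A assume A: "A \<subseteq> edges_in S"
  have "u \<noteq> v" using assms(3) not_loop by (auto simp: nbrs_def)
  show "S \<subseteq> \<Union> (g ` A) \<longleftrightarrow> S - {v} \<subseteq> \<Union> (g ` A)"
  proof
    assume *: "S - {v} \<subseteq> \<Union> (g ` A)"
    then obtain a where "a \<in> A" "u \<in> g a" using assms(1) \<open>u \<noteq> v\<close> by blast
    then have "v \<in> \<Union> (g ` A)" using leaf_edge[OF assms(3), of a] A by auto
    then show "S \<subseteq> \<Union> (g ` A)" using * by blast
  qed blast
qed

text \<open>With \<open>v\<close> taken off the vertices to be covered, \<open>vw\<close> only has
  to reach \<open>w\<close>. So all other edges at \<open>w\<close> are deletable and
  \<open>vw\<close> is forced. Since \<open>u\<close> remains a leaf at \<open>v\<close>,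
  \<open>v\<close> can be put back afterwards.\<close>

lemma leaf_remove_nbr:
  assumes "u \<in> S" "v \<in> S" "nbrs S u = {v}" "w \<in> nbrs S v" "w \<noteq> u"
  shows "ind_hom T S n \<longleftrightarrow> ind_hom T (S - {w}) (n - 1)"
proof -
  have w: "w \<in> S" "{v, w} \<in> E" "w \<noteq> v" using assms(4) not_loop by (auto simp: nbrs_def)
  obtain e where e: "e \<in> I" "g e = {v, w}" using edge_index w(2) by metis
  have eS: "e \<in> edges_in S" using e w assms(2) by (auto simp: edges_in_def)
  define F where "F = {a \<in> edges_in S. w \<in> g a \<and> a \<noteq> e}"
  have "ind_hom T S n \<longleftrightarrow> cov_hom T g (edges_in S) (S - {v}) n" by (rule leaf_drop[OF assms(1-3)])
  also have "\<dots> \<longleftrightarrow> cov_hom T g (edges_in S - F) (S - {v}) n"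
    by (rule cov_hom_dominated[OF fin_edges_in eS]) (auto simp: F_def e(2))
  also have "\<dots> \<longleftrightarrow> cov_hom T g (edges_in S - F - {e}) (S - {v} - g e) (n - 1)"
    by (rule cov_hom_forced[of _ _ w]) (use eS w fin_edges_in in \<open>auto simp: F_def\<close>)
  also have "edges_in S - F - {e} = edges_in (S - {w})"
    using e by (auto simp: F_def edges_in_def)
  also have "S - {v} - g e = S - {w} - {v}" using e by auto
  also have "cov_hom T g (edges_in (S - {w})) (S - {w} - {v}) (n - 1) \<longleftrightarrow> ind_hom T (S - {w}) (n - 1)"
    by (rule leaf_drop[symmetric, of u]) (use assms w in \<open>auto simp: nbrs_def\<close>)
  finally show ?thesis .
qed

text \<open>After the other neighbours of \<open>v\<close> are gone, \<open>uv\<close> is an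
  isolated edge and forced. Every neighbour of \<open>v\<close>, with \<open>u\<close> among them,
  accounts for one edge of the cover.\<close>

lemma leaf_reduce:
  assumes "finite S" "u \<in> S" "v \<in> S" "nbrs S u = {v}"
  shows "ind_hom T S n \<longleftrightarrow> ind_hom T (S - insert v (nbrs S v)) (n - int (card (nbrs S v)))"
proof -
  have uv: "{u, v} \<in> E" "u \<noteq> v" using assms(4) not_loop by (auto simp: nbrs_def)
  have rem: "ind_hom T S n \<longleftrightarrow> ind_hom T (S - W) (n - int (card W))" if "finite W" "W \<subseteq> nbrs S v - {u}" for W
    using that
  proof (induction W)
    case (insert w W)
    have v: "v \<notin> nbrs S v" using not_loop by (auto simp: nbrs_def)
    have "ind_hom T (S - W) (n - int (card W)) \<longleftrightarrow> ind_hom T (S - W - {w}) (n - int (card W) - 1)"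
      by (rule leaf_remove_nbr[of u _ v]) (use insert.prems insert.hyps assms v in \<open>auto simp: nbrs_def\<close>)
    moreover have "S - W - {w} = S - insert w W" "n - int (card W) - 1 = n - int (card (insert w W))"
      using insert.hyps by auto
    moreover have "ind_hom T S n \<longleftrightarrow> ind_hom T (S - W) (n - int (card W))"
      by (rule insert.IH) (use insert.prems in auto)
    ultimately show ?case by simp
  qed simp
  define W where "W = nbrs S v - {u}"
  have u: "u \<in> nbrs S v" using assms uv by (simp add: nbrs_def insert_commute)
  have finN: "finite (nbrs S v)" using assms(1) by (simp add: nbrs_def)
  obtain e where e: "e \<in> I" "g e = {u, v}" using edge_index uv(1) by metis
  have vW: "v \<notin> W" "u \<notin> W" using not_loop by (auto simp: W_def nbrs_def)
  have nu: "nbrs (S - W) u = {v}" using assms vW by (auto simp: nbrs_def)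
  have "ind_hom T S n \<longleftrightarrow> ind_hom T (S - W) (n - int (card W))"
    by (rule rem) (use finN in \<open>auto simp: W_def\<close>)
  also have "\<dots> \<longleftrightarrow> cov_hom T g (edges_in (S - W) - {e}) (S - W - g e) (n - int (card W) - 1)"
    unfolding ind_hom_def
  proof (rule cov_hom_forced[of _ _ u])
    fix a assume "a \<in> edges_in (S - W)" "u \<in> g a"
    then have "g a = g e" "a \<in> I" using leaf_edge[OF nu] e by (auto simp: edges_in_def)
    then show "a = e" using e g_inj by blast
  qed (use fin_edges_in e assms vW in \<open>auto simp: edges_in_def\<close>)
  also have "edges_in (S - W) - {e} = edges_in (S - insert v (nbrs S v))"
  proof
    show "edges_in (S - W) - {e} \<subseteq> edges_in (S - insert v (nbrs S v))"
    proof
      fix a assume a: "a \<in> edges_in (S - W) - {e}"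
      then have aE: "g a \<in> E" "g a \<subseteq> S - W" "a \<in> I" "a \<noteq> e" using g_in_E by (auto simp: edges_in_def)
      have "u \<notin> g a"
        using leaf_edge[OF nu, of a] a e(2) g_inj[OF aE(3) e(1)] aE(4) by auto
      moreover have "v \<notin> g a"
      proof
        assume "v \<in> g a"
        then obtain x where x: "g a = {v, x}" using edge_other aE(1) by metis
        then have "x \<in> nbrs S v" using aE by (auto simp: nbrs_def)
        moreover have "x \<noteq> u" using \<open>u \<notin> g a\<close> x by auto
        ultimately have "x \<in> W" by (auto simp: W_def)
        then show False using x aE by auto
      qed
      ultimately show "a \<in> edges_in (S - insert v (nbrs S v))" using aE by (auto simp: edges_in_def W_def)
    qed
    show "edges_in (S - insert v (nbrs S v)) \<subseteq> edges_in (S - W) - {e}"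
      using e by (auto simp: edges_in_def W_def)
  qed
  also have "S - W - g e = S - insert v (nbrs S v)" using e u by (auto simp: W_def)
  also have "n - int (card W) - 1 = n - int (card (nbrs S v))"
    using finN u card_Suc_Diff1[of "nbrs S v" u] unfolding W_def by linarith
  finally show ?thesis unfolding ind_hom_def .
qed

text \<open>Each edge of \<open>M\<close> is a component of its own, so \<open>leaf_reduce\<close>
  at one of its ends removes exactly this edge and one from the degree.\<close>

lemma ind_hom_add_matching:
  assumes "finite M" "finite X" "M \<subseteq> E" "pairwise disjnt M" "X \<inter> \<Union> M = {}"
    and "\<And>e u x. e \<in> M \<Longrightarrow> u \<in> e \<Longrightarrow> x \<in> X \<union> \<Union> M \<Longrightarrow> {u, x} \<in> E \<Longrightarrow> x \<in> e"
  shows "ind_hom T (X \<union> \<Union> M) (n + int (card M)) \<longleftrightarrow> ind_hom T X n"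
  using assms(1,3-)
proof (induction M arbitrary: n)
  case (insert e M)
  let ?S = "X \<union> \<Union> (insert e M)"
  obtain u v where uv: "e = {u, v}" "u \<noteq> v" using edge_pair insert.prems(1) by blast
  have "finite e" "finite (\<Union> M)" using insert.hyps(1) insert.prems(1) edge_finite by auto
  then have finS: "finite ?S" using assms(2) by auto
  have e: "{u, v} \<in> E" "{v, u} \<in> E" using uv insert.prems(1) by (auto simp: insert_commute)
  have disj: "e \<inter> \<Union> M = {}"
    using insert.prems(2) insert.hyps(2) by (auto simp: pairwise_insert disjnt_def)
  have nu: "nbrs ?S u = {v}" using insert.prems(4)[of e u] uv e not_loop by (auto simp: nbrs_def)
  have nv: "nbrs ?S v = {u}" using insert.prems(4)[of e v] uv e not_loop by (auto simp: nbrs_def)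
  have "ind_hom T ?S (n + int (card (insert e M))) \<longleftrightarrow>
      ind_hom T (?S - insert v (nbrs ?S v)) (n + int (card (insert e M)) - int (card (nbrs ?S v)))"
    by (rule leaf_reduce[OF finS _ _ nu]) (use uv in auto)
  also have "?S - insert v (nbrs ?S v) = X \<union> \<Union> M" using nv uv disj insert.prems(3) by auto
  also have "n + int (card (insert e M)) - int (card (nbrs ?S v)) = n + int (card M)"
    using nv insert.hyps by simp
  also have "ind_hom T (X \<union> \<Union> M) (n + int (card M)) \<longleftrightarrow> ind_hom T X n"
  proof (rule insert.IH)
    fix e' u' x assume *: "e' \<in> M" "u' \<in> e'" "x \<in> X \<union> \<Union> M" "{u', x} \<in> E"
    show "x \<in> e'" by (rule insert.prems(4)[of _ u']) (use * in auto)
  qed (use insert.prems in \<open>auto simp: pairwise_insert\<close>)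
  finally show ?case .
qed simp

section \<open>Induced matchings and their homology classes\<close>

lemma ind_hom_empty: "ind_hom T {} n \<longleftrightarrow> n = 0"
proof -
  have "edges_in {} = {}" using g_in_E edge_pair by (fastforce simp: edges_in_def)
  then show ?thesis by (simp add: ind_hom_def cov_hom_empty)
qed

lemma fin_match: "ind_match M \<Longrightarrow> finite M"
  using fin_I g_image by (auto simp: ind_match_def intro: finite_subset)

lemma match_edge_unique:
  assumes "ind_match M" "e \<in> M" "e' \<in> M" "u \<in> e" "u \<in> e'"
  shows "e = e'"
  using assms unfolding ind_match_def pairwise_def disjnt_def by blast

lemma card_disjoint_Union:
  assumes "P \<subseteq> E" "pairwise disjnt P"
  shows "card (\<Union> P) = 2 * card P"
proof -
  have "card (\<Union> P) = sum card P"
    by (rule card_Union_disjoint[OF assms(2)]) (use assms(1) edge_finite in auto)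
  also have "\<dots> = (\<Sum>e\<in>P. 2)"
    by (rule sum.cong) (use assms(1) edge_card in auto)
  finally show ?thesis by simp
qed

lemma ind_match_empty: "ind_match {}"
  by (auto simp: ind_match_def)

lemma ind_hom_match:
  assumes "ind_match M"
  shows "ind_hom T (\<Union> M) (int (card M))"
proof -
  have "ind_hom T ({} \<union> \<Union> M) (0 + int (card M)) \<longleftrightarrow> ind_hom T {} 0"
  proof (rule ind_hom_add_matching)
    fix e u x assume *: "e \<in> M" "u \<in> e" "x \<in> {} \<union> \<Union> M" "{u, x} \<in> E"
    then have "{u, x} \<in> M" using assms by (auto simp: ind_match_def)
    then show "x \<in> e" using match_edge_unique[OF assms *(1) _ *(2)] by blast
  qed (use assms fin_match in \<open>auto simp: ind_match_def\<close>)
  then show ?thesis by (simp add: ind_hom_empty)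
qed

lemma ind_match_nums:
  shows "finite {card M | M. ind_match M \<and> \<Union> M \<subseteq> X}" "{card M | M. ind_match M \<and> \<Union> M \<subseteq> X} \<noteq> {}"
proof -
  have "{card M | M. ind_match M \<and> \<Union> M \<subseteq> X} \<subseteq> card ` Pow E" by (auto simp: ind_match_def)
  moreover have "finite (card ` Pow E)" using fin_I g_image by auto
  ultimately show "finite {card M | M. ind_match M \<and> \<Union> M \<subseteq> X}" by (rule finite_subset)
  show "{card M | M. ind_match M \<and> \<Union> M \<subseteq> X} \<noteq> {}" using ind_match_empty by fastforce
qed

lemma ind_match_num_ge:
  assumes "ind_match M" "\<Union> M \<subseteq> X"
  shows "card M \<le> ind_match_num X"
  unfolding ind_match_num_def by (rule Max_ge[OF ind_match_nums(1)]) (use assms in blast)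

lemma ind_match_num_attained:
  obtains M where "ind_match M" "\<Union> M \<subseteq> X" "card M = ind_match_num X"
  using Max_in[OF ind_match_nums[of X]] unfolding ind_match_num_def by (auto intro: that)

lemma ind_match_num_mono:
  assumes "X \<subseteq> Y" shows "ind_match_num X \<le> ind_match_num Y"
proof -
  obtain M where "ind_match M" "\<Union> M \<subseteq> X" "card M = ind_match_num X" by (rule ind_match_num_attained)
  then show ?thesis using ind_match_num_ge[of M Y] assms by auto
qed

text \<open>Outside the closed neighbourhood of \<open>v\<close>, no vertex of \<open>S\<close> is
  adjacent to \<open>v\<close>, and none to \<open>u\<close> because \<open>v\<close> is its only
  neighbour.\<close>

lemma ind_match_insert:
  assumes M: "ind_match M" "\<Union> M \<subseteq> S - insert v (nbrs S v)" and "u \<in> S" "v \<in> S" "nbrs S u = {v}"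
  shows "ind_match (insert {u, v} M)" "card (insert {u, v} M) = card M + 1"
proof -
  have uv: "{u, v} \<in> E" using assms(5) by (auto simp: nbrs_def)
  have u: "u \<in> nbrs S v" using assms uv by (simp add: nbrs_def insert_commute)
  have disj: "e \<inter> {u, v} = {}" if "e \<in> M" for e using that M(2) u by auto
  have "{u, v} \<notin> M" using disj[of "{u, v}"] by auto
  then show "card (insert {u, v} M) = card M + 1"
    using fin_match[OF M(1)] by simp
  show "ind_match (insert {u, v} M)"
    unfolding ind_match_def
  proof (intro conjI ballI impI)
    show "insert {u, v} M \<subseteq> E" using M(1) uv by (auto simp: ind_match_def)
    show "pairwise disjnt (insert {u, v} M)"
      using M(1) disj by (auto simp: ind_match_def pairwise_insert disjnt_def)
    fix e assume e: "e \<in> E" "e \<subseteq> \<Union> (insert {u, v} M)"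
    show "e \<in> insert {u, v} M"
    proof (cases "e \<subseteq> \<Union> M")
      case True
      then show ?thesis using M(1) e(1) by (auto simp: ind_match_def)
    next
      case False
      then obtain x where x: "x \<in> e" "x \<in> {u, v}" using e(2) by auto
      then obtain y where y: "e = {x, y}" using edge_other e(1) by metis
      show ?thesis
      proof (cases "y \<in> {u, v}")
        case True
        then show ?thesis using x y not_loop e(1) by auto
      next
        case False
        then have yS: "y \<in> S - insert v (nbrs S v)" using y e(2) M(2) by auto
        then have "y \<in> nbrs S x" using y e(1) by (auto simp: nbrs_def)
        then show ?thesis using x assms(5) yS by auto
      qed
    qed
  qed
qed

end

text \<open>The shape of a unicyclic graph as the homological argument sees it: a cycle without
  chords, and a vertex of degree at most one in every other nonempty induced subgraph. The last
  clause of \<open>leaf_ex\<close> keeps this vertex off the cycle while the cycle is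
  intact.\<close>

locale unicyclic_edges = edge_family +
  fixes V :: "'a set" and n :: nat and c :: "nat \<Rightarrow> 'a"
  assumes fin_V: "finite V" and E_V: "e \<in> E \<Longrightarrow> e \<subseteq> V"
    and n3: "n \<ge> 3" and injc: "inj_on c {..<n}" and cV: "c ` {..<n} \<subseteq> V"
    and cycle_edge: "i < n \<Longrightarrow> {c i, c (Suc i mod n)} \<in> E"
    and chordless: "e \<in> E \<Longrightarrow> e \<subseteq> c ` {..<n} \<Longrightarrow> \<exists>i < n. e = {c i, c (Suc i mod n)}"
    and leaf_ex: "S \<subseteq> V \<Longrightarrow> S \<noteq> {} \<Longrightarrow> S \<noteq> c ` {..<n}
      \<Longrightarrow> \<exists>u \<in> S. card (nbrs S u) \<le> 1 \<and> (c ` {..<n} \<subseteq> S \<longrightarrow> u \<notin> c ` {..<n})"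
begin

abbreviation "cyc \<equiv> c ` {..<n}"

definition "cyc_nbrs = {v \<in> V. v \<notin> cyc \<and> (\<exists>u \<in> cyc. {u, v} \<in> E)}"

lemma cyc_cyc_nbrs: "cyc \<inter> cyc_nbrs = {}"
  by (auto simp: cyc_nbrs_def)

lemma card_cyc: "card cyc = n"
  using injc by (simp add: card_image)

lemma ind_hom_cases:
  assumes "S \<subseteq> V" "ind_hom T S d"
  shows "(\<exists>M. ind_match M \<and> \<Union> M \<subseteq> S \<and> int (card S) - d = int (card M)) \<or>
    (\<exists>M d'. ind_match M \<and> \<Union> M \<subseteq> S - cyc - cyc_nbrs \<and> cyc \<subseteq> S \<and> ind_hom T cyc d' \<and>
       int (card S) - d = int (card M) + (int n - d'))"
  using assms
proof (induction "card S" arbitrary: S d rule: less_induct)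
  case less
  have finS: "finite S" using less.prems(1) fin_V finite_subset by blast
  consider "S = {}" | "S = cyc" | "S \<noteq> {}" "S \<noteq> cyc" by blast
  then show ?case
  proof cases
    case 1
    then show ?thesis using less.prems ind_match_empty by (intro disjI1 exI[of _ "{}"]) (auto simp: ind_hom_empty)
  next
    case 2
    then show ?thesis using less.prems ind_match_empty card_cyc by (intro disjI2 exI[of _ "{}"] exI[of _ d]) auto
  next
    case 3
    obtain u where u: "u \<in> S" "card (nbrs S u) \<le> 1" "cyc \<subseteq> S \<longrightarrow> u \<notin> cyc"
      using leaf_ex[OF less.prems(1) 3] by blast
    have "nbrs S u \<noteq> {}" using ind_hom_isolated[OF u(1)] less.prems(2) by blast
    moreover have "finite (nbrs S u)" using finS by (simp add: nbrs_def)
    ultimately have "card (nbrs S u) = 1" using u(2) by (simp add: le_eq_less_or_eq)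
    then obtain v where v: "nbrs S u = {v}" by (auto simp: card_1_singleton_iff)
    then have vS: "v \<in> S" "{u, v} \<in> E" by (auto simp: nbrs_def)
    define S' where "S' = S - insert v (nbrs S v)"
    define d' where "d' = d - int (card (nbrs S v))"
    have vN: "v \<notin> nbrs S v" using not_loop by (auto simp: nbrs_def)
    have uN: "u \<in> nbrs S v" using vS u by (simp add: nbrs_def insert_commute)
    have N: "insert v (nbrs S v) \<subseteq> S" "finite (nbrs S v)" using vS finS by (auto simp: nbrs_def)
    have hS': "ind_hom T S' d'" using leaf_reduce[OF finS u(1) vS(1) v, of T d] less.prems(2) by (simp add: S'_def d'_def)
    have cardS: "card S' + 1 + card (nbrs S v) = card S"
      using card_Diff_subset[OF _ N(1)] N vN finS card_mono[OF finS N(1)] by (simp add: S'_def)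
    have S'V: "S' \<subseteq> V" "S' \<subseteq> S" using less.prems(1) by (auto simp: S'_def)
    have IH: "(\<exists>M. ind_match M \<and> \<Union> M \<subseteq> S' \<and> int (card S') - d' = int (card M)) \<or>
      (\<exists>M d''. ind_match M \<and> \<Union> M \<subseteq> S' - cyc - cyc_nbrs \<and> cyc \<subseteq> S' \<and> ind_hom T cyc d'' \<and>
       int (card S') - d' = int (card M) + (int n - d''))"
      by (rule less.hyps) (use cardS S'V hS' in auto)
    have val: "int (card S) - d = (int (card S') - d') + 1"
      unfolding d'_def using cardS by linarith
    from IH show ?thesis
    proof (elim disjE exE conjE)
      fix M assume M: "ind_match M" "\<Union> M \<subseteq> S'" "int (card S') - d' = int (card M)"
      note ins = ind_match_insert[OF M(1) M(2)[unfolded S'_def] u(1) vS(1) v]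
      have "\<Union> (insert {u, v} M) \<subseteq> S" using M(2) S'V u vS by auto
      moreover have "int (card S) - d = int (card (insert {u, v} M))" unfolding val M(3) ins(2) by simp
      ultimately show ?thesis using ins(1) by blast
    next
      fix M d'' assume M: "ind_match M" "\<Union> M \<subseteq> S' - cyc - cyc_nbrs" "cyc \<subseteq> S'" "ind_hom T cyc d''"
         "int (card S') - d' = int (card M) + (int n - d'')"
      have MS: "\<Union> M \<subseteq> S - insert v (nbrs S v)" using M(2) by (auto simp: S'_def)
      note ins = ind_match_insert[OF M(1) MS u(1) vS(1) v]
      \<comment> \<open>The cycle survives the deletion of the closed neighbourhood of
        \<open>v\<close>, so \<open>v\<close> is neither on it nor adjacent to it.\<close>
      have v1: "v \<notin> cyc" "v \<notin> cyc_nbrs"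
      proof -
        show "v \<notin> cyc" using M(3) by (auto simp: S'_def)
        show "v \<notin> cyc_nbrs"
        proof
          assume "v \<in> cyc_nbrs"
          then obtain x where "x \<in> cyc" "{v, x} \<in> E" unfolding cyc_nbrs_def using edge_sym by blast
          moreover from this have "x \<in> nbrs S v" using M(3) S'V by (auto simp: nbrs_def)
          ultimately show False using M(3) by (auto simp: S'_def)
        qed
      qed
      \<comment> \<open>A neighbour of the leaf \<open>u\<close> on the cycle would have to be
        \<open>v\<close>.\<close>
      have u1: "u \<notin> cyc" "u \<notin> cyc_nbrs"
      proof -
        show "u \<notin> cyc" using u(3) M(3) S'V by blast
        show "u \<notin> cyc_nbrs"
        proof
          assume "u \<in> cyc_nbrs"
          then obtain x where x: "x \<in> cyc" "{u, x} \<in> E" unfolding cyc_nbrs_def using edge_sym by blast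
          then have "x \<in> nbrs S u" using M(3) S'V by (auto simp: nbrs_def)
          then show False using v x v1 by auto
        qed
      qed
      have "\<Union> (insert {u, v} M) \<subseteq> S - cyc - cyc_nbrs" using M(2) S'V u vS u1 v1 by auto
      moreover have "int (card S) - d = int (card (insert {u, v} M)) + (int n - d'')"
        unfolding val M(5) ins(2) by simp
      moreover have "cyc \<subseteq> S" using M(3) S'V by blast
      ultimately show ?thesis using ins(1) M(4) by blast
    qed
  qed
qed

section \<open>The cycle as an induced subgraph and its matching number\<close>

lemma succ_mod:
  assumes "i < n"
  shows "Suc i mod n < n" "Suc i mod n \<noteq> i" "Suc (Suc i mod n) mod n \<noteq> i"
  using assms n3 by (auto simp: mod_Suc split: if_splits)

lemma succ_inj:
  assumes "i < n" "j < n" "Suc i mod n = Suc j mod n" shows "i = j"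
  using assms n3 by (auto simp: mod_Suc split: if_splits)

lemma c_eq: "i < n \<Longrightarrow> j < n \<Longrightarrow> c i = c j \<longleftrightarrow> i = j"
  using injc by (auto simp: inj_on_eq_iff)

text \<open>Here \<open>n \<ge> 3\<close> enters: two steps along the cycle do not return to the
  start, so no edge is met again in the opposite direction.\<close>

lemma cycle_edge_eq:
  assumes "i < n" "j < n" "{c i, c (Suc i mod n)} = {c j, c (Suc j mod n)}"
  shows "i = j"
proof -
  consider "c i = c j" | "c i = c (Suc j mod n)" "c (Suc i mod n) = c j"
    using assms(3) by (auto simp: doubleton_eq_iff)
  then show ?thesis
  proof cases
    case 2
    then have "i = Suc j mod n" "Suc i mod n = j" using assms c_eq succ_mod(1) by blast+
    then show ?thesis using succ_mod(3)[OF assms(2)] by simp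
  qed (use assms c_eq in blast)
qed

lemma edges_in_cyc:
  "\<exists>\<epsilon>. inj_on \<epsilon> {..<n} \<and> edges_in cyc = \<epsilon> ` {..<n} \<and> (\<forall>i < n. g (\<epsilon> i) = {c i, c (Suc i mod n)})"
proof -
  define \<epsilon> where "\<epsilon> i = inv_into I g {c i, c (Suc i mod n)}" for i
  have \<epsilon>: "\<epsilon> i \<in> I" "g (\<epsilon> i) = {c i, c (Suc i mod n)}" if "i < n" for i
    using cycle_edge[OF that] g_image unfolding \<epsilon>_def by (metis inv_into_into, metis f_inv_into_f)
  show ?thesis
  proof (intro exI conjI)
    show "inj_on \<epsilon> {..<n}"
    proof (rule inj_onI)
      fix i j assume *: "i \<in> {..<n}" "j \<in> {..<n}" "\<epsilon> i = \<epsilon> j"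
      then have "{c i, c (Suc i mod n)} = {c j, c (Suc j mod n)}" using \<epsilon>(2)[of i] \<epsilon>(2)[of j] by simp
      then show "i = j" using cycle_edge_eq * by simp
    qed
    show "edges_in cyc = \<epsilon> ` {..<n}"
    proof
      show "edges_in cyc \<subseteq> \<epsilon> ` {..<n}"
      proof
        fix a assume "a \<in> edges_in cyc"
        then have a: "a \<in> I" "g a \<subseteq> cyc" by (auto simp: edges_in_def)
        then obtain i where i: "i < n" "g a = {c i, c (Suc i mod n)}" using chordless g_in_E by meson
        then have "a = \<epsilon> i" using \<epsilon>[OF i(1)] a g_inj by metis
        then show "a \<in> \<epsilon> ` {..<n}" using i by blast
      qed
      show "\<epsilon> ` {..<n} \<subseteq> edges_in cyc" using \<epsilon> succ_mod by (auto simp: edges_in_def)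
    qed
  qed (use \<epsilon> in blast)
qed

lemma ind_hom_cyc_le:
  assumes "ind_hom T cyc d"
  shows "int n - d \<le> int (n div 3) + (if n mod 3 = 2 then 1 else 0)"
proof -
  obtain \<epsilon> where \<epsilon>: "inj_on \<epsilon> {..<n}" "edges_in cyc = \<epsilon> ` {..<n}" "\<forall>i < n. g (\<epsilon> i) = {c i, c (Suc i mod n)}"
    using edges_in_cyc by (elim exE conjE)
  have "cov_hom T g (\<epsilon> ` {..<n}) cyc d" using assms unfolding ind_hom_def \<epsilon>(2) .
  then show ?thesis by (rule cov_hom_cycle_le[OF n3 injc \<epsilon>(1), rotated]) (use \<epsilon>(3) in blast)
qed

lemma ind_hom_cyc:
  assumes "n mod 3 = 2"
  shows "ind_hom T cyc (int n - int (n div 3) - 1)"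
proof -
  obtain \<epsilon> where \<epsilon>: "inj_on \<epsilon> {..<n}" "edges_in cyc = \<epsilon> ` {..<n}" "\<forall>i < n. g (\<epsilon> i) = {c i, c (Suc i mod n)}"
    using edges_in_cyc by (elim exE conjE)
  show ?thesis unfolding ind_hom_def \<epsilon>(2) by (rule cov_hom_cycle[OF n3 injc \<epsilon>(1) _ assms]) (use \<epsilon>(3) in blast)
qed

text \<open>Every third edge is taken. The vertex \<open>c (3 * i + 2)\<close> separates consecutive
  ones, also across the end of the numbering because \<open>3 * i + 2 < n\<close>.\<close>

lemma cyc_match:
  obtains M where "ind_match M" "\<Union> M \<subseteq> cyc" "card M = n div 3"
proof -
  let ?e = "\<lambda>i. {c (3 * i), c (3 * i + 1)}"
  define M where "M = ?e ` {..<n div 3}"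
  have lt: "3 * i + 2 < n" if "i < n div 3" for i using that by linarith
  have eq: "?e i = {c (3 * i), c (Suc (3 * i) mod n)}" if "i < n div 3" for i using lt[OF that] by simp
  have UM: "x \<in> \<Union> M \<longleftrightarrow> (\<exists>i < n div 3. x = c (3 * i) \<or> x = c (3 * i + 1))" for x by (auto simp: M_def)
  have disj: "i = j" if "i < n div 3" "j < n div 3" "?e i \<inter> ?e j \<noteq> {}" for i j
  proof -
    have "3 * i = 3 * j \<or> 3 * i = 3 * j + 1 \<or> 3 * i + 1 = 3 * j \<or> 3 * i + 1 = 3 * j + 1"
      using that(3) c_eq lt[OF that(1)] lt[OF that(2)] by auto
    then show ?thesis by presburger
  qed
  have "ind_match M"
    unfolding ind_match_def
  proof (intro conjI ballI impI)
    show "M \<subseteq> E"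
    proof
      fix e assume "e \<in> M"
      then obtain i where i: "i < n div 3" "e = ?e i" by (auto simp: M_def)
      then show "e \<in> E" using cycle_edge[of "3 * i"] lt[OF i(1)] eq[OF i(1)] by simp
    qed
    show "pairwise disjnt M"
      unfolding pairwise_def disjnt_def M_def using disj by blast
    fix e assume e: "e \<in> E" "e \<subseteq> \<Union> M"
    have "\<Union> M \<subseteq> cyc"
    proof
      fix x assume "x \<in> \<Union> M"
      then obtain i where i: "i < n div 3" "x = c (3 * i) \<or> x = c (3 * i + 1)" using UM by blast
      then show "x \<in> cyc" using lt[OF i(1)] by auto
    qed
    then obtain k where k: "k < n" "e = {c k, c (Suc k mod n)}" using chordless e by blast
    then have "c k \<in> \<Union> M" "c (Suc k mod n) \<in> \<Union> M" using e(2) by auto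
    then obtain i j where ij: "i < n div 3" "c k = c (3 * i) \<or> c k = c (3 * i + 1)"
      "j < n div 3" "c (Suc k mod n) = c (3 * j) \<or> c (Suc k mod n) = c (3 * j + 1)"
      unfolding UM by blast
    note lts = lt[OF ij(1)] lt[OF ij(3)]
    have "k = 3 * i \<or> k = 3 * i + 1" using ij(2) c_eq k(1) lts(1) by auto
    moreover have j: "Suc k mod n = 3 * j \<or> Suc k mod n = 3 * j + 1" using ij(4) c_eq succ_mod(1)[OF k(1)] lts(2) by auto
    moreover have "k \<noteq> 3 * i + 1"
    proof
      assume "k = 3 * i + 1"
      then have "Suc k mod n = 3 * i + 2" using lts(1) by simp
      with j have "3 * i + 2 = 3 * j \<or> 3 * i + 2 = 3 * j + 1" by simp
      then show False by presburger
    qed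
    ultimately have "k = 3 * i" by blast
    then show "e \<in> M" using k(2) eq[OF ij(1)] ij(1) by (auto simp: M_def)
  qed
  moreover have "\<Union> M \<subseteq> cyc"
  proof
    fix x assume "x \<in> \<Union> M"
    then obtain i where i: "i < n div 3" "x = c (3 * i) \<or> x = c (3 * i + 1)" using UM by blast
    then show "x \<in> cyc" using lt[OF i(1)] by auto
  qed
  moreover have "card M = n div 3"
  proof -
    have "inj_on ?e {..<n div 3}" by (rule inj_onI) (use disj in blast)
    then show ?thesis unfolding M_def by (simp add: card_image)
  qed
  ultimately show ?thesis by (rule that)
qed

text \<open>A matching edge blocks its two successors on the cycle: the next one shares a vertex
  with it, and if the one after that were in \<open>M\<close>, the edge between would join two
  matching edges. So \<open>J\<close> and its two shifts are disjoint sets of equal size among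
  \<open>n\<close> indices.\<close>

lemma cyc_match_le:
  assumes M: "ind_match M" "\<Union> M \<subseteq> cyc"
  shows "card M \<le> n div 3"
proof -
  let ?s = "\<lambda>i. Suc i mod n"
  define J where "J = {i. i < n \<and> {c i, c (?s i)} \<in> M}"
  have J: "J \<subseteq> {..<n}" by (auto simp: J_def)
  have sJ: "?s i \<notin> J" if "i \<in> J" for i
  proof
    assume "?s i \<in> J"
    then have "{c i, c (?s i)} = {c (?s i), c (?s (?s i))}"
      using match_edge_unique[OF M(1), of "{c i, c (?s i)}" "{c (?s i), c (?s (?s i))}" "c (?s i)"] that
      by (auto simp: J_def)
    moreover have "i < n" using that by (simp add: J_def)
    ultimately show False using cycle_edge_eq[of i "?s i"] succ_mod[of i] by simp
  qed
  have ssJ: "?s (?s i) \<notin> J" if "i \<in> J" for i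
  proof
    assume *: "?s (?s i) \<in> J"
    have "{c (?s i), c (?s (?s i))} \<in> E" using cycle_edge succ_mod(1) that by (auto simp: J_def)
    moreover have "{c (?s i), c (?s (?s i))} \<subseteq> \<Union> M" using * that by (auto simp: J_def)
    ultimately have "{c (?s i), c (?s (?s i))} \<in> M" using M(1) unfolding ind_match_def by blast
    then have "?s i \<in> J" using succ_mod(1) that by (auto simp: J_def)
    then show False using sJ that by blast
  qed
  have inj: "inj_on ?s {..<n}" 
  proof (rule inj_onI)
    fix i j assume "i \<in> {..<n}" "j \<in> {..<n}" "?s i = ?s j"
    then have "i < n" "j < n" "?s i = ?s j" by (simp_all only: lessThan_iff)
    then show "i = j" by (rule succ_inj)
  qed
  have sn: "?s ` A \<subseteq> {..<n}" for A using n3 by auto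
  have "J \<inter> ?s ` J = {}" "J \<inter> ?s ` ?s ` J = {}" using sJ ssJ by auto
  moreover have "?s ` J \<inter> ?s ` ?s ` J = {}"
    using inj_on_image_Int[OF inj J sn[of J]] \<open>J \<inter> ?s ` J = {}\<close> by simp
  moreover have fin: "finite J" using J finite_subset by blast
  ultimately have "card (J \<union> ?s ` J \<union> ?s ` ?s ` J) = card J + card (?s ` J) + card (?s ` ?s ` J)"
    by (subst card_Un_disjoint; simp add: card_Un_disjoint Int_Un_distrib2)
  moreover have "card (J \<union> ?s ` J \<union> ?s ` ?s ` J) \<le> n"
    using card_mono[of "{..<n}" "J \<union> ?s ` J \<union> ?s ` ?s ` J"] J sn[of J] sn[of "?s ` J"] by simp
  moreover have "card (?s ` J) = card J" "card (?s ` ?s ` J) = card J"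
    using card_image[OF inj_on_subset[OF inj J]] card_image[OF inj_on_subset[OF inj sn[of J]]] by simp_all
  ultimately have "3 * card J \<le> n" by simp
  moreover have "M \<subseteq> (\<lambda>i. {c i, c (?s i)}) ` J"
  proof
    fix e assume e: "e \<in> M"
    then have "e \<in> E" "e \<subseteq> cyc" using M by (auto simp: ind_match_def)
    then obtain i where "i < n" "e = {c i, c (?s i)}" using chordless by blast
    then show "e \<in> (\<lambda>i. {c i, c (?s i)}) ` J" using e by (auto simp: J_def)
  qed
  then have "card M \<le> card J" using fin surj_card_le by blast
  ultimately show ?thesis by simp
qed

text \<open>The other end, if off the cycle, would be adjacent to \<open>x\<close> and so belong to
  \<open>cyc_nbrs\<close>.\<close>

lemma match_mixed:
  assumes "e \<in> E" "e \<inter> cyc_nbrs = {}" "x \<in> e" "x \<in> cyc"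
  shows "e \<subseteq> cyc"
proof -
  obtain y where y: "e = {x, y}" using edge_other assms by metis
  then have "y \<in> V" using E_V assms(1) by blast
  then show ?thesis using assms y by (auto simp: cyc_nbrs_def)
qed

text \<open>A vertex off the cycle and off \<open>cyc_nbrs\<close> has no neighbour on the cycle, so
  \<open>n div 3\<close> edges of the cycle can be added to \<open>M\<close>.\<close>

lemma ind_match_cyc_le:
  assumes M: "ind_match M" "\<Union> M \<subseteq> V - cyc - cyc_nbrs"
  shows "card M + n div 3 \<le> ind_match_num (V - cyc_nbrs)"
proof -
  obtain N where N: "ind_match N" "\<Union> N \<subseteq> cyc" "card N = n div 3" by (rule cyc_match)
  have disj: "M \<inter> N = {}"
  proof (rule ccontr)
    assume "M \<inter> N \<noteq> {}"
    then obtain e where e: "e \<in> M" "e \<in> N" by blast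
    then have "e \<noteq> {}" using M(1) by (auto simp: ind_match_def)
    then obtain u where "u \<in> e" by blast
    then show False using e M N by blast
  qed
  have "ind_match (M \<union> N)"
    unfolding ind_match_def
  proof (intro conjI ballI impI)
    show "M \<union> N \<subseteq> E" using M N by (auto simp: ind_match_def)
    have MN: "disjnt e e'" if "e \<in> M" "e' \<in> N" for e e'
      unfolding disjnt_def using that M(2) N(2) by blast
    show "pairwise disjnt (M \<union> N)"
    proof (rule pairwiseI)
      fix e e' assume *: "e \<in> M \<union> N" "e' \<in> M \<union> N" "e \<noteq> e'"
      have pw: "pairwise disjnt M" "pairwise disjnt N" using M(1) N(1) by (auto simp: ind_match_def)
      from *(1,2) show "disjnt e e'"
        by (elim UnE) (use MN MN[THEN disjnt_sym] pairwiseD[OF pw(1)] pairwiseD[OF pw(2)] *(3) in simp_all)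
    qed
    fix e assume e: "e \<in> E" "e \<subseteq> \<Union> (M \<union> N)"
    then have e': "e \<subseteq> \<Union> M \<union> \<Union> N" by (simp add: Union_Un_distrib)
    then have ge: "e \<inter> cyc_nbrs = {}" using M(2) N(2) cyc_cyc_nbrs by blast
    show "e \<in> M \<union> N"
    proof (cases "e \<inter> cyc = {}")
      case True
      then have "e \<subseteq> \<Union> M" using e' N(2) by blast
      then show ?thesis using M e by (auto simp: ind_match_def)
    next
      case False
      then have "e \<subseteq> cyc" using match_mixed[OF e(1) ge] by blast
      then have "e \<subseteq> \<Union> N" using e' M(2) by blast
      then show ?thesis using N e by (auto simp: ind_match_def)
    qed
  qed
  moreover have "\<Union> (M \<union> N) \<subseteq> V - cyc_nbrs"
    unfolding Union_Un_distrib using M(2) N(2) cV cyc_cyc_nbrs by blast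
  moreover have "card (M \<union> N) = card M + n div 3"
    using card_Un_disjoint[OF fin_match[OF M(1)] fin_match[OF N(1)] disj] N(3) by simp
  ultimately show ?thesis using ind_match_num_ge by metis
qed

text \<open>If the reduction ends with the cycle, the value is at most
  \<open>card M + n div 3\<close>, and one more for \<open>n mod 3 = 2\<close>. In that case the
  strict inequality of the matching numbers pays for the extra one.\<close>

lemma ind_hom_le:
  assumes "S \<subseteq> V" "ind_hom T S d" "n mod 3 = 0 \<or> n mod 3 = 1 \<or> ind_match_num (V - cyc_nbrs) < ind_match_num V"
  shows "int (card S) - d \<le> int (ind_match_num V)"
  using ind_hom_cases[OF assms(1,2)]
proof (elim disjE exE conjE)
  fix M assume "ind_match M" "\<Union> M \<subseteq> S" "int (card S) - d = int (card M)"
  then show ?thesis using ind_match_num_ge[of M V] assms(1) by auto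
next
  fix M d' assume M: "ind_match M" "\<Union> M \<subseteq> S - cyc - cyc_nbrs" "ind_hom T cyc d'"
       "int (card S) - d = int (card M) + (int n - d')"
  have "card M + n div 3 \<le> ind_match_num (V - cyc_nbrs)"
    by (rule ind_match_cyc_le) (use M assms(1) in auto)
  moreover have "ind_match_num (V - cyc_nbrs) \<le> ind_match_num V" by (rule ind_match_num_mono) auto
  ultimately show ?thesis using ind_hom_cyc_le[OF M(3)] assms(3) M(4) by (auto split: if_splits)
qed

text \<open>A maximum induced matching attains the value. It is nonempty because the cycle already
  contains an induced matching of size \<open>n div 3 \<ge> 1\<close>; this gives
  \<open>d \<ge> 1\<close>, which \<open>Tor\<close> of the ideal requires.\<close>

lemma ind_hom_ge: "\<exists>S d. S \<subseteq> V \<and> d \<ge> 1 \<and> ind_hom T S d \<and> int (card S) - d = int (ind_match_num V)"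
proof -
  obtain M where M: "ind_match M" "\<Union> M \<subseteq> V" "card M = ind_match_num V" by (rule ind_match_num_attained)
  obtain N where N: "ind_match N" "\<Union> N \<subseteq> cyc" "card N = n div 3" by (rule cyc_match)
  have "1 \<le> n div 3" using n3 by linarith
  also have "\<dots> \<le> card M" using ind_match_num_ge[OF N(1) order_trans[OF N(2) cV]] N(3) M(3) by simp
  finally have "1 \<le> int (card M)" by simp
  moreover have "card (\<Union> M) = 2 * card M" using M(1) card_disjoint_Union by (simp add: ind_match_def)
  then have "int (card (\<Union> M)) - int (card M) = int (ind_match_num V)" using M(3) by simp
  ultimately show ?thesis using ind_hom_match[OF M(1)] M(2) by blast
qed

text \<open>In a maximum matching that avoids \<open>cyc_nbrs\<close>, the edges on the cycle, at
  most \<open>n div 3\<close> of them, are traded for the whole cycle, which contributes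
  \<open>n div 3 + 1\<close>.\<close>

lemma ind_hom_gt:
  assumes "n mod 3 = 2" "ind_match_num (V - cyc_nbrs) = ind_match_num V"
  shows "\<exists>S d. S \<subseteq> V \<and> d \<ge> 1 \<and> ind_hom T S d \<and> int (card S) - d > int (ind_match_num V)"
proof -
  obtain M where M: "ind_match M" "\<Union> M \<subseteq> V - cyc_nbrs" "card M = ind_match_num (V - cyc_nbrs)"
    by (rule ind_match_num_attained)
  define N where "N = {e \<in> M. e \<subseteq> cyc}"
  define P where "P = M - N"
  have "ind_match N"
  proof -
    have "pairwise disjnt N" using M(1) by (auto simp: ind_match_def pairwise_def N_def)
    moreover have "e \<in> N" if "e \<in> E" "e \<subseteq> \<Union> N" for e
    proof -
      have "e \<subseteq> \<Union> M" "e \<subseteq> cyc" using that(2) by (auto simp: N_def)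
      then show ?thesis using M(1) that(1) by (auto simp: ind_match_def N_def)
    qed
    ultimately show ?thesis using M(1) by (auto simp: ind_match_def N_def)
  qed
  then have cN: "card N \<le> n div 3" by (rule cyc_match_le) (auto simp: N_def)
  have finM: "finite M" by (rule fin_match[OF M(1)])
  have cM: "card M = card N + card P"
    using card_Un_disjoint[of N P] finM by (simp add: N_def P_def Un_absorb1 Collect_mono_iff Un_Diff_cancel)
  have PM: "P \<subseteq> M" by (auto simp: P_def)
  have Pcyc: "e \<inter> cyc = {}" if "e \<in> P" for e
  proof (rule ccontr)
    assume "e \<inter> cyc \<noteq> {}"
    then obtain x where x: "x \<in> e" "x \<in> cyc" by blast
    have "e \<in> M" using that PM by blast
    then have "e \<in> E" "e \<inter> cyc_nbrs = {}" using M(1,2) by (auto simp: ind_match_def)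
    then have "e \<subseteq> cyc" using match_mixed x by blast
    then show False using that by (simp add: P_def N_def)
  qed
  let ?S = "cyc \<union> \<Union> P"
  have pw: "pairwise disjnt P" using M(1) PM by (auto simp: ind_match_def intro: pairwise_subset)
  have "ind_hom T ?S (int n - int (n div 3) - 1 + int (card P)) \<longleftrightarrow> ind_hom T cyc (int n - int (n div 3) - 1)"
  proof (rule ind_hom_add_matching)
    fix e u x assume *: "e \<in> P" "u \<in> e" "x \<in> ?S" "{u, x} \<in> E"
    show "x \<in> e"
    proof (cases "x \<in> cyc")
      case True
      \<comment> \<open>An edge of \<open>P\<close> avoids both the cycle and its neighbours, so it
        cannot be joined to the cycle.\<close>
      have "u \<notin> cyc" "u \<in> V" "u \<notin> cyc_nbrs" using Pcyc[OF *(1)] *(1,2) M(2) PM by blast+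
      then show ?thesis using True edge_sym[OF *(4)] by (auto simp: cyc_nbrs_def)
    next
      case False
      then have "{u, x} \<subseteq> \<Union> M" using *(1-3) PM by blast
      then have "{u, x} \<in> M" using M(1) *(4) unfolding ind_match_def by blast
      then have "{u, x} = e" using match_edge_unique[OF M(1), of "{u, x}" e u] *(1,2) PM by blast
      then show ?thesis by blast
    qed
  next
    show "finite P" using finM PM finite_subset by blast
    show "P \<subseteq> E" using M(1) PM by (auto simp: ind_match_def)
    show "cyc \<inter> \<Union> P = {}" using Pcyc by blast
  qed (use pw in simp_all)
  then have h: "ind_hom T ?S (int n - int (n div 3) - 1 + int (card P))" using ind_hom_cyc[OF assms(1)] by simp
  have "card (\<Union> P) = 2 * card P"
    by (rule card_disjoint_Union[OF _ pw]) (use M(1) PM in \<open>auto simp: ind_match_def\<close>)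
  moreover have "card ?S = n + card (\<Union> P)"
  proof -
    have "\<Union> P \<subseteq> V" using M(2) PM by blast
    then have "finite (\<Union> P)" using fin_V finite_subset by blast
    moreover have "cyc \<inter> \<Union> P = {}" using Pcyc by blast
    ultimately show ?thesis using card_Un_disjoint[of cyc "\<Union> P"] card_cyc by simp
  qed
  moreover have "?S \<subseteq> V" using cV M(2) PM by blast
  moreover have "int (n div 3) + 1 < int n" using n3 by linarith
  ultimately have "?S \<subseteq> V \<and> int n - int (n div 3) - 1 + int (card P) \<ge> 1 \<and>
      int (card ?S) - (int n - int (n div 3) - 1 + int (card P)) > int (ind_match_num V)"
    using cM cN M(3) assms(2) by linarith
  then show ?thesis using h by blast
qed

end

section \<open>Comparison of graded free resolutions\<close>

lemma monom_deg_sum: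
  assumes "finite A" "Poly_Mapping.keys m \<subseteq> A"
  shows "monom_deg m = (\<Sum>v\<in>A. Poly_Mapping.lookup m v)"
  unfolding monom_deg_def by (rule sum.mono_neutral_left) (use assms in \<open>auto simp: in_keys_iff\<close>)

lemma monom_deg_add: "monom_deg (a + b) = monom_deg a + monom_deg b"
proof -
  let ?A = "Poly_Mapping.keys a \<union> Poly_Mapping.keys b"
  have "Poly_Mapping.keys (a + b) \<subseteq> ?A" by (rule keys_add)
  then show ?thesis
    using monom_deg_sum[of ?A a] monom_deg_sum[of ?A b] monom_deg_sum[of ?A "a + b"]
    by (simp add: lookup_add sum.distrib)
qed

lemma monom_deg_zero [simp]: "monom_deg 0 = 0"
  by (simp add: monom_deg_def)

lemma keys_add_nat: "Poly_Mapping.keys (a + b) = Poly_Mapping.keys a \<union> Poly_Mapping.keys (b :: 'v monom)"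
  by (auto simp: in_keys_iff lookup_add)

lemma monom_add_eq_0: "a + b = (0 :: 'v monom) \<longleftrightarrow> a = 0 \<and> b = 0"
  using keys_add_nat[of a b] by (metis Un_empty keys_eq_empty)

text \<open>Natural exponents cannot cancel, so only the pair of zero exponents contributes. Taking
  constant terms is thus a ring homomorphism; it models tensoring with the field.\<close>

lemma lookup_mult_0: "Poly_Mapping.lookup (p * q) 0 = Poly_Mapping.lookup p 0 * Poly_Mapping.lookup (q :: ('v, 'k::field) mpoly) 0"
proof -
  have q: "(\<Sum>b. Poly_Mapping.lookup q b when 0 = a + b) = (Poly_Mapping.lookup q 0 when a = 0)" for a :: "'v monom"
  proof -
    have "(\<lambda>b. Poly_Mapping.lookup q b when 0 = a + b) = (\<lambda>b. (Poly_Mapping.lookup q 0 when a = 0) when b = 0)"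
      by (rule ext) (use monom_add_eq_0 in \<open>auto simp: when_def eq_commute[of 0]\<close>)
    then show ?thesis by (simp only: Sum_any_when_equal)
  qed
  have "Poly_Mapping.lookup (p * q) 0 = (\<Sum>a. Poly_Mapping.lookup p a * (Poly_Mapping.lookup q 0 when a = 0))"
    by (simp only: times_poly_mapping.rep_eq prod_fun_def q)
  also have "(\<lambda>a. Poly_Mapping.lookup p a * (Poly_Mapping.lookup q 0 when a = 0))
      = (\<lambda>a. (Poly_Mapping.lookup p 0 * Poly_Mapping.lookup q 0) when a = 0)"
    by (rule ext) (auto simp: when_def)
  finally show ?thesis by simp
qed

lemma poly_ring_zero: "0 \<in> poly_ring V"
  by (simp add: poly_ring_def)

lemma poly_ring_add: "p \<in> poly_ring V \<Longrightarrow> q \<in> poly_ring V \<Longrightarrow> p + q \<in> poly_ring V"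
  unfolding poly_ring_def using keys_add[of p q] by blast

lemma poly_ring_mult: "p \<in> poly_ring V \<Longrightarrow> q \<in> poly_ring V \<Longrightarrow> p * q \<in> poly_ring V"
  unfolding poly_ring_def mem_Collect_eq
proof
  fix m assume pq: "\<forall>m\<in>Poly_Mapping.keys p. Poly_Mapping.keys m \<subseteq> V" "\<forall>m\<in>Poly_Mapping.keys q. Poly_Mapping.keys m \<subseteq> V"
    and "m \<in> Poly_Mapping.keys (p * q)"
  then obtain a b where "m = a + b" "a \<in> Poly_Mapping.keys p" "b \<in> Poly_Mapping.keys q"
    using keys_mult[of p q] by blast
  then show "Poly_Mapping.keys m \<subseteq> V" using pq by (simp add: keys_add_nat)
qed

lemma hom_comp_zero [simp]: "0 \<in> hom_comp V d"
  by (simp add: hom_comp_def poly_ring_def)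

lemma hom_comp_add: "p \<in> hom_comp V d \<Longrightarrow> q \<in> hom_comp V d \<Longrightarrow> p + q \<in> hom_comp V d"
  unfolding hom_comp_def using keys_add[of p q] poly_ring_add by blast

lemma hom_comp_uminus: "p \<in> hom_comp V d \<Longrightarrow> - p \<in> hom_comp V d"
  unfolding hom_comp_def poly_ring_def by simp

lemma hom_comp_mult:
  assumes "p \<in> hom_comp V d" "q \<in> hom_comp V e"
  shows "p * q \<in> hom_comp V (d + e)"
  unfolding hom_comp_def
proof (intro CollectI conjI ballI)
  show "p * q \<in> poly_ring V" using assms poly_ring_mult by (auto simp: hom_comp_def)
  fix m assume "m \<in> Poly_Mapping.keys (p * q)"
  then obtain a b where "m = a + b" "a \<in> Poly_Mapping.keys p" "b \<in> Poly_Mapping.keys q"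
    using keys_mult[of p q] by blast
  then show "int (monom_deg m) = d + e" using assms by (auto simp: hom_comp_def monom_deg_add)
qed

lemma hom_comp_const: "Poly_Mapping.single 0 c \<in> hom_comp V 0"
  by (auto simp: hom_comp_def poly_ring_def)

lemma hom_comp_one: "1 \<in> hom_comp V 0"
  using hom_comp_const[of 1] by simp

section \<open>Vectors over the polynomial ring and maps between them\<close>

type_synonym ('v, 'k) vec = "nat \<Rightarrow> ('v, 'k) mpoly"

definition smul :: "('v, 'k::field) mpoly \<Rightarrow> ('v, 'k) vec \<Rightarrow> ('v, 'k) vec" where
  "smul r f = (\<lambda>b. r * f b)"

definition vadd :: "('v, 'k::field) vec \<Rightarrow> ('v, 'k) vec \<Rightarrow> ('v, 'k) vec" where
  "vadd f g = (\<lambda>b. f b + g b)"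

definition vneg :: "('v, 'k::field) vec \<Rightarrow> ('v, 'k) vec" where
  "vneg f = (\<lambda>b. - f b)"

definition unit_vec :: "nat \<Rightarrow> ('v, 'k::field) vec" where
  "unit_vec c = (\<lambda>b. if b = c then 1 else 0)"

definition vzero :: "('v, 'k::field) vec" where
  "vzero = (\<lambda>_. 0)"

definition lin_ext :: "nat \<Rightarrow> (nat \<Rightarrow> ('v, 'k::field) vec) \<Rightarrow> ('v, 'k) vec \<Rightarrow> ('v, 'k) vec" where
  "lin_ext r v f = (\<lambda>b. \<Sum>c<r. f c * v c b)"

definition const_part :: "('v, 'k::field) vec \<Rightarrow> nat \<Rightarrow> 'k" where
  "const_part f = (\<lambda>b. Poly_Mapping.lookup (f b) 0)"

text \<open>The third clause makes the map descend to the quotient by the irrelevant ideal.\<close>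

definition mod_map :: "(('v, 'k::field) vec \<Rightarrow> ('v, 'k) vec) \<Rightarrow> bool" where
  "mod_map L \<longleftrightarrow> (\<forall>f g. L (vadd f g) = vadd (L f) (L g)) \<and> (\<forall>r f. L (smul r f) = smul r (L f)) \<and>
     (\<forall>f. const_part f = (\<lambda>_. 0) \<longrightarrow> const_part (L f) = (\<lambda>_. 0))"

lemma const_part_vadd: "const_part (vadd f g) = (\<lambda>b. const_part f b + const_part g b)"
  by (simp add: const_part_def vadd_def lookup_add)

lemma const_part_vneg: "const_part (vneg f) = (\<lambda>b. - const_part f b)"
  by (simp add: const_part_def vneg_def)

lemma mod_mapD:
  assumes "mod_map L"
  shows "L (vadd f g) = vadd (L f) (L g)" "L (smul r f) = smul r (L f)"
    "const_part f = (\<lambda>_. 0) \<Longrightarrow> const_part (L f) = (\<lambda>_. 0)" "L (vneg f) = vneg (L f)" "L vzero = vzero"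
proof -
  show "L (vadd f g) = vadd (L f) (L g)" "\<And>r f. L (smul r f) = smul r (L f)"
    "const_part f = (\<lambda>_. 0) \<Longrightarrow> const_part (L f) = (\<lambda>_. 0)"
    using assms by (simp_all add: mod_map_def)
  from this(2)[of "-1" f] this(2)[of 0 f] show "L (vneg f) = vneg (L f)" "L vzero = vzero"
    by (simp_all add: smul_def vneg_def vzero_def)
qed

lemma mod_map_id: "mod_map (\<lambda>f. f)"
  by (simp add: mod_map_def)

lemma mod_map_comp: "mod_map L \<Longrightarrow> mod_map K \<Longrightarrow> mod_map (\<lambda>f. L (K f))"
  by (simp add: mod_map_def)

lemma mod_map_zero: "mod_map (\<lambda>f. vzero)"
  by (simp add: mod_map_def vzero_def vadd_def smul_def const_part_def)

lemma mod_map_lin_ext: "mod_map (lin_ext r v)"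
  unfolding mod_map_def
proof (intro conjI allI impI)
  fix f g :: "('a, 'b) vec" and q
  show "lin_ext r v (vadd f g) = vadd (lin_ext r v f) (lin_ext r v g)"
    by (simp add: lin_ext_def vadd_def sum.distrib distrib_right)
  show "lin_ext r v (smul q f) = smul q (lin_ext r v f)"
    by (simp add: lin_ext_def smul_def sum_distrib_left mult.assoc)
  assume f: "const_part f = (\<lambda>_. 0)"
  have "Poly_Mapping.lookup (f c) 0 = 0" for c using fun_cong[OF f, of c] by (simp add: const_part_def)
  then show "const_part (lin_ext r v f) = (\<lambda>_. 0)"
    by (simp add: const_part_def lin_ext_def lookup_sum lookup_mult_0)
qed

lemma mod_map_lin_comb:
  assumes "mod_map L"
  shows "L (lin_ext r v f) = lin_ext r (\<lambda>c. L (v c)) f"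
proof (induction r)
  case 0
  then show ?case using mod_mapD(5)[OF assms] by (simp add: lin_ext_def vzero_def)
next
  case (Suc r)
  have *: "lin_ext (Suc r) w f = vadd (lin_ext r w f) (smul (f r) (w r))" for w
    by (simp add: lin_ext_def vadd_def smul_def)
  show ?case unfolding * using Suc by (simp add: mod_mapD[OF assms])
qed

lemma lin_ext_unit_vec:
  assumes "\<And>b. b \<ge> r \<Longrightarrow> f b = 0"
  shows "lin_ext r unit_vec f = f"
proof
  fix b
  have "lin_ext r unit_vec f b = (\<Sum>c<r. if c = b then f b else 0)"
    unfolding lin_ext_def unit_vec_def by (rule sum.cong) auto
  then show "lin_ext r unit_vec f b = f b" using assms[of b] by (auto simp: not_less)
qed

text \<open>The augmented complex \<open>\<dots> \<rightarrow> F\<^sub>1 \<rightarrow> F\<^sub>0 \<rightarrow> M\<close>, with \<open>M\<close> in position 0 and \<open>F\<^sub>i\<close> in position \<open>i + 1\<close>.\<close>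

definition aug_comp :: "'v set \<Rightarrow> (int \<Rightarrow> ('v, 'k::field) mpoly set) \<Rightarrow> ('v, 'k, ('v, 'k) mpoly) free_cpx
    \<Rightarrow> nat \<Rightarrow> int \<Rightarrow> ('v, 'k) vec set" where
  "aug_comp V M F n d = (case n of 0 \<Rightarrow> {\<lambda>b. if b = 0 then m else 0 | m. m \<in> M d} | Suc i \<Rightarrow> free_comp V F i d)"

definition aug_diff :: "('v, 'k::field, ('v, 'k) mpoly) free_cpx \<Rightarrow> nat \<Rightarrow> ('v, 'k) vec \<Rightarrow> ('v, 'k) vec" where
  "aug_diff F n = lin_ext (rk F n) (\<lambda>c b. case n of 0 \<Rightarrow> if b = 0 then aug F c else 0
     | Suc i \<Rightarrow> if b < rk F i then dmat F i b c else 0)"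

lemma aug_diff_0: "aug_diff F 0 f = (\<lambda>b. if b = 0 then aug_map (*) F f else 0)"
  by (auto simp: aug_diff_def lin_ext_def aug_map_def)

lemma aug_diff_Suc: "aug_diff F (Suc i) f = free_map F i f"
  by (auto simp: aug_diff_def lin_ext_def free_map_def mult.commute)

lemma mod_map_aug_diff: "mod_map (aug_diff F n)"
  unfolding aug_diff_def by (rule mod_map_lin_ext)

lemma free_comp_vadd: "f \<in> free_comp V F i d \<Longrightarrow> g \<in> free_comp V F i d \<Longrightarrow> vadd f g \<in> free_comp V F i d"
  by (simp add: free_comp_def vadd_def hom_comp_add)

lemma free_comp_smul:
  assumes "r \<in> hom_comp V e" "f \<in> free_comp V F i d" shows "smul r f \<in> free_comp V F i (e + d)"
proof -
  have "r * f b \<in> hom_comp V (e + d - bdeg F i b)" if "b < rk F i" for b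
    using hom_comp_mult[OF assms(1), of "f b" "d - bdeg F i b"] assms(2) that by (simp add: free_comp_def add_diff_eq)
  then show ?thesis using assms(2) by (simp add: free_comp_def smul_def)
qed

lemma free_comp_vneg: "f \<in> free_comp V F i d \<Longrightarrow> vneg f \<in> free_comp V F i d"
  by (simp add: free_comp_def vneg_def hom_comp_uminus)

lemma free_comp_vzero: "vzero \<in> free_comp V F i d"
  by (simp add: free_comp_def vzero_def)

lemma free_comp_unit: "c < rk F i \<Longrightarrow> unit_vec c \<in> free_comp V F i (bdeg F i c)"
  by (auto simp: free_comp_def unit_vec_def hom_comp_one)

lemma free_comp_outside: "f \<in> free_comp V F i d \<Longrightarrow> b \<ge> rk F i \<Longrightarrow> f b = 0"
  by (simp add: free_comp_def)

definition resolves :: "'v set \<Rightarrow> (int \<Rightarrow> ('v, 'k::field) mpoly set) \<Rightarrow> ('v, 'k, ('v, 'k) mpoly) free_cpx \<Rightarrow> bool" where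
  "resolves V M F \<longleftrightarrow> graded_free_resolution V (*) M F"

lemma aug_comp_0:
  assumes "resolves V M F"
  shows "aug_comp V M F 0 d = aug_diff F 0 ` aug_comp V M F 1 d"
proof -
  have "aug_map (*) F ` free_comp V F 0 d = M d"
    using assms by (simp add: resolves_def graded_free_resolution_def)
  then show ?thesis
    by (simp add: aug_comp_def aug_diff_0[abs_def] Setcompr_eq_image image_image flip: \<open>_ = M d\<close>)
qed

lemma aug_exact:
  assumes "resolves V M F"
  shows "{f \<in> aug_comp V M F (Suc n) d. aug_diff F n f = vzero} = aug_diff F (Suc n) ` aug_comp V M F (Suc (Suc n)) d"
proof (cases n)
  case 0
  have "{f \<in> free_comp V F 0 d. aug_map (*) F f = 0} = free_map F 0 ` free_comp V F 1 d"
    using assms by (simp add: resolves_def graded_free_resolution_def)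
  moreover have "aug_diff F 0 f = vzero \<longleftrightarrow> aug_map (*) F f = 0" for f
    unfolding aug_diff_0 vzero_def by (auto simp: fun_eq_iff)
  ultimately show ?thesis unfolding 0 by (simp add: aug_comp_def aug_diff_Suc[abs_def])
next
  case (Suc i)
  have "{f \<in> free_comp V F (Suc i) d. free_map F i f = (\<lambda>_. 0)} = free_map F (Suc i) ` free_comp V F (Suc (Suc i)) d"
    using assms unfolding resolves_def graded_free_resolution_def by blast
  then show ?thesis unfolding Suc by (simp add: aug_comp_def aug_diff_Suc[abs_def] vzero_def)
qed

text \<open>\<open>M\<close> is merely a family of sets; its closure properties are inherited from
  \<open>F\<^sub>0\<close>, of which it is the image.\<close>

lemma aug_closed:
  assumes "resolves V M F"
  shows "f \<in> aug_comp V M F n d \<Longrightarrow> g \<in> aug_comp V M F n d \<Longrightarrow> vadd f g \<in> aug_comp V M F n d"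
    "r \<in> hom_comp V e \<Longrightarrow> f \<in> aug_comp V M F n d \<Longrightarrow> smul r f \<in> aug_comp V M F n (e + d)"
    "f \<in> aug_comp V M F n d \<Longrightarrow> vneg f \<in> aug_comp V M F n d"
    "vzero \<in> aug_comp V M F n d"
proof -
  have *: "aug_comp V M F 1 = free_comp V F 0" by (auto simp: aug_comp_def)
  note L = mod_mapD[OF mod_map_aug_diff[of F 0], symmetric]
  show "vadd f g \<in> aug_comp V M F n d" if "f \<in> aug_comp V M F n d" "g \<in> aug_comp V M F n d"
  proof (cases n)
    case 0
    then have "f \<in> aug_diff F 0 ` free_comp V F 0 d" "g \<in> aug_diff F 0 ` free_comp V F 0 d"
      using that unfolding 0 aug_comp_0[OF assms] * by blast+
    then obtain f' g' where "f' \<in> free_comp V F 0 d" "g' \<in> free_comp V F 0 d" "f = aug_diff F 0 f'" "g = aug_diff F 0 g'"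
      by blast
    then show ?thesis unfolding 0 aug_comp_0[OF assms] * by (auto simp: L intro!: imageI free_comp_vadd)
  qed (use that free_comp_vadd in \<open>auto simp: aug_comp_def\<close>)
  show "smul r f \<in> aug_comp V M F n (e + d)" if "r \<in> hom_comp V e" "f \<in> aug_comp V M F n d"
  proof (cases n)
    case 0
    then have "f \<in> aug_diff F 0 ` free_comp V F 0 d"
      using that unfolding 0 aug_comp_0[OF assms] * by blast
    then obtain f' where "f' \<in> free_comp V F 0 d" "f = aug_diff F 0 f'" by blast
    then show ?thesis unfolding 0 aug_comp_0[OF assms] * using that by (auto simp: L intro!: imageI free_comp_smul)
  qed (use that free_comp_smul in \<open>auto simp: aug_comp_def\<close>)
  show "vneg f \<in> aug_comp V M F n d" if "f \<in> aug_comp V M F n d"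
  proof (cases n)
    case 0
    then have "f \<in> aug_diff F 0 ` free_comp V F 0 d"
      using that unfolding 0 aug_comp_0[OF assms] * by blast
    then obtain f' where "f' \<in> free_comp V F 0 d" "f = aug_diff F 0 f'" by blast
    then show ?thesis unfolding 0 aug_comp_0[OF assms] * using that by (auto simp: L intro!: imageI free_comp_vneg)
  qed (use that free_comp_vneg in \<open>auto simp: aug_comp_def\<close>)
  show "vzero \<in> aug_comp V M F n d"
  proof (cases n)
    case 0
    show ?thesis unfolding 0 aug_comp_0[OF assms] * using free_comp_vzero L(5) by (metis image_eqI)
  qed (use free_comp_vzero in \<open>auto simp: aug_comp_def\<close>)
qed

lemma aug_diff_comp:
  assumes "resolves V M F" "f \<in> aug_comp V M F (Suc n) d"
  shows "aug_diff F n f \<in> aug_comp V M F n d"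
proof (cases n)
  case 0
  then show ?thesis using assms(2) aug_comp_0[OF assms(1)] by auto
next
  case (Suc m)
  then show ?thesis using aug_exact[OF assms(1), of m d] assms(2) by blast
qed

lemma aug_diff_diff:
  assumes "resolves V M F" "f \<in> aug_comp V M F (Suc (Suc n)) d"
  shows "aug_diff F n (aug_diff F (Suc n) f) = vzero"
  using aug_exact[OF assms(1), of n d] assms(2) by blast

text \<open>Exactness at positive positions, surjectivity of the augmentation at position 0, where
  no cycle condition applies.\<close>

lemma aug_lift:
  assumes "resolves V M F" "f \<in> aug_comp V M F n d" "n > 0 \<Longrightarrow> aug_diff F (n - 1) f = vzero"
  shows "\<exists>y. y \<in> aug_comp V M F (Suc n) d \<and> aug_diff F n y = f"
proof (cases n)
  case 0
  then show ?thesis using assms(2) aug_comp_0[OF assms(1)] by auto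
next
  case (Suc m)
  have "f \<in> aug_diff F (Suc m) ` aug_comp V M F (Suc (Suc m)) d"
    unfolding aug_exact[OF assms(1), symmetric] using assms(2,3) Suc by simp
  then show ?thesis unfolding Suc by blast
qed

lemma lin_ext_comp:
  assumes "resolves V M F'" "f \<in> free_comp V F i d" "\<And>c. c < rk F i \<Longrightarrow> v c \<in> aug_comp V M F' n (bdeg F i c)"
  shows "lin_ext (rk F i) v f \<in> aug_comp V M F' n d"
proof -
  have "lin_ext r v f \<in> aug_comp V M F' n d" if "r \<le> rk F i" for r
    using that
  proof (induction r)
    case 0
    have "lin_ext 0 v f = vzero" by (simp add: lin_ext_def vzero_def)
    then show ?case using aug_closed(4)[OF assms(1)] by simp
  next
    case (Suc r)
    have "f r \<in> hom_comp V (d - bdeg F i r)" using assms(2) Suc.prems by (simp add: free_comp_def)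
    moreover have "v r \<in> aug_comp V M F' n (bdeg F i r)" using assms(3) Suc.prems by simp
    ultimately have "smul (f r) (v r) \<in> aug_comp V M F' n (d - bdeg F i r + bdeg F i r)"
      by (rule aug_closed(2)[OF assms(1)])
    moreover have "lin_ext (Suc r) v f = vadd (lin_ext r v f) (smul (f r) (v r))"
      by (simp add: lin_ext_def vadd_def smul_def)
    ultimately show ?case using Suc aug_closed(1)[OF assms(1)] by simp
  qed
  then show ?thesis by simp
qed

text \<open>The comparison map over the identity of \<open>M\<close>, built by choosing preimages of
  the images of basis vectors.\<close>

primrec res_map :: "'v set \<Rightarrow> (int \<Rightarrow> ('v, 'k::field) mpoly set) \<Rightarrow> ('v, 'k, ('v, 'k) mpoly) free_cpx
    \<Rightarrow> ('v, 'k, ('v, 'k) mpoly) free_cpx \<Rightarrow> nat \<Rightarrow> ('v, 'k) vec \<Rightarrow> ('v, 'k) vec" where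
  "res_map V M F F' 0 = (\<lambda>f. f)"
| "res_map V M F F' (Suc n) = lin_ext (rk F n) (\<lambda>c. SOME y. y \<in> aug_comp V M F' (Suc n) (bdeg F n c) \<and>
     aug_diff F' n y = res_map V M F F' n (aug_diff F n (unit_vec c)))"

declare res_map.simps(2) [simp del]

lemma mod_map_res_map: "mod_map (res_map V M F F' n)"
  by (cases n) (auto simp: mod_map_id mod_map_lin_ext res_map.simps(2))

text \<open>This is where freeness enters: a linear map into cycles is lifted by choosing preimages
  for the basis vectors. Separate \<open>n\<close> and \<open>m\<close> allow its use for comparison
  maps, with \<open>m = n\<close>, and for homotopies, with \<open>m = n + 1\<close>.\<close>

lemma basis_lift:
  assumes F': "resolves V M F'" and K: "mod_map K"
    and comp: "\<And>d f. f \<in> aug_comp V M F (Suc n) d \<Longrightarrow> K f \<in> aug_comp V M F' m d"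
    and cyc: "\<And>d f. f \<in> aug_comp V M F (Suc n) d \<Longrightarrow> m > 0 \<Longrightarrow> aug_diff F' (m - 1) (K f) = vzero"
    and f: "f \<in> aug_comp V M F (Suc n) d"
  defines "v \<equiv> \<lambda>c. SOME y. y \<in> aug_comp V M F' (Suc m) (bdeg F n c) \<and> aug_diff F' m y = K (unit_vec c)"
  shows "lin_ext (rk F n) v f \<in> aug_comp V M F' (Suc m) d" "aug_diff F' m (lin_ext (rk F n) v f) = K f"
proof -
  let ?P = "\<lambda>c y. y \<in> aug_comp V M F' (Suc m) (bdeg F n c) \<and> aug_diff F' m y = K (unit_vec c)"
  have v: "?P c (v c)" if "c < rk F n" for c
  proof -
    have u: "unit_vec c \<in> aug_comp V M F (Suc n) (bdeg F n c)"
      using free_comp_unit[OF that] by (simp add: aug_comp_def)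
    have "\<exists>y. ?P c y" by (rule aug_lift[OF F' comp[OF u] cyc[OF u]])
    then show ?thesis unfolding v_def by (rule someI_ex)
  qed
  have f': "f \<in> free_comp V F n d" using f by (simp add: aug_comp_def)
  show "lin_ext (rk F n) v f \<in> aug_comp V M F' (Suc m) d"
    by (rule lin_ext_comp[OF F' f']) (use v in blast)
  have "aug_diff F' m (lin_ext (rk F n) v f) = lin_ext (rk F n) (\<lambda>c. aug_diff F' m (v c)) f"
    by (rule mod_map_lin_comb[OF mod_map_aug_diff])
  also have "\<dots> = lin_ext (rk F n) (\<lambda>c. K (unit_vec c)) f"
    using v by (simp add: lin_ext_def)
  also have "\<dots> = K (lin_ext (rk F n) unit_vec f)"
    by (rule mod_map_lin_comb[OF K, symmetric])
  also have "lin_ext (rk F n) unit_vec f = f"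
    by (rule lin_ext_unit_vec) (use f' free_comp_outside in blast)
  finally show "aug_diff F' m (lin_ext (rk F n) v f) = K f" .
qed

text \<open>Degrees and commutation go through the induction together: the next preimages exist only
  because the composite already lands in cycles of the right degree.\<close>

lemma res_map:
  assumes F: "resolves V M F" and F': "resolves V M F'"
  shows "(\<forall>d. \<forall>f \<in> aug_comp V M F n d. res_map V M F F' n f \<in> aug_comp V M F' n d) \<and>
    (\<forall>d. \<forall>f \<in> aug_comp V M F (Suc n) d. res_map V M F F' (Suc n) f \<in> aug_comp V M F' (Suc n) d \<and>
      aug_diff F' n (res_map V M F F' (Suc n) f) = res_map V M F F' n (aug_diff F n f))"
proof (induction n)
  case 0
  have eq: "aug_comp V M F 0 = aug_comp V M F' 0" by (auto simp: aug_comp_def)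
  then have comp: "aug_diff F 0 f \<in> aug_comp V M F' 0 d" if "f \<in> aug_comp V M F (Suc 0) d" for d f
    using aug_diff_comp[OF F that] by simp
  have "res_map V M F F' (Suc 0) f \<in> aug_comp V M F' (Suc 0) d \<and>
      aug_diff F' 0 (res_map V M F F' (Suc 0) f) = res_map V M F F' 0 (aug_diff F 0 f)"
    if "f \<in> aug_comp V M F (Suc 0) d" for d f
    unfolding res_map.simps by (intro conjI basis_lift[OF F' mod_map_aug_diff comp _ that]) simp_all
  then show ?case using eq by simp
next
  case (Suc n)
  let ?K = "\<lambda>f. res_map V M F F' (Suc n) (aug_diff F (Suc n) f)"
  have K: "mod_map ?K" by (rule mod_map_comp[OF mod_map_res_map mod_map_aug_diff])
  have comp: "?K f \<in> aug_comp V M F' (Suc n) d" if "f \<in> aug_comp V M F (Suc (Suc n)) d" for d f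
    using Suc aug_diff_comp[OF F that] by blast
  have cyc: "aug_diff F' (Suc n - 1) (?K f) = vzero" if "f \<in> aug_comp V M F (Suc (Suc n)) d" for d f
    using Suc aug_diff_comp[OF F that] aug_diff_diff[OF F that] mod_mapD(5)[OF mod_map_res_map[of V M F F' n]] by auto
  have "res_map V M F F' (Suc (Suc n)) f \<in> aug_comp V M F' (Suc (Suc n)) d \<and>
      aug_diff F' (Suc n) (res_map V M F F' (Suc (Suc n)) f) = ?K f"
    if "f \<in> aug_comp V M F (Suc (Suc n)) d" for d f
    unfolding res_map.simps(2)[of V M F F' "Suc n"]
    by (intro conjI basis_lift[OF F' K comp cyc that])
  then show ?case using Suc by blast
qed

lemma res_map_comp:
  "resolves V M F \<Longrightarrow> resolves V M F' \<Longrightarrow> f \<in> aug_comp V M F n d \<Longrightarrow> res_map V M F F' n f \<in> aug_comp V M F' n d"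
  using res_map by blast

lemma res_map_diff:
  "resolves V M F \<Longrightarrow> resolves V M F' \<Longrightarrow> f \<in> aug_comp V M F (Suc n) d \<Longrightarrow>
    aug_diff F' n (res_map V M F F' (Suc n) f) = res_map V M F F' n (aug_diff F n f)"
  using res_map by blast

text \<open>The remainder \<open>id - \<chi> - h d\<close>, which the next stage of the homotopy has
  to bound.\<close>

definition defect :: "(nat \<Rightarrow> ('v, 'k::field) vec \<Rightarrow> ('v, 'k) vec) \<Rightarrow> ('v, 'k, ('v, 'k) mpoly) free_cpx \<Rightarrow> nat
    \<Rightarrow> (('v, 'k) vec \<Rightarrow> ('v, 'k) vec) \<Rightarrow> ('v, 'k) vec \<Rightarrow> ('v, 'k) vec" where
  "defect \<chi> F n h f = vadd f (vneg (vadd (\<chi> (Suc n) f) (h (aug_diff F n f))))"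

text \<open>It starts with zero because \<open>\<chi>\<close> will be a lift of the identity of
  \<open>M\<close>.\<close>

primrec homotopy :: "'v set \<Rightarrow> (int \<Rightarrow> ('v, 'k::field) mpoly set) \<Rightarrow> ('v, 'k, ('v, 'k) mpoly) free_cpx
    \<Rightarrow> (nat \<Rightarrow> ('v, 'k) vec \<Rightarrow> ('v, 'k) vec) \<Rightarrow> nat \<Rightarrow> ('v, 'k) vec \<Rightarrow> ('v, 'k) vec" where
  "homotopy V M F \<chi> 0 = (\<lambda>f. vzero)"
| "homotopy V M F \<chi> (Suc n) = lin_ext (rk F n) (\<lambda>c. SOME z. z \<in> aug_comp V M F (Suc (Suc n)) (bdeg F n c) \<and>
     aug_diff F (Suc n) z = defect \<chi> F n (homotopy V M F \<chi> n) (unit_vec c))"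

declare homotopy.simps(2) [simp del]

lemma mod_map_homotopy: "mod_map (homotopy V M F \<chi> n)"
  by (cases n) (auto simp: mod_map_zero mod_map_lin_ext homotopy.simps(2))

lemma vec_simps:
  "vadd f (vneg f) = vzero" "vadd f vzero = f" "vadd vzero f = f" "vneg vzero = vzero"
  "vadd (vadd f g) h = vadd f (vadd g h)" "vneg (vadd f g) = vadd (vneg f) (vneg g)" "vneg (vneg f) = f"
  "vadd f g = vadd g f"
  by (auto simp: vadd_def vneg_def vzero_def)

lemma mod_map_defect:
  fixes \<chi> :: "nat \<Rightarrow> ('v, 'k::field) vec \<Rightarrow> ('v, 'k) vec"
  assumes "mod_map (\<chi> (Suc n))" "mod_map h"
  shows "mod_map (defect \<chi> F n h)"
proof -
  note rules = mod_mapD[OF assms(1)] mod_mapD[OF assms(2)] mod_mapD[OF mod_map_aug_diff[of F n]]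
  show ?thesis
    unfolding mod_map_def defect_def rules(1,2,6,7,11,12)
  proof (intro conjI allI impI)
    fix f :: "('v, 'k) vec" assume f: "const_part f = (\<lambda>_. 0)"
    have "const_part (\<chi> (Suc n) f) = (\<lambda>_. 0)" "const_part (h (aug_diff F n f)) = (\<lambda>_. 0)"
      using rules(3,8,13) f by blast+
    then show "const_part (vadd f (vneg (vadd (\<chi> (Suc n) f) (h (aug_diff F n f))))) = (\<lambda>_. 0)"
      using f by (simp add: const_part_vadd const_part_vneg)
  qed (auto simp: rules vadd_def vneg_def smul_def algebra_simps)
qed

section \<open>The homotopy from an endomorphism of a resolution to the identity\<close>

context
  fixes V :: "'v set" and M F and \<chi> :: "nat \<Rightarrow> ('v, 'k::field) vec \<Rightarrow> ('v, 'k) vec"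
  assumes F: "resolves V M F" and \<chi>_mod: "\<And>n. mod_map (\<chi> n)" and \<chi>_0: "\<And>f. \<chi> 0 f = f"
    and \<chi>_comp: "\<And>n d f. f \<in> aug_comp V M F n d \<Longrightarrow> \<chi> n f \<in> aug_comp V M F n d"
    and \<chi>_diff: "\<And>n d f. f \<in> aug_comp V M F (Suc n) d \<Longrightarrow> aug_diff F n (\<chi> (Suc n) f) = \<chi> n (aug_diff F n f)"
begin

lemma defect_comp:
  assumes "\<And>d f. f \<in> aug_comp V M F n d \<Longrightarrow> h f \<in> aug_comp V M F (Suc n) d" "f \<in> aug_comp V M F (Suc n) d"
  shows "defect \<chi> F n h f \<in> aug_comp V M F (Suc n) d"
  unfolding defect_def by (intro aug_closed[OF F] \<chi>_comp assms aug_diff_comp[OF F])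

lemma homotopy_step:
  assumes h: "\<And>d f. f \<in> aug_comp V M F n d \<Longrightarrow> homotopy V M F \<chi> n f \<in> aug_comp V M F (Suc n) d"
    and cyc: "\<And>d f. f \<in> aug_comp V M F (Suc n) d \<Longrightarrow> aug_diff F n (defect \<chi> F n (homotopy V M F \<chi> n) f) = vzero"
    and f: "f \<in> aug_comp V M F (Suc n) d"
  shows "homotopy V M F \<chi> (Suc n) f \<in> aug_comp V M F (Suc (Suc n)) d"
    "aug_diff F (Suc n) (homotopy V M F \<chi> (Suc n) f) = defect \<chi> F n (homotopy V M F \<chi> n) f"
  unfolding homotopy.simps(2)
  by (intro basis_lift[OF F mod_map_defect[OF \<chi>_mod mod_map_homotopy] defect_comp[OF h] _ f], simp_all add: cyc)+

lemma homotopy: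
  "(\<forall>d. \<forall>f \<in> aug_comp V M F n d. homotopy V M F \<chi> n f \<in> aug_comp V M F (Suc n) d) \<and>
   (\<forall>d. \<forall>f \<in> aug_comp V M F (Suc n) d. aug_diff F n (defect \<chi> F n (homotopy V M F \<chi> n) f) = vzero)"
proof (induction n)
  case 0
  have "aug_diff F 0 (defect \<chi> F 0 (homotopy V M F \<chi> 0) f) = vzero" if "f \<in> aug_comp V M F (Suc 0) d" for d f
    using \<chi>_diff[OF that] by (simp add: defect_def mod_mapD[OF mod_map_aug_diff] \<chi>_0 vec_simps)
  then show ?case using aug_closed(4)[OF F] by auto
next
  case (Suc n)
  have st: "homotopy V M F \<chi> (Suc n) f \<in> aug_comp V M F (Suc (Suc n)) d"
    "aug_diff F (Suc n) (homotopy V M F \<chi> (Suc n) f) = defect \<chi> F n (homotopy V M F \<chi> n) f"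
    if "f \<in> aug_comp V M F (Suc n) d" for d f
    using homotopy_step[of n f d] Suc that by blast+
  have "aug_diff F (Suc n) (defect \<chi> F (Suc n) (homotopy V M F \<chi> (Suc n)) f) = vzero"
    if f: "f \<in> aug_comp V M F (Suc (Suc n)) d" for d f
  proof -
    let ?x = "aug_diff F (Suc n) f"
    have x: "?x \<in> aug_comp V M F (Suc n) d" by (rule aug_diff_comp[OF F f])
    \<comment> \<open>By the previous stage the boundary of the homotopy at \<open>?x\<close> is the
      defect of \<open>?x\<close>; its last term vanishes since \<open>?x\<close> is itself a
      boundary, and the rest cancels.\<close>
    have "aug_diff F (Suc n) (defect \<chi> F (Suc n) (homotopy V M F \<chi> (Suc n)) f)
        = vadd ?x (vneg (vadd (\<chi> (Suc n) ?x) (defect \<chi> F n (homotopy V M F \<chi> n) ?x)))"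
      unfolding defect_def[of \<chi> F "Suc n"] mod_mapD[OF mod_map_aug_diff] \<chi>_diff[OF f] st(2)[OF x] ..
    also have "\<dots> = vzero"
      unfolding defect_def aug_diff_diff[OF F f] mod_mapD(5)[OF mod_map_homotopy]
      by (auto simp: vadd_def vneg_def vzero_def)
    finally show ?thesis .
  qed
  then show ?case using st by blast
qed

lemma homotopy_eq:
  assumes "f \<in> aug_comp V M F (Suc n) d"
  shows "homotopy V M F \<chi> (Suc n) f \<in> aug_comp V M F (Suc (Suc n)) d"
    "aug_diff F (Suc n) (homotopy V M F \<chi> (Suc n) f) = defect \<chi> F n (homotopy V M F \<chi> n) f"
  using homotopy_step[of n f d] homotopy[of n] assms by blast+

end

text \<open>Nonvanishing of \<open>H\<^sub>i(F \<otimes> K)\<^sub>j\<close>, expressed by elements of \<open>F\<close> modulo the irrelevant ideal.\<close>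

definition mod_hom :: "'v set \<Rightarrow> (int \<Rightarrow> ('v, 'k::field) mpoly set) \<Rightarrow> ('v, 'k, ('v, 'k) mpoly) free_cpx \<Rightarrow> nat \<Rightarrow> int \<Rightarrow> bool" where
  "mod_hom V M F i j \<longleftrightarrow> (\<exists>f \<in> aug_comp V M F (Suc i) j. (i > 0 \<longrightarrow> const_part (aug_diff F i f) = (\<lambda>_. 0)) \<and>
     \<not> (\<exists>g \<in> aug_comp V M F (Suc (Suc i)) j. const_part (vadd f (vneg (aug_diff F (Suc i) g))) = (\<lambda>_. 0)))"

text \<open>A class of \<open>F\<close> that dies in \<open>F'\<close> is still dead after the
  return to \<open>F\<close>. The homotopy replaces the round trip by the identity up to
  \<open>h (d f)\<close>, and this vanishes modulo the irrelevant ideal because \<open>d f\<close>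
  does.\<close>

lemma mod_hom_transfer:
  assumes F: "resolves V M F" and F': "resolves V M F'" and nz: "mod_hom V M F i j"
  shows "mod_hom V M F' i j"
proof (rule ccontr)
  assume z: "\<not> mod_hom V M F' i j"
  obtain f where f: "f \<in> aug_comp V M F (Suc i) j" "i > 0 \<Longrightarrow> const_part (aug_diff F i f) = (\<lambda>_. 0)"
    "\<And>g. g \<in> aug_comp V M F (Suc (Suc i)) j \<Longrightarrow> const_part (vadd f (vneg (aug_diff F (Suc i) g))) \<noteq> (\<lambda>_. 0)"
    using nz unfolding mod_hom_def by blast
  let ?\<phi> = "res_map V M F F'" and ?\<psi> = "res_map V M F' F"
  let ?\<chi> = "\<lambda>n f. ?\<psi> n (?\<phi> n f)"
  let ?h = "homotopy V M F ?\<chi>"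
  have "const_part (aug_diff F' i (?\<phi> (Suc i) f)) = (\<lambda>_. 0)" if "i > 0"
    unfolding res_map_diff[OF F F' f(1)] by (rule mod_mapD(3)[OF mod_map_res_map]) (rule f(2)[OF that])
  then obtain g where g: "g \<in> aug_comp V M F' (Suc (Suc i)) j"
    "const_part (vadd (?\<phi> (Suc i) f) (vneg (aug_diff F' (Suc i) g))) = (\<lambda>_. 0)"
    using z res_map_comp[OF F F' f(1)] unfolding mod_hom_def by blast
  have "const_part (?\<psi> (Suc i) (vadd (?\<phi> (Suc i) f) (vneg (aug_diff F' (Suc i) g)))) = (\<lambda>_. 0)"
    by (rule mod_mapD(3)[OF mod_map_res_map g(2)])
  then have 1: "const_part (vadd (?\<chi> (Suc i) f) (vneg (aug_diff F (Suc i) (?\<psi> (Suc (Suc i)) g)))) = (\<lambda>_. 0)"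
    unfolding mod_mapD(1,4)[OF mod_map_res_map] res_map_diff[OF F' F g(1)] .
  have \<chi>: "mod_map (?\<chi> n)" "?\<chi> 0 f = f" "f \<in> aug_comp V M F n d \<Longrightarrow> ?\<chi> n f \<in> aug_comp V M F n d"
    "f \<in> aug_comp V M F (Suc n) d \<Longrightarrow> aug_diff F n (?\<chi> (Suc n) f) = ?\<chi> n (aug_diff F n f)" for n f d
  proof -
    show "mod_map (?\<chi> n)" by (rule mod_map_comp[OF mod_map_res_map mod_map_res_map])
    show "f \<in> aug_comp V M F n d \<Longrightarrow> ?\<chi> n f \<in> aug_comp V M F n d"
      using res_map_comp[OF F F'] res_map_comp[OF F' F] by blast
    show "f \<in> aug_comp V M F (Suc n) d \<Longrightarrow> aug_diff F n (?\<chi> (Suc n) f) = ?\<chi> n (aug_diff F n f)"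
      using res_map_comp[OF F F'] res_map_diff[OF F F'] res_map_diff[OF F' F] by metis
  qed simp
  note hom = homotopy_eq[of V M F ?\<chi>, OF F \<chi> f(1)]
  \<comment> \<open>For \<open>i = 0\<close> nothing is assumed about the augmentation of
    \<open>f\<close>, but there the homotopy is zero.\<close>
  have 2: "const_part (?h i (aug_diff F i f)) = (\<lambda>_. 0)"
  proof (cases "i = 0")
    case True
    then show ?thesis by (simp add: const_part_def vzero_def)
  next
    case False
    then show ?thesis by (intro mod_mapD(3)[OF mod_map_homotopy] f(2)) simp
  qed
  let ?g = "vadd (?h (Suc i) f) (?\<psi> (Suc (Suc i)) g)"
  have "?g \<in> aug_comp V M F (Suc (Suc i)) j"
    by (intro aug_closed(1)[OF F] hom(1) res_map_comp[OF F' F] g(1))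
  moreover have "vadd f (vneg (aug_diff F (Suc i) ?g))
      = vadd (vadd (?\<chi> (Suc i) f) (vneg (aug_diff F (Suc i) (?\<psi> (Suc (Suc i)) g)))) (?h i (aug_diff F i f))"
  proof -
    have e: "aug_diff F (Suc i) (?h (Suc i) f) = vadd f (vneg (vadd (?\<chi> (Suc i) f) (?h i (aug_diff F i f))))"
      using hom(2) unfolding defect_def .
    show ?thesis unfolding mod_mapD(1)[OF mod_map_aug_diff] e by (auto simp: vadd_def vneg_def)
  qed
  then have "const_part (vadd f (vneg (aug_diff F (Suc i) ?g))) = (\<lambda>_. 0)"
    by (simp add: const_part_vadd[of _ "?h i (aug_diff F i f)"] 1 2)
  ultimately show False using f(3) by blast
qed

text \<open>A nonzero constant term of a homogeneous entry forces the degree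
  \<open>j - bdeg F i b\<close> of that entry to be 0.\<close>

lemma const_part_comp: "f \<in> free_comp V F i j \<Longrightarrow> const_part f \<in> tensor_comp F i j"
proof -
  assume f: "f \<in> free_comp V F i j"
  have "b < rk F i \<and> bdeg F i b = j" if "const_part f b \<noteq> 0" for b
  proof -
    have 0: "0 \<in> Poly_Mapping.keys (f b)" using that by (simp add: const_part_def in_keys_iff)
    have "b < rk F i"
    proof (rule ccontr)
      assume "\<not> b < rk F i"
      then have "f b = 0" using free_comp_outside[OF f] by simp
      then show False using 0 by simp
    qed
    moreover from this f have "f b \<in> hom_comp V (j - bdeg F i b)" by (simp add: free_comp_def)
    then have "\<forall>m\<in>Poly_Mapping.keys (f b). int (monom_deg m) = j - bdeg F i b" by (simp add: hom_comp_def)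
    from bspec[OF this 0] have "0 = j - bdeg F i b" by simp
    ultimately show ?thesis by simp
  qed
  then show ?thesis by (simp add: tensor_comp_def)
qed

lemma const_part_lift:
  assumes "t \<in> tensor_comp F i j"
  obtains f where "f \<in> free_comp V F i j" "const_part f = t"
proof (rule that)
  let ?f = "\<lambda>b. Poly_Mapping.single 0 (t b)"
  show "?f \<in> free_comp V F i j"
    unfolding free_comp_def
  proof (intro CollectI conjI allI impI)
    fix b
    show "?f b \<in> hom_comp V (j - bdeg F i b)" if "b < rk F i"
      using assms hom_comp_const by (cases "t b = 0") (auto simp: tensor_comp_def)
    show "?f b = 0" if "b \<ge> rk F i" using assms that by (cases "t b = 0") (auto simp: tensor_comp_def)
  qed
  show "const_part ?f = t" by (simp add: const_part_def)
qed

lemma const_part_free_map: "const_part (free_map F i f) = tensor_map F i (const_part f)"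
  by (rule ext) (simp add: const_part_def free_map_def tensor_map_def lookup_sum lookup_mult_0)

section \<open>Homology of the tensor product with the field\<close>

definition tensor_nonzero :: "('v, 'k::field, 'm) free_cpx \<Rightarrow> nat \<Rightarrow> int \<Rightarrow> bool" where
  "tensor_nonzero F i j \<longleftrightarrow> (\<exists>f \<in> tensor_cycles F i j. f \<notin> tensor_boundaries F i j)"

lemma tensor_map_diff: "tensor_map F i (\<lambda>b. f b - g b) = (\<lambda>b. tensor_map F i f b - tensor_map F i g b)"
  by (rule ext) (simp add: tensor_map_def right_diff_distrib sum_subtractf)

lemma tensor_map_zero: "tensor_map F i (\<lambda>_. 0) = (\<lambda>_. 0)"
  by (rule ext) (simp add: tensor_map_def)

lemma tensor_comp_diff: "f \<in> tensor_comp F i j \<Longrightarrow> g \<in> tensor_comp F i j \<Longrightarrow> (\<lambda>b. f b - g b) \<in> tensor_comp F i j"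
  unfolding tensor_comp_def mem_Collect_eq by (metis diff_zero)

lemma tensor_cycles_diff:
  assumes "f \<in> tensor_cycles F i j" "g \<in> tensor_cycles F i j"
  shows "(\<lambda>b. f b - g b) \<in> tensor_cycles F i j"
  using assms tensor_comp_diff[of f F i j g]
  by (auto simp: tensor_cycles_def tensor_map_diff split: nat.splits)

lemma tensor_boundaries_diff:
  assumes "f \<in> tensor_boundaries F i j" "g \<in> tensor_boundaries F i j"
  shows "(\<lambda>b. f b - g b) \<in> tensor_boundaries F i j"
proof -
  obtain f' g' where fg: "f' \<in> tensor_comp F (Suc i) j" "g' \<in> tensor_comp F (Suc i) j"
    "f = tensor_map F i f'" "g = tensor_map F i g'"
    using assms by (auto simp: tensor_boundaries_def)
  show ?thesis unfolding tensor_boundaries_def fg(3,4) tensor_map_diff[symmetric]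
    by (rule imageI) (rule tensor_comp_diff[OF fg(1,2)])
qed

lemma tensor_zero_mem: "(\<lambda>_. 0) \<in> tensor_cycles F i j" "(\<lambda>_. 0) \<in> tensor_boundaries F i j"
proof -
  have 0: "(\<lambda>_. 0) \<in> tensor_comp F i j" for i by (simp add: tensor_comp_def)
  show "(\<lambda>_. 0) \<in> tensor_cycles F i j" by (simp add: tensor_cycles_def 0 tensor_map_zero split: nat.split)
  show "(\<lambda>_. 0) \<in> tensor_boundaries F i j"
    unfolding tensor_boundaries_def by (rule image_eqI[where x = "\<lambda>_. 0"]) (simp_all add: tensor_map_zero 0)
qed

lemma tensor_homology_nonzero:
  "(\<exists>a \<in> tensor_homology F i j. \<exists>b \<in> tensor_homology F i j. a \<noteq> b) \<longleftrightarrow> tensor_nonzero F i j"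
proof -
  let ?Z = "tensor_cycles F i j" and ?B = "tensor_boundaries F i j"
  define R where "R = {(f, g). f \<in> ?Z \<and> g \<in> ?Z \<and> (\<lambda>b. f b - g b) \<in> ?B}"
  have sym: "(\<lambda>b. g b - f b) \<in> ?B" if "(\<lambda>b. f b - g b) \<in> ?B" for f g
    using tensor_boundaries_diff[OF tensor_zero_mem(2) that] by simp
  have equiv: "equiv ?Z R"
  proof (rule equivI)
    show "R \<subseteq> ?Z \<times> ?Z" by (auto simp: R_def)
    show "refl_on ?Z R" using tensor_zero_mem(2) by (auto simp: refl_on_def R_def)
    show "sym R" using sym by (auto simp: sym_def R_def)
    show "trans R"
    proof (rule transI)
      fix f g h assume *: "(f, g) \<in> R" "(g, h) \<in> R"
      have "(\<lambda>b. h b - g b) \<in> ?B" using *(2) sym by (auto simp: R_def)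
      moreover have "(\<lambda>b. f b - g b) \<in> ?B" using *(1) by (simp add: R_def)
      ultimately have "(\<lambda>b. (f b - g b) - (h b - g b)) \<in> ?B" using tensor_boundaries_diff by blast
      then show "(f, h) \<in> R" using * by (simp add: R_def)
    qed
  qed
  have H: "tensor_homology F i j = ?Z // R" by (simp add: tensor_homology_def R_def)
  show ?thesis
  proof
    assume "\<exists>a \<in> tensor_homology F i j. \<exists>b \<in> tensor_homology F i j. a \<noteq> b"
    then obtain f g where fg: "f \<in> ?Z" "g \<in> ?Z" "R `` {f} \<noteq> R `` {g}"
      unfolding H by (auto elim!: quotientE)
    then have "(f, g) \<notin> R" using equiv_class_eq[OF equiv] by blast
    then have "(\<lambda>b. f b - g b) \<notin> ?B" using fg by (simp add: R_def)
    then show "tensor_nonzero F i j" unfolding tensor_nonzero_def using tensor_cycles_diff[OF fg(1,2)] by blast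
  next
    assume "tensor_nonzero F i j"
    then obtain f where f: "f \<in> ?Z" "f \<notin> ?B" unfolding tensor_nonzero_def by blast
    then have "(f, \<lambda>_. 0) \<notin> R" by (simp add: R_def)
    then have neq: "R `` {f} \<noteq> R `` {\<lambda>_. 0}" using eq_equiv_class[OF _ equiv tensor_zero_mem(1)] by blast
    then show "\<exists>a \<in> tensor_homology F i j. \<exists>b \<in> tensor_homology F i j. a \<noteq> b"
      unfolding H
    proof (intro bexI)
      show "R `` {f} \<noteq> R `` {\<lambda>_. 0}" by (rule neq)
      show "R `` {f} \<in> ?Z // R" by (rule quotientI[OF f(1)])
      show "R `` {\<lambda>_. 0} \<in> ?Z // R" by (rule quotientI[OF tensor_zero_mem(1)])
    qed
  qed
qed

text \<open>\<open>const_part\<close> maps each \<open>F\<^sub>i\<close> onto its tensor product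
  with the field, in every degree, and commutes with the differentials.\<close>

lemma mod_hom_tensor: "mod_hom V M F i j \<longleftrightarrow> tensor_nonzero F i j"
proof -
  have comp: "aug_comp V M F (Suc m) j = free_comp V F m j" for m by (simp add: aug_comp_def)
  have diff: "const_part (aug_diff F (Suc m) f) = tensor_map F m (const_part f)" for m f
    by (simp add: aug_diff_Suc const_part_free_map)
  have cyc: "(i > 0 \<longrightarrow> const_part (aug_diff F i f) = (\<lambda>_. 0)) \<longleftrightarrow> const_part f \<in> tensor_cycles F i j"
    if "f \<in> free_comp V F i j" for f
    using const_part_comp[OF that] by (cases i) (simp_all add: tensor_cycles_def diff)
  have bd: "(\<exists>g \<in> free_comp V F (Suc i) j. const_part (vadd f (vneg (aug_diff F (Suc i) g))) = (\<lambda>_. 0))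
      \<longleftrightarrow> const_part f \<in> tensor_boundaries F i j" for f
  proof -
    have "const_part (vadd f (vneg (aug_diff F (Suc i) g))) = (\<lambda>_. 0) \<longleftrightarrow> const_part f = tensor_map F i (const_part g)" for g
      by (simp add: const_part_vadd const_part_vneg diff fun_eq_iff)
    moreover have "const_part ` free_comp V F (Suc i) j = tensor_comp F (Suc i) j"
    proof
      show "const_part ` free_comp V F (Suc i) j \<subseteq> tensor_comp F (Suc i) j" using const_part_comp by blast
      show "tensor_comp F (Suc i) j \<subseteq> const_part ` free_comp V F (Suc i) j"
      proof
        fix t assume "t \<in> tensor_comp F (Suc i) j"
        then obtain g where "g \<in> free_comp V F (Suc i) j" "const_part g = t" by (rule const_part_lift)
        then show "t \<in> const_part ` free_comp V F (Suc i) j" by blast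
      qed
    qed
    then have "tensor_boundaries F i j = (\<lambda>g. tensor_map F i (const_part g)) ` free_comp V F (Suc i) j"
      by (simp add: tensor_boundaries_def image_image flip: \<open>_ = tensor_comp F (Suc i) j\<close>)
    ultimately show ?thesis by (simp only: image_iff)
  qed
  show ?thesis
  proof
    assume "mod_hom V M F i j"
    then show "tensor_nonzero F i j"
      unfolding mod_hom_def tensor_nonzero_def comp bd using cyc by blast
  next
    assume "tensor_nonzero F i j"
    then obtain t where t: "t \<in> tensor_cycles F i j" "t \<notin> tensor_boundaries F i j" unfolding tensor_nonzero_def by blast
    then have "t \<in> tensor_comp F i j" by (simp add: tensor_cycles_def)
    then obtain f where f: "f \<in> free_comp V F i j" "const_part f = t" by (rule const_part_lift)
    show "mod_hom V M F i j"
      unfolding mod_hom_def comp bd using f t cyc[OF f(1)] by blast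
  qed
qed

text \<open>The existence of \<open>F\<close> makes the chosen family a resolution too, and
  comparison in both directions lets \<open>F\<close> replace it.\<close>

theorem Tor_nonzero_eq:
  assumes "graded_free_resolution V (*) M F"
  shows "Tor_nonzero V (*) M i j \<longleftrightarrow> tensor_nonzero F i j"
proof -
  let ?F = "SOME F. graded_free_resolution V (*) M F"
  have "graded_free_resolution V (*) M ?F" by (rule someI) (rule assms)
  then have "resolves V M ?F" "resolves V M F" using assms by (simp_all add: resolves_def)
  then have "mod_hom V M ?F i j \<longleftrightarrow> mod_hom V M F i j" using mod_hom_transfer by blast
  then show ?thesis
    unfolding Tor_nonzero_def Tor_def tensor_homology_nonzero mod_hom_tensor .
qed

section \<open>The Taylor complex\<close>

definition sqf :: "'v set \<Rightarrow> 'v monom" where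
  "sqf S = (\<Sum>v\<in>S. Poly_Mapping.single v 1)"

lemma lookup_sqf: "finite S \<Longrightarrow> Poly_Mapping.lookup (sqf S) v = (if v \<in> S then 1 else 0)"
  by (simp add: sqf_def lookup_sum lookup_single when_def)

lemma keys_sqf [simp]: "finite S \<Longrightarrow> Poly_Mapping.keys (sqf S) = S"
  by (auto simp: in_keys_iff lookup_sqf split: if_splits)

lemma monom_deg_sqf: "finite S \<Longrightarrow> monom_deg (sqf S) = card S"
  by (simp add: monom_deg_def lookup_sqf)

lemma sqf_empty [simp]: "sqf {} = 0"
  by (simp add: sqf_def)

lemma sqf_Un: "finite S \<Longrightarrow> finite T \<Longrightarrow> S \<inter> T = {} \<Longrightarrow> sqf (S \<union> T) = sqf S + sqf T"
  by (simp add: sqf_def sum.union_disjoint)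

lemma sqf_eq_0: "finite S \<Longrightarrow> sqf S = 0 \<longleftrightarrow> S = {}"
  by (metis keys_sqf keys_zero sqf_empty)

lemma monom_diff_add:
  assumes "finite S" "S \<subseteq> Poly_Mapping.keys m"
  shows "m - sqf S + sqf S = m"
proof (rule poly_mapping_eqI)
  fix v show "Poly_Mapping.lookup (m - sqf S + sqf S) v = Poly_Mapping.lookup m v"
    using assms by (auto simp: lookup_add lookup_minus lookup_sqf in_keys_iff subset_iff)
qed

lemma lookup_single_mult_add:
  "Poly_Mapping.lookup (Poly_Mapping.single s c * p) (s + k) = c * Poly_Mapping.lookup p (k :: 'v monom)" for c :: "'k::field"
proof -
  have 1: "(\<Sum>b. Poly_Mapping.lookup p b when s + k = a + b) = Poly_Mapping.lookup p k" if "a = s" for a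
    using that by simp
  have "Poly_Mapping.lookup (Poly_Mapping.single s c * p) (s + k)
      = (\<Sum>a. Poly_Mapping.lookup (Poly_Mapping.single s c) a * (\<Sum>b. Poly_Mapping.lookup p b when s + k = a + b))"
    by (simp only: times_poly_mapping.rep_eq prod_fun_def)
  also have "(\<lambda>a. Poly_Mapping.lookup (Poly_Mapping.single s c) a * (\<Sum>b. Poly_Mapping.lookup p b when s + k = a + b))
     = (\<lambda>a. (c * Poly_Mapping.lookup p k) when a = s)"
  proof
    fix a show "Poly_Mapping.lookup (Poly_Mapping.single s c) a * (\<Sum>b. Poly_Mapping.lookup p b when s + k = a + b) = (c * Poly_Mapping.lookup p k when a = s)"
      using 1[of a] by (cases "a = s") (simp_all add: lookup_single)
  qed
  finally show ?thesis by simp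
qed

lemma keys_single_mult:
  assumes "k \<in> Poly_Mapping.keys (Poly_Mapping.single s c * p)"
  obtains k' where "k = s + k'" "k' \<in> Poly_Mapping.keys p"
  using keys_mult[of "Poly_Mapping.single s c" p] assms by (fastforce split: if_splits)

text \<open>Pairs are cancelled by induction; that the sum equals its own negative would not suffice
  in characteristic 2.\<close>

lemma sum_antisym_pairs:
  fixes F :: "'i \<Rightarrow> 'i \<Rightarrow> 'r::ab_group_add"
  assumes "finite S" "\<And>a b. a \<in> S \<Longrightarrow> b \<in> S \<Longrightarrow> a \<noteq> b \<Longrightarrow> F a b = - F b a"
  shows "(\<Sum>a\<in>S. \<Sum>b\<in>S - {a}. F a b) = 0"
  using assms
proof (induction S)
  case (insert x S)
  have IH: "(\<Sum>a\<in>S. \<Sum>b\<in>S - {a}. F a b) = 0" by (rule insert.IH, rule insert.prems) auto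
  have "(\<Sum>a\<in>S. \<Sum>b\<in>insert x S - {a}. F a b) = (\<Sum>a\<in>S. F a x + (\<Sum>b\<in>S - {a}. F a b))"
  proof (rule sum.cong)
    fix a assume "a \<in> S"
    then have "insert x S - {a} = insert x (S - {a})" using insert.hyps by auto
    then show "(\<Sum>b\<in>insert x S - {a}. F a b) = F a x + (\<Sum>b\<in>S - {a}. F a b)" using insert.hyps by simp
  qed simp
  also have "\<dots> = (\<Sum>a\<in>S. F a x)" using IH by (simp add: sum.distrib)
  also have "\<dots> = (\<Sum>a\<in>S. - F x a)" by (rule sum.cong[OF refl], rule insert.prems) (use insert.hyps in auto)
  finally have "(\<Sum>a\<in>S. \<Sum>b\<in>insert x S - {a}. F a b) = - (\<Sum>a\<in>S. F x a)" by (simp add: sum_negf)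
  moreover have "insert x S - {x} = S" using insert.hyps by auto
  ultimately show ?case using insert.hyps by simp
qed simp

lemma hom_comp_sum:
  "(\<And>x. x \<in> X \<Longrightarrow> f x \<in> hom_comp V d) \<Longrightarrow> sum f X \<in> hom_comp V d"
  by (induction X rule: infinite_finite_induct) (auto intro: hom_comp_add)

text \<open>The generators are the monomials \<open>sqf (g a)\<close>; nonempty \<open>g a\<close>
  means that none of them is a unit.\<close>

locale sqf_monomials =
  fixes V :: "'v set" and I :: "nat set" and g :: "nat \<Rightarrow> 'v set"
  assumes fin_V: "finite V" and fin_I: "finite I" and g_V: "a \<in> I \<Longrightarrow> g a \<subseteq> V" and g_ne: "a \<in> I \<Longrightarrow> g a \<noteq> {}"
begin

text \<open>\<open>sqf (supp A)\<close> is the least common multiple of the generators in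
  \<open>A\<close>.\<close>

definition supp :: "nat set \<Rightarrow> 'v set" where
  "supp A = \<Union> (g ` A)"

lemma supp_V: "A \<subseteq> I \<Longrightarrow> supp A \<subseteq> V"
  using g_V by (auto simp: supp_def)

lemma fin_supp: "A \<subseteq> I \<Longrightarrow> finite (supp A)"
  using supp_V fin_V finite_subset by blast

lemma supp_insert [simp]: "supp (insert a B) = g a \<union> supp B"
  by (simp add: supp_def)

lemma supp_empty [simp]: "supp {} = {}"
  by (simp add: supp_def)

lemma supp_mono: "A \<subseteq> B \<Longrightarrow> supp A \<subseteq> supp B"
  by (auto simp: supp_def)

text \<open>\<open>sqf (g a - supp B)\<close> is the quotient of the least common multiples of
  \<open>insert a B\<close> and \<open>B\<close>.\<close>

definition taylor_diff :: "(nat set \<Rightarrow> ('v, 'k::field) mpoly) \<Rightarrow> nat set \<Rightarrow> ('v, 'k) mpoly" where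
  "taylor_diff f B = (if B \<subseteq> I then
     \<Sum>a\<in>I - B. Poly_Mapping.single (sqf (g a - supp B)) (rem_sign a B) * f (insert a B) else 0)"

text \<open>Basis element \<open>A\<close> has the degree of its least common multiple. Level 0,
  spanned by the empty set, is the ring; the ideal will be the image of level 1.\<close>

definition taylor_comp :: "nat \<Rightarrow> int \<Rightarrow> (nat set \<Rightarrow> ('v, 'k::field) mpoly) set" where
  "taylor_comp n d = {f. \<forall>A. (f A \<noteq> 0 \<longrightarrow> A \<subseteq> I \<and> card A = n) \<and> f A \<in> hom_comp V (d - int (card (supp A)))}"

text \<open>The coefficient of \<open>f\<close> in multidegree \<open>m\<close>.\<close>

definition mcoeff :: "(nat set \<Rightarrow> ('v, 'k::field) mpoly) \<Rightarrow> 'v monom \<Rightarrow> nat set \<Rightarrow> 'k" where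
  "mcoeff f m A = (if supp A \<subseteq> Poly_Mapping.keys m then Poly_Mapping.lookup (f A) (m - sqf (supp A)) else 0)"

lemma mcoeff_zero: "mcoeff (\<lambda>_. 0) m A = 0"
  by (simp add: mcoeff_def)

lemma mcoeff_add:
  assumes "A \<subseteq> I"
  shows "mcoeff f (k + sqf (supp A)) A = Poly_Mapping.lookup (f A) k"
  using fin_supp[OF assms] by (simp add: mcoeff_def keys_add_nat)

text \<open>The monomial factors are absorbed by the shifts \<open>sqf (supp A)\<close>; so in each
  multidegree the Taylor differential becomes a simplicial boundary with scalar
  coefficients.\<close>

lemma mcoeff_taylor_diff:
  assumes B: "B \<subseteq> I"
  shows "mcoeff (taylor_diff f) m B = (\<Sum>a\<in>I - B. rem_sign a B * mcoeff f m (insert a B))"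
proof (cases "supp B \<subseteq> Poly_Mapping.keys m")
  case False
  then show ?thesis by (simp add: mcoeff_def)
next
  case True
  have "mcoeff (taylor_diff f) m B = (\<Sum>a\<in>I - B. Poly_Mapping.lookup
      (Poly_Mapping.single (sqf (g a - supp B)) (rem_sign a B) * f (insert a B)) (m - sqf (supp B)))"
    using True B by (simp add: mcoeff_def taylor_diff_def lookup_sum)
  also have "\<dots> = (\<Sum>a\<in>I - B. rem_sign a B * mcoeff f m (insert a B))"
  proof (rule sum.cong)
    fix a assume a: "a \<in> I - B"
    let ?W = "g a - supp B"
    have aB: "insert a B \<subseteq> I" using a B by auto
    have fin: "finite ?W" "finite (supp B)" using fin_supp[OF aB] fin_supp[OF B] by auto
    have un: "sqf (supp (insert a B)) = sqf ?W + sqf (supp B)"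
      using sqf_Un[of ?W "supp B"] fin by (simp add: Un_commute Int_commute)
    show "Poly_Mapping.lookup (Poly_Mapping.single (sqf ?W) (rem_sign a B) * f (insert a B)) (m - sqf (supp B))
        = rem_sign a B * mcoeff f m (insert a B)"
    proof (cases "supp (insert a B) \<subseteq> Poly_Mapping.keys m")
      case True
      let ?k = "m - sqf (supp (insert a B))"
      have "?k + (sqf ?W + sqf (supp B)) = m"
        using monom_diff_add[OF fin_supp[OF aB] True] by (simp only: un)
      then have "m - sqf (supp B) = sqf ?W + ?k"
        by (metis add.assoc add.commute add_diff_cancel_right')
      then show ?thesis using True lookup_single_mult_add[of "sqf ?W" "rem_sign a B"] by (simp add: mcoeff_def del: supp_insert)
    next
      case False
      \<comment> \<open>A term at this exponent would make \<open>m\<close> divisible by every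
        generator in \<open>insert a B\<close>.\<close>
      have "m - sqf (supp B) \<notin> Poly_Mapping.keys (Poly_Mapping.single (sqf ?W) (rem_sign a B) * f (insert a B))"
      proof
        assume "m - sqf (supp B) \<in> Poly_Mapping.keys (Poly_Mapping.single (sqf ?W) (rem_sign a B) * f (insert a B))"
        then obtain k' where "m - sqf (supp B) = sqf ?W + k'" by (rule keys_single_mult)
        then have "m = sqf ?W + k' + sqf (supp B)"
          using monom_diff_add[OF fin(2) \<open>supp B \<subseteq> _\<close>] by simp
        then have "Poly_Mapping.keys m = ?W \<union> Poly_Mapping.keys k' \<union> supp B"
          using fin by (simp add: keys_add_nat)
        then show False using False by auto
      qed
      moreover have "mcoeff f m (insert a B) = 0" using False by (simp add: mcoeff_def del: supp_insert)
      ultimately show ?thesis by (simp add: in_keys_iff)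
    qed
  qed simp
  finally show ?thesis .
qed

lemma mcoeff_eqI:
  assumes "\<And>A. \<not> A \<subseteq> I \<Longrightarrow> f A = 0" "\<And>A. \<not> A \<subseteq> I \<Longrightarrow> h A = 0"
    "\<And>m A. A \<subseteq> I \<Longrightarrow> mcoeff f m A = mcoeff h m A"
  shows "f = h"
proof
  fix A show "f A = h A"
  proof (cases "A \<subseteq> I")
    case True
    show ?thesis by (rule poly_mapping_eqI) (use assms(3)[OF True] mcoeff_add[OF True] in metis)
  qed (use assms(1,2) in simp)
qed

lemma taylor_diff_diff:
  fixes f :: "nat set \<Rightarrow> ('v, 'k::field) mpoly"
  assumes "f \<in> taylor_comp n d"
  shows "taylor_diff (taylor_diff f) = (\<lambda>_. 0)"
proof (rule mcoeff_eqI)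
  fix m B assume B: "B \<subseteq> I"
  have finB: "finite B" using B fin_I finite_subset by blast
  let ?F = "\<lambda>a b. rem_sign a B * (rem_sign b (insert a B) * mcoeff f m (insert b (insert a B)))"
  have "mcoeff (taylor_diff (taylor_diff f)) m B = (\<Sum>a\<in>I - B. \<Sum>b\<in>I - B - {a}. ?F a b)"
    unfolding mcoeff_taylor_diff[OF B]
  proof (rule sum.cong)
    fix a assume a: "a \<in> I - B"
    then have "insert a B \<subseteq> I" using B by auto
    moreover have "I - insert a B = I - B - {a}" by auto
    ultimately show "rem_sign a B * mcoeff (taylor_diff f) m (insert a B) = (\<Sum>b\<in>I - B - {a}. ?F a b)"
      by (simp add: mcoeff_taylor_diff sum_distrib_left)
  qed simp
  also have "\<dots> = 0"
  proof (rule sum_antisym_pairs)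
    fix a b assume ab: "a \<in> I - B" "b \<in> I - B" "a \<noteq> b"
    have "rem_sign b (insert a B) * rem_sign a B = - (rem_sign a (insert b B) * rem_sign b B :: 'k)"
      by (rule rem_sign_swap) (use ab finB in auto)
    then have "rem_sign b (insert a B) * rem_sign a B * x = - (rem_sign a (insert b B) * rem_sign b B * x)" for x :: 'k
      by simp
    from this[of "mcoeff f m (insert b (insert a B))"] show "?F a b = - ?F b a"
      by (simp add: ac_simps insert_commute)
  qed (use fin_I in simp)
  finally show "mcoeff (taylor_diff (taylor_diff f)) m B = mcoeff (\<lambda>_. 0) m B"
    by (simp add: mcoeff_def)
qed (simp_all add: taylor_diff_def)

lemma taylor_diff_comp:
  assumes f: "f \<in> taylor_comp (Suc n) d"
  shows "taylor_diff f \<in> taylor_comp n d"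
  unfolding taylor_comp_def
proof (intro CollectI allI conjI impI)
  fix B
  show "B \<subseteq> I" if "taylor_diff f B \<noteq> 0" using that by (auto simp: taylor_diff_def split: if_splits)
  show "card B = n" if nz: "taylor_diff f B \<noteq> 0"
  proof -
    have B: "B \<subseteq> I" using nz by (auto simp: taylor_diff_def split: if_splits)
    have "\<exists>a\<in>I - B. f (insert a B) \<noteq> 0"
    proof (rule ccontr)
      assume "\<not> ?thesis"
      then have "taylor_diff f B = 0" by (simp add: taylor_diff_def)
      then show False using nz by simp
    qed
    then obtain a where a: "a \<in> I - B" "f (insert a B) \<noteq> 0" by blast
    then have "card (insert a B) = Suc n" using f by (auto simp: taylor_comp_def)
    then show ?thesis using a B fin_I finite_subset by fastforce
  qed
  show "taylor_diff f B \<in> hom_comp V (d - int (card (supp B)))"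
  proof (cases "B \<subseteq> I")
    case True
    have "Poly_Mapping.single (sqf (g a - supp B)) (rem_sign a B) * f (insert a B) \<in> hom_comp V (d - int (card (supp B)))"
      if a: "a \<in> I - B" for a
    proof -
      let ?W = "g a - supp B"
      have aB: "insert a B \<subseteq> I" using a True by auto
      have fin: "finite ?W" "finite (supp B)" using fin_supp[OF aB] fin_supp[OF True] by auto
      have "?W \<subseteq> V" using supp_V[OF aB] by auto
      then have "Poly_Mapping.single (sqf ?W) (rem_sign a B) \<in> hom_comp V (int (card ?W))"
        using fin by (auto simp: hom_comp_def poly_ring_def monom_deg_sqf split: if_splits)
      moreover have "f (insert a B) \<in> hom_comp V (d - int (card (supp (insert a B))))"
        using f unfolding taylor_comp_def by blast
      ultimately have "Poly_Mapping.single (sqf ?W) (rem_sign a B) * f (insert a B) \<in> hom_comp V (int (card ?W) + (d - int (card (supp (insert a B)))))"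
        by (rule hom_comp_mult)
      moreover have "card (supp (insert a B)) = card ?W + card (supp B)"
        using card_Un_disjoint[of ?W "supp B"] fin by (simp add: Un_commute Int_commute)
      ultimately show ?thesis by (simp add: algebra_simps del: supp_insert)
    qed
    then have "(\<Sum>a\<in>I - B. Poly_Mapping.single (sqf (g a - supp B)) (rem_sign a B) * f (insert a B)) \<in> hom_comp V (d - int (card (supp B)))"
      by (rule hom_comp_sum)
    then show ?thesis using True by (simp add: taylor_diff_def)
  qed (simp add: taylor_diff_def)
qed

definition first_gen :: "'v monom \<Rightarrow> nat" where
  "first_gen m = (LEAST a. a \<in> I \<and> g a \<subseteq> Poly_Mapping.keys m)"

lemma first_gen:
  assumes "a \<in> I" "g a \<subseteq> Poly_Mapping.keys m"
  shows "first_gen m \<in> I" "g (first_gen m) \<subseteq> Poly_Mapping.keys m"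
  using LeastI[of "\<lambda>a. a \<in> I \<and> g a \<subseteq> Poly_Mapping.keys m" a] assms by (simp_all add: first_gen_def)

text \<open>A contracting homotopy: in multidegree \<open>m\<close> it adds the generator \<open>first_gen m\<close>.\<close>

definition taylor_lift :: "nat \<Rightarrow> (nat set \<Rightarrow> ('v, 'k::field) mpoly) \<Rightarrow> nat set \<Rightarrow> ('v, 'k) mpoly" where
  "taylor_lift n f A = (if A \<subseteq> I \<and> card A = Suc n then \<Sum>a\<in>A.
     Poly_Mapping.map_key (\<lambda>k. k + sqf (g a - supp (A - {a})))
       (Poly_Mapping.mapp (\<lambda>k x. if first_gen (k + sqf (supp (A - {a}))) = a then rem_sign a (A - {a}) * x else 0)
         (f (A - {a}))) else 0)"

text \<open>\<open>map_key\<close> divides by \<open>sqf (g a - supp (A - {a}))\<close>, and the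
  test inside \<open>mapp\<close> keeps in each multidegree only the summand for
  \<open>first_gen m\<close>.\<close>

lemma mcoeff_taylor_lift:
  assumes A: "A \<subseteq> I" "card A = Suc n"
  shows "mcoeff (taylor_lift n f) m A = (if first_gen m \<in> A \<and> supp A \<subseteq> Poly_Mapping.keys m
    then rem_sign (first_gen m) (A - {first_gen m}) * mcoeff f m (A - {first_gen m}) else 0)"
proof (cases "supp A \<subseteq> Poly_Mapping.keys m")
  case False
  then show ?thesis by (simp add: mcoeff_def)
next
  case True
  have finA: "finite A" using A fin_I finite_subset by blast
  let ?k = "m - sqf (supp A)"
  have "mcoeff (taylor_lift n f) m A = (\<Sum>a\<in>A. if first_gen m = a then rem_sign a (A - {a}) * mcoeff f m (A - {a}) else 0)"
    unfolding mcoeff_def[of "taylor_lift n f"] taylor_lift_def lookup_sum using A True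
  proof (simp add: lookup_sum, intro sum.cong refl)
    fix a assume a: "a \<in> A"
    let ?A = "A - {a}"
    let ?W = "g a - supp ?A"
    have A': "?A \<subseteq> I" using A by auto
    have fin: "finite ?W" "finite (supp ?A)" using fin_supp[OF A'] g_V[of a] A(1) a fin_V by (auto intro: finite_subset)
    have sA: "supp A = ?W \<union> supp ?A" using a by (auto simp: supp_def)
    have sq: "sqf (supp A) = sqf ?W + sqf (supp ?A)" unfolding sA by (rule sqf_Un) (use fin in auto)
    have m: "?k + sqf ?W + sqf (supp ?A) = m"
      using monom_diff_add[OF fin_supp[OF A(1)] True] by (simp add: sq add.assoc)
    then have k: "?k + sqf ?W = m - sqf (supp ?A)" by (metis add_diff_cancel_right')
    have "inj (\<lambda>k. k + sqf ?W)" by (simp add: inj_def)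
    then have "Poly_Mapping.lookup (Poly_Mapping.map_key (\<lambda>k. k + sqf ?W)
       (Poly_Mapping.mapp (\<lambda>k x. if first_gen (k + sqf (supp ?A)) = a then rem_sign a ?A * x else 0) (f ?A))) ?k
      = (if first_gen m = a then rem_sign a ?A * Poly_Mapping.lookup (f ?A) (?k + sqf ?W) else 0)"
      using m by (simp add: map_key.rep_eq lookup_mapp when_def in_keys_iff)
    also have "\<dots> = (if first_gen m = a then rem_sign a ?A * mcoeff f m ?A else 0)"
    proof -
      have "supp ?A \<subseteq> Poly_Mapping.keys m" using True sA by blast
      then show ?thesis by (simp only: mcoeff_def k if_True)
    qed
    finally show "Poly_Mapping.lookup (Poly_Mapping.map_key (\<lambda>k. k + sqf ?W)
       (Poly_Mapping.mapp (\<lambda>k x. if first_gen (k + sqf (supp ?A)) = a then rem_sign a ?A * x else 0) (f ?A))) ?k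
      = (if first_gen m = a then rem_sign a ?A * mcoeff f m ?A else 0)" .
  qed
  also have "\<dots> = (if first_gen m \<in> A then rem_sign (first_gen m) (A - {first_gen m}) * mcoeff f m (A - {first_gen m}) else 0)"
    using finA by (simp add: sum.delta)
  finally show ?thesis using True by simp
qed

lemma taylor_lift_comp:
  assumes f: "f \<in> taylor_comp n d"
  shows "taylor_lift n f \<in> taylor_comp (Suc n) d"
  unfolding taylor_comp_def
proof (intro CollectI allI conjI impI)
  fix A
  show "A \<subseteq> I" "card A = Suc n" if "taylor_lift n f A \<noteq> 0" using that by (auto simp: taylor_lift_def split: if_splits)
  show "taylor_lift n f A \<in> hom_comp V (d - int (card (supp A)))"
  proof (cases "A \<subseteq> I \<and> card A = Suc n")
    case True
    then have A: "A \<subseteq> I" "card A = Suc n" by auto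
    have "Poly_Mapping.keys k \<subseteq> V \<and> int (monom_deg k) = d - int (card (supp A))"
      if "k \<in> Poly_Mapping.keys (taylor_lift n f A)" for k
    proof -
      let ?m = "k + sqf (supp A)"
      have "mcoeff (taylor_lift n f) ?m A \<noteq> 0" using that mcoeff_add[OF A(1), of "taylor_lift n f" k] by (simp add: in_keys_iff)
      then have a: "mcoeff f ?m (A - {first_gen ?m}) \<noteq> 0"
        unfolding mcoeff_taylor_lift[OF A] by (auto split: if_splits)
      let ?A = "A - {first_gen ?m}"
      have A': "?A \<subseteq> I" using A by auto
      let ?k = "?m - sqf (supp ?A)"
      have sub: "supp ?A \<subseteq> Poly_Mapping.keys ?m" using a by (auto simp: mcoeff_def split: if_splits)
      have "?k \<in> Poly_Mapping.keys (f ?A)" using a by (auto simp: mcoeff_def in_keys_iff split: if_splits)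
      moreover have "f ?A \<in> hom_comp V (d - int (card (supp ?A)))" using f by (simp add: taylor_comp_def)
      ultimately have k: "Poly_Mapping.keys ?k \<subseteq> V" "int (monom_deg ?k) = d - int (card (supp ?A))"
        by (auto simp: hom_comp_def poly_ring_def)
      have e: "?k + sqf (supp ?A) = ?m" by (rule monom_diff_add[OF fin_supp[OF A'] sub])
      have "monom_deg ?k + monom_deg (sqf (supp ?A)) = monom_deg k + monom_deg (sqf (supp A))"
        unfolding monom_deg_add[symmetric] e ..
      then have "int (monom_deg k) = d - int (card (supp A))"
        using k(2) fin_supp[OF A'] fin_supp[OF A(1)] by (simp add: monom_deg_sqf)
      moreover have "Poly_Mapping.keys k \<subseteq> Poly_Mapping.keys ?m" by (simp add: keys_add_nat)
      then have "Poly_Mapping.keys k \<subseteq> V"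
        using k(1) supp_V[OF A'] fin_supp[OF A'] keys_add_nat[of ?k "sqf (supp ?A)"] unfolding e by auto
      ultimately show ?thesis by blast
    qed
    then show ?thesis by (simp add: hom_comp_def poly_ring_def)
  qed (auto simp: taylor_lift_def)
qed

text \<open>In multidegree \<open>m\<close> the lift is the cone over the vertex
  \<open>first_gen m\<close>. The cone identity \<open>d h + h d = id\<close> gives
  \<open>d h f = f\<close> on cycles. At \<open>n = 0\<close> only monomials of the ideal can be
  reached, hence \<open>gen\<close>.\<close>

lemma taylor_exact:
  fixes f :: "nat set \<Rightarrow> ('v, 'k::field) mpoly"
  assumes f: "f \<in> taylor_comp n d" and cyc: "taylor_diff f = (\<lambda>_. 0)"
    and gen: "n = 0 \<Longrightarrow> \<forall>m \<in> Poly_Mapping.keys (f {}). \<exists>a \<in> I. g a \<subseteq> Poly_Mapping.keys m"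
  shows "taylor_diff (taylor_lift n f) = f"
proof (rule mcoeff_eqI)
  show "f A = 0" if "\<not> A \<subseteq> I" for A using f that by (auto simp: taylor_comp_def)
  show "taylor_diff (taylor_lift n f) A = 0" if "\<not> A \<subseteq> I" for A using that by (simp add: taylor_diff_def)
  fix m B assume B: "B \<subseteq> I"
  have finB: "finite B" using B fin_I finite_subset by blast
  let ?h = "taylor_lift n f" and ?x = "first_gen m"
  have h: "mcoeff ?h m A = (if card A = Suc n \<and> ?x \<in> A \<and> supp A \<subseteq> Poly_Mapping.keys m
      then rem_sign ?x (A - {?x}) * mcoeff f m (A - {?x}) else 0)" if "A \<subseteq> I" for A
  proof (cases "card A = Suc n")
    case True
    then show ?thesis using mcoeff_taylor_lift[OF that True, of f m] by simp
  next
    case False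
    then show ?thesis by (simp add: mcoeff_def taylor_lift_def)
  qed
  have ins: "insert a B \<subseteq> I" "card (insert a B) = Suc (card B)" if "a \<in> I - B" for a
    using that B finB by auto
  show "mcoeff (taylor_diff ?h) m B = mcoeff f m B"
  proof (cases "card B = n \<and> supp B \<subseteq> Poly_Mapping.keys m")
    case False
    have "f B = 0" if "card B \<noteq> n" using f that unfolding taylor_comp_def by blast
    then have "mcoeff f m B = 0" using False by (auto simp: mcoeff_def)
    moreover have "mcoeff ?h m (insert a B) = 0" if "a \<in> I - B" for a
      using h[OF ins(1)[OF that]] ins(2)[OF that] False by auto
    ultimately show ?thesis unfolding mcoeff_taylor_diff[OF B] by simp
  next
    case True
    then have cB: "card B = n" and sB: "supp B \<subseteq> Poly_Mapping.keys m" by auto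
    show ?thesis
    proof (cases "\<exists>a\<in>I. g a \<subseteq> Poly_Mapping.keys m")
      \<comment> \<open>In this multidegree only the empty set has its support within
        \<open>m\<close>, and its coefficient vanishes by \<open>gen\<close>.\<close>
      case False
      then have "B = {}" using sB B by (auto simp: supp_def)
      then have "n = 0" using cB by simp
      have "m \<notin> Poly_Mapping.keys (f {})" using gen[OF \<open>n = 0\<close>] False by blast
      then have "mcoeff f m B = 0" using \<open>B = {}\<close> by (simp add: mcoeff_def in_keys_iff)
      moreover have "mcoeff ?h m (insert a B) = 0" if "a \<in> I - B" for a
        using False that by (auto simp: mcoeff_def)
      ultimately show ?thesis unfolding mcoeff_taylor_diff[OF B] by simp
    next
      case True
      then have x: "?x \<in> I" "g ?x \<subseteq> Poly_Mapping.keys m" using first_gen by blast+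
      show ?thesis
      proof (cases "?x \<in> B")
        case False
        \<comment> \<open>The lift is supported on sets that contain \<open>?x\<close>, so only
          \<open>a = ?x\<close> counts, and its two equal signs cancel.\<close>
        have "mcoeff (taylor_diff ?h) m B = (\<Sum>a\<in>I - B. if a = ?x then mcoeff f m B else 0)"
          unfolding mcoeff_taylor_diff[OF B]
        proof (rule sum.cong)
          fix a assume a: "a \<in> I - B"
          show "rem_sign a B * mcoeff ?h m (insert a B) = (if a = ?x then mcoeff f m B else 0)"
            using h[OF ins(1)[OF a]] ins(2)[OF a] False x cB sB by auto
        qed simp
        also have "\<dots> = mcoeff f m B" using False x fin_I by simp
        finally show ?thesis .
      next
        case xB: True
        define B' where "B' = B - {?x}"
        have B': "B = insert ?x B'" "?x \<notin> B'" "B' \<subseteq> I" "finite B'" using xB B finB by (auto simp: B'_def)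
        \<comment> \<open>The cycle condition, read at \<open>B\<close> without \<open>?x\<close>,
          expresses the coefficient at \<open>B\<close> by those that the lift moves to the sets
          \<open>insert a B\<close>.\<close>
        have c0: "0 = (\<Sum>a\<in>I - B'. rem_sign a B' * mcoeff f m (insert a B'))"
          using mcoeff_taylor_diff[OF B'(3), of f m] unfolding cyc mcoeff_zero .
        have IB: "I - B' = insert ?x (I - B)" using B' x by auto
        have "(\<Sum>a\<in>I - B'. rem_sign a B' * mcoeff f m (insert a B'))
            = rem_sign ?x B' * mcoeff f m (insert ?x B') + (\<Sum>a\<in>I - B. rem_sign a B' * mcoeff f m (insert a B'))"
          unfolding IB by (rule sum.insert) (use fin_I xB in auto)
        then have c1: "rem_sign ?x B' * mcoeff f m B = - (\<Sum>a\<in>I - B. rem_sign a B' * mcoeff f m (insert a B'))"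
          unfolding B'(1)[symmetric] c0[symmetric] eq_neg_iff_add_eq_0 by (rule sym)
        have "mcoeff (taylor_diff ?h) m B = (\<Sum>a\<in>I - B. - rem_sign ?x B' * (rem_sign a B' * mcoeff f m (insert a B')))"
          unfolding mcoeff_taylor_diff[OF B]
        proof (rule sum.cong)
          fix a assume a: "a \<in> I - B"
          then have ax: "a \<noteq> ?x" "a \<notin> B'" using B' by auto
          have del: "insert a B - {?x} = insert a B'" using ax B' by auto
          show "rem_sign a B * mcoeff ?h m (insert a B) = - rem_sign ?x B' * (rem_sign a B' * mcoeff f m (insert a B'))"
          proof (cases "supp (insert a B) \<subseteq> Poly_Mapping.keys m")
            case True
            then have "mcoeff ?h m (insert a B) = rem_sign ?x (insert a B') * mcoeff f m (insert a B')"
              using h[OF ins(1)[OF a]] ins(2)[OF a] xB cB del by simp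
            moreover have "rem_sign a B * rem_sign ?x (insert a B') = - rem_sign ?x B' * (rem_sign a B' :: 'k)"
              using ax B'(2,4) unfolding B'(1) by (auto simp: rem_sign_insert)
            then have "rem_sign a B * (rem_sign ?x (insert a B') * y) = - rem_sign ?x B' * (rem_sign a B' * y)" for y :: 'k
              by (metis mult.assoc)
            ultimately show ?thesis by simp
          next
            case False
            moreover have "supp (insert a B) = supp (insert a B') \<union> g ?x" unfolding B'(1) by auto
            ultimately have "\<not> supp (insert a B') \<subseteq> Poly_Mapping.keys m" using x(2) by auto
            then have "mcoeff f m (insert a B') = 0" "mcoeff ?h m (insert a B) = 0"
              using False by (simp_all add: mcoeff_def del: supp_insert)
            then show ?thesis by simp
          qed
        qed simp
        also have "\<dots> = rem_sign ?x B' * (rem_sign ?x B' * mcoeff f m B)"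
          unfolding c1 by (simp add: sum_distrib_left sum_negf)
        finally show ?thesis by simp
      qed
    qed
  qed
qed

end

section \<open>Tor of squarefree monomial ideals\<close>

context sqf_monomials
begin

section \<open>The Taylor complex in the record format of resolutions\<close>

definition faces :: "nat \<Rightarrow> nat set set" where
  "faces n = {A. A \<subseteq> I \<and> card A = n}"

text \<open>Bases are numbered by naturals, so the sets of size \<open>i + 1\<close> are enumerated
  in some order. The shift by one is there because \<open>F\<^sub>0\<close> maps onto the
  ideal.\<close>

definition face :: "nat \<Rightarrow> nat \<Rightarrow> nat set" where
  "face i = (SOME e. bij_betw e {..<card (faces (Suc i))} (faces (Suc i)))"

definition to_faces :: "nat \<Rightarrow> (nat \<Rightarrow> 'r::zero) \<Rightarrow> nat set \<Rightarrow> 'r" where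
  "to_faces i f A = (if A \<in> faces (Suc i) then f (inv_into {..<card (faces (Suc i))} (face i) A) else 0)"

definition of_faces :: "nat \<Rightarrow> (nat set \<Rightarrow> 'r::zero) \<Rightarrow> nat \<Rightarrow> 'r" where
  "of_faces i f b = (if b < card (faces (Suc i)) then f (face i b) else 0)"

definition taylor_cpx :: "('v, 'k::field, ('v, 'k) mpoly) free_cpx" where
  "taylor_cpx = \<lparr>rk = \<lambda>i. card (faces (Suc i)), bdeg = \<lambda>i b. int (card (supp (face i b))),
     aug = \<lambda>b. Poly_Mapping.single (sqf (supp (face 0 b))) 1,
     dmat = \<lambda>i b c. if face i b \<subseteq> face (Suc i) c
       then Poly_Mapping.single (sqf (supp (face (Suc i) c) - supp (face i b)))
         (rem_sign (the_elem (face (Suc i) c - face i b)) (face i b)) else 0\<rparr>"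

lemma rk_taylor: "rk taylor_cpx i = card (faces (Suc i))"
  by (simp add: taylor_cpx_def)

lemma face_bij: "bij_betw (face i) {..<card (faces (Suc i))} (faces (Suc i))"
proof -
  have "finite (faces (Suc i))" using fin_I by (simp add: faces_def)
  then have "\<exists>e. bij_betw e {..<card (faces (Suc i))} (faces (Suc i))"
    using ex_bij_betw_nat_finite[of "faces (Suc i)"] by (simp add: lessThan_atLeast0)
  then show ?thesis unfolding face_def by (rule someI_ex)
qed

lemma face_mem: "b < card (faces (Suc i)) \<Longrightarrow> face i b \<in> faces (Suc i)"
  using face_bij[of i] by (auto simp: bij_betw_def)

lemma face_obtain:
  assumes "A \<in> faces (Suc i)"
  obtains b where "b < card (faces (Suc i))" "A = face i b"
  using face_bij[of i] assms by (auto simp: bij_betw_def)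

lemma facesD: "A \<in> faces n \<Longrightarrow> A \<subseteq> I" "A \<in> faces n \<Longrightarrow> card A = n"
  by (auto simp: faces_def)

lemma to_faces_face: "b < card (faces (Suc i)) \<Longrightarrow> to_faces i f (face i b) = f b"
  using face_bij[of i] face_mem[of b i] by (simp add: to_faces_def bij_betw_def inv_into_f_f)

lemma to_faces_outside: "A \<notin> faces (Suc i) \<Longrightarrow> to_faces i f A = 0"
  by (simp add: to_faces_def)

lemma of_to_faces: "(\<And>b. b \<ge> card (faces (Suc i)) \<Longrightarrow> f b = 0) \<Longrightarrow> of_faces i (to_faces i f) = f"
  by (rule ext) (simp add: of_faces_def to_faces_face)

lemma to_of_faces:
  assumes "\<And>A. A \<notin> faces (Suc i) \<Longrightarrow> f A = 0"
  shows "to_faces i (of_faces i f) = f"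
proof
  fix A show "to_faces i (of_faces i f) A = f A"
  proof (cases "A \<in> faces (Suc i)")
    case True
    then obtain b where "b < card (faces (Suc i))" "A = face i b" by (rule face_obtain)
    then show ?thesis by (simp add: to_faces_face of_faces_def)
  qed (simp add: assms to_faces_outside)
qed

lemma to_faces_inj:
  assumes "to_faces i f = to_faces i h" "\<And>b. b \<ge> card (faces (Suc i)) \<Longrightarrow> f b = 0" "\<And>b. b \<ge> card (faces (Suc i)) \<Longrightarrow> h b = 0"
  shows "f = h"
  by (metis of_to_faces[of i f, OF assms(2)] of_to_faces[of i h, OF assms(3)] assms(1))

lemma insert_faces:
  assumes "B \<subseteq> I" "a \<in> I - B"
  shows "insert a B \<in> faces (Suc n) \<longleftrightarrow> B \<in> faces n"
  using assms fin_I finite_subset[of B I] by (auto simp: faces_def)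

text \<open>The columns with an entry in row \<open>B\<close> are exactly those of the sets
  \<open>insert a B\<close>, and \<open>a\<close> is recovered from the difference.\<close>

lemma face_sum:
  assumes B: "B \<in> faces (Suc i)"
  shows "(\<Sum>c<card (faces (Suc (Suc i))). if B \<subseteq> face (Suc i) c then \<psi> (the_elem (face (Suc i) c - B)) (face (Suc i) c) else 0)
     = (\<Sum>a\<in>I - B. \<psi> a (insert a B))"
proof -
  let ?F = "faces (Suc (Suc i))"
  have fin: "finite ?F" "finite B" using fin_I B finite_subset[of B I] by (auto simp: faces_def)
  have "(\<Sum>c<card ?F. if B \<subseteq> face (Suc i) c then \<psi> (the_elem (face (Suc i) c - B)) (face (Suc i) c) else 0)
     = (\<Sum>A\<in>?F. if B \<subseteq> A then \<psi> (the_elem (A - B)) A else 0)"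
    by (rule sum.reindex_bij_betw[OF face_bij])
  also have "\<dots> = (\<Sum>A\<in>{A \<in> ?F. B \<subseteq> A}. \<psi> (the_elem (A - B)) A)"
    by (rule sum.inter_filter[OF fin(1), symmetric])
  also have "{A \<in> ?F. B \<subseteq> A} = (\<lambda>a. insert a B) ` (I - B)"
  proof
    show "{A \<in> ?F. B \<subseteq> A} \<subseteq> (\<lambda>a. insert a B) ` (I - B)"
    proof
      fix A assume A: "A \<in> {A \<in> ?F. B \<subseteq> A}"
      then have "card (A - B) = 1" using facesD(2)[of A "Suc (Suc i)"] facesD(2)[OF B] fin by (simp add: card_Diff_subset)
      then obtain a where a: "A - B = {a}" by (auto simp: card_1_singleton_iff)
      then have "A = insert a B" "a \<in> I - B" using A facesD(1)[of A] by auto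
      then show "A \<in> (\<lambda>a. insert a B) ` (I - B)" by blast
    qed
    show "(\<lambda>a. insert a B) ` (I - B) \<subseteq> {A \<in> ?F. B \<subseteq> A}"
    proof
      fix A assume "A \<in> (\<lambda>a. insert a B) ` (I - B)"
      then obtain a where a: "a \<in> I - B" "A = insert a B" by blast
      then show "A \<in> {A \<in> ?F. B \<subseteq> A}" using insert_faces[OF facesD(1)[OF B] a(1), of "Suc i"] B by auto
    qed
  qed
  also have "(\<Sum>A\<in>(\<lambda>a. insert a B) ` (I - B). \<psi> (the_elem (A - B)) A) = (\<Sum>a\<in>I - B. \<psi> (the_elem (insert a B - B)) (insert a B))"
    by (subst sum.reindex) (auto intro: inj_onI)
  also have "\<dots> = (\<Sum>a\<in>I - B. \<psi> a (insert a B))"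
  proof (rule sum.cong)
    fix a assume "a \<in> I - B"
    then have "insert a B - B = {a}" by auto
    then show "\<psi> (the_elem (insert a B - B)) (insert a B) = \<psi> a (insert a B)" by simp
  qed simp
  finally show ?thesis .
qed

lemma taylor_diff_outside:
  assumes "\<And>A. A \<notin> faces (Suc n) \<Longrightarrow> f A = 0" "B \<notin> faces n"
  shows "taylor_diff f B = 0"
proof (cases "B \<subseteq> I")
  case True
  have "f (insert a B) = 0" if "a \<in> I - B" for a
    using assms insert_faces[OF True that, of n] by blast
  then show ?thesis by (simp add: taylor_diff_def)
qed (simp add: taylor_diff_def)

lemma free_map_taylor:
  assumes b: "b < card (faces (Suc i))"
  shows "free_map taylor_cpx i f b = taylor_diff (to_faces (Suc i) f) (face i b)"
proof -
  let ?B = "face i b" and ?A = "\<lambda>c. face (Suc i) c"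
  have B: "?B \<in> faces (Suc i)" by (rule face_mem[OF b])
  let ?\<psi> = "\<lambda>a A. Poly_Mapping.single (sqf (supp A - supp ?B)) (rem_sign a ?B) * to_faces (Suc i) f A"
  have "free_map taylor_cpx i f b = (\<Sum>c<card (faces (Suc (Suc i))). if ?B \<subseteq> ?A c then ?\<psi> (the_elem (?A c - ?B)) (?A c) else 0)"
    unfolding free_map_def rk_taylor using b
    by (auto simp: taylor_cpx_def to_faces_face intro!: sum.cong)
  also have "\<dots> = (\<Sum>a\<in>I - ?B. ?\<psi> a (insert a ?B))" by (rule face_sum[OF B])
  also have "\<dots> = taylor_diff (to_faces (Suc i) f) ?B"
    using facesD(1)[OF B] by (simp add: taylor_diff_def Un_Diff)
  finally show ?thesis .
qed

lemma to_faces_free_map: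
  "to_faces i (free_map taylor_cpx i f) = taylor_diff (to_faces (Suc i) f)"
proof
  fix B show "to_faces i (free_map taylor_cpx i f) B = taylor_diff (to_faces (Suc i) f) B"
  proof (cases "B \<in> faces (Suc i)")
    case True
    then obtain b where b: "b < card (faces (Suc i))" "B = face i b" by (rule face_obtain)
    then show ?thesis by (simp add: to_faces_face free_map_taylor)
  next
    case False
    then have "taylor_diff (to_faces (Suc i) f) B = 0"
      by (intro taylor_diff_outside[of "Suc i"] to_faces_outside)
    then show ?thesis by (simp add: to_faces_outside False)
  qed
qed

lemma aug_map_taylor: "aug_map (*) taylor_cpx f = taylor_diff (to_faces 0 f) {}"
proof -
  have "aug_map (*) taylor_cpx f = (\<Sum>b<card (faces (Suc 0)). Poly_Mapping.single (sqf (supp (face 0 b))) 1 * to_faces 0 f (face 0 b))"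
    unfolding aug_map_def rk_taylor by (auto simp: taylor_cpx_def to_faces_face mult.commute intro!: sum.cong)
  also have "\<dots> = (\<Sum>A\<in>faces (Suc 0). Poly_Mapping.single (sqf (supp A)) 1 * to_faces 0 f A)"
    by (rule sum.reindex_bij_betw[OF face_bij])
  also have "faces (Suc 0) = (\<lambda>a. {a}) ` I" by (auto simp: faces_def card_Suc_eq)
  also have "(\<Sum>A\<in>(\<lambda>a. {a}) ` I. Poly_Mapping.single (sqf (supp A)) 1 * to_faces 0 f A) = taylor_diff (to_faces 0 f) {}"
    by (subst sum.reindex) (auto simp: taylor_diff_def rem_sign_def)
  finally show ?thesis .
qed

lemma to_faces_comp:
  assumes "f \<in> free_comp V taylor_cpx i d"
  shows "to_faces i f \<in> taylor_comp (Suc i) d"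
  unfolding taylor_comp_def
proof (intro CollectI allI conjI impI)
  fix A
  show "A \<subseteq> I" "card A = Suc i" if "to_faces i f A \<noteq> 0" using that by (auto simp: to_faces_def faces_def split: if_splits)
  show "to_faces i f A \<in> hom_comp V (d - int (card (supp A)))"
  proof (cases "A \<in> faces (Suc i)")
    case True
    then obtain b where b: "b < card (faces (Suc i))" "A = face i b" by (rule face_obtain)
    then show ?thesis using assms by (simp add: to_faces_face free_comp_def taylor_cpx_def)
  qed (simp add: to_faces_outside)
qed

lemma taylor_comp_outside: "f \<in> taylor_comp n d \<Longrightarrow> A \<notin> faces n \<Longrightarrow> f A = 0"
  unfolding taylor_comp_def faces_def by blast

lemma of_faces_comp:
  assumes "f \<in> taylor_comp (Suc i) d"
  shows "of_faces i f \<in> free_comp V taylor_cpx i d"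
  using assms by (simp add: free_comp_def of_faces_def taylor_cpx_def taylor_comp_def)

lemma free_comp_cut: "f \<in> free_comp V taylor_cpx i d \<Longrightarrow> b \<ge> card (faces (Suc i)) \<Longrightarrow> f b = 0"
  by (simp add: free_comp_def rk_taylor)

lemma free_map_cut: "b \<ge> card (faces (Suc i)) \<Longrightarrow> free_map taylor_cpx i f b = 0"
  by (simp add: free_map_def rk_taylor)

lemma free_map_comp:
  assumes "h \<in> free_comp V taylor_cpx (Suc i) d"
  shows "free_map taylor_cpx i h \<in> free_comp V taylor_cpx i d"
proof -
  have "of_faces i (to_faces i (free_map taylor_cpx i h)) = free_map taylor_cpx i h"
    by (rule of_to_faces) (rule free_map_cut)
  moreover have "to_faces i (free_map taylor_cpx i h) \<in> taylor_comp (Suc i) d"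
    unfolding to_faces_free_map by (intro taylor_diff_comp to_faces_comp assms)
  ultimately show ?thesis using of_faces_comp by metis
qed

lemma taylor_exact_faces:
  assumes f: "f \<in> free_comp V taylor_cpx i d" and "taylor_diff (to_faces i f) = (\<lambda>_. 0)"
  shows "f \<in> free_map taylor_cpx i ` free_comp V taylor_cpx (Suc i) d"
proof -
  let ?F = "taylor_lift (Suc i) (to_faces i f)"
  have F: "?F \<in> taylor_comp (Suc (Suc i)) d" by (rule taylor_lift_comp[OF to_faces_comp[OF f]])
  have dF: "taylor_diff ?F = to_faces i f" by (rule taylor_exact[OF to_faces_comp[OF f] assms(2)]) simp
  let ?h = "of_faces (Suc i) ?F"
  have "to_faces (Suc i) ?h = ?F" by (rule to_of_faces) (rule taylor_comp_outside[OF F])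
  then have "to_faces i (free_map taylor_cpx i ?h) = to_faces i f" by (simp add: to_faces_free_map dF)
  then have "free_map taylor_cpx i ?h = f"
    by (rule to_faces_inj) (auto intro: free_map_cut free_comp_cut[OF f])
  then show ?thesis by (intro image_eqI[OF _ of_faces_comp[OF F]]) (rule sym)
qed

text \<open>Membership in a monomial ideal is decided monomial by monomial.\<close>

definition mon_ideal_comp :: "int \<Rightarrow> ('v, 'k::field) mpoly set" where
  "mon_ideal_comp d = {p \<in> hom_comp V d. \<forall>m \<in> Poly_Mapping.keys p. \<exists>a \<in> I. g a \<subseteq> Poly_Mapping.keys m}"

text \<open>For surjectivity, \<open>p\<close> is placed at the empty set, where it is trivially a
  cycle, and exactness at level 0 provides the preimage.\<close>

lemma aug_image: "aug_map (*) (taylor_cpx :: ('v, 'k::field, ('v, 'k) mpoly) free_cpx) ` free_comp V taylor_cpx 0 d = mon_ideal_comp d"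
  (is "?L = ?R")
proof
  show "?L \<subseteq> ?R"
  proof
    fix p assume "p \<in> ?L"
    then obtain f where f: "f \<in> free_comp V taylor_cpx 0 d" "p = taylor_diff (to_faces 0 f) {}"
      by (auto simp: aug_map_taylor)
    have "taylor_diff (to_faces 0 f) \<in> taylor_comp 0 d" by (rule taylor_diff_comp[OF to_faces_comp[OF f(1)]])
    then have "taylor_diff (to_faces 0 f) {} \<in> hom_comp V (d - int (card (supp {})))" unfolding taylor_comp_def by blast
    then have "p \<in> hom_comp V d" using f(2) by simp
    moreover have "\<exists>a\<in>I. g a \<subseteq> Poly_Mapping.keys m" if m: "m \<in> Poly_Mapping.keys p" for m
    proof -
      have "p = (\<Sum>a\<in>I. Poly_Mapping.single (sqf (g a)) (rem_sign a {}) * to_faces 0 f {a})"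
        using f(2) by (simp add: taylor_diff_def)
      then obtain a where a: "a \<in> I" "m \<in> Poly_Mapping.keys (Poly_Mapping.single (sqf (g a)) (rem_sign a {}) * to_faces 0 f {a})"
        using m keys_sum[of "\<lambda>a. Poly_Mapping.single (sqf (g a)) (rem_sign a {}) * to_faces 0 f {a}" I] by blast
      obtain k where "m = sqf (g a) + k" using a(2) by (rule keys_single_mult)
      moreover have "finite (g a)" using g_V[OF a(1)] fin_V finite_subset by blast
      ultimately show ?thesis using a(1) by (auto simp: keys_add_nat)
    qed
    ultimately show "p \<in> ?R" by (simp add: mon_ideal_comp_def)
  qed
  show "?R \<subseteq> ?L"
  proof
    fix p :: "('v, 'k) mpoly" assume p: "p \<in> ?R"
    let ?P = "\<lambda>A :: nat set. if A = {} then p else 0"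
    have P: "?P \<in> taylor_comp 0 d" using p by (auto simp: taylor_comp_def mon_ideal_comp_def)
    have dP: "taylor_diff ?P = (\<lambda>_. 0)" by (auto simp: taylor_diff_def)
    let ?F = "taylor_lift 0 ?P"
    have F: "?F \<in> taylor_comp (Suc 0) d" by (rule taylor_lift_comp[OF P])
    have dF: "taylor_diff ?F = ?P"
      by (rule taylor_exact[OF P dP]) (use p in \<open>simp add: mon_ideal_comp_def\<close>)
    have "to_faces 0 (of_faces 0 ?F) = ?F" by (rule to_of_faces) (rule taylor_comp_outside[OF F])
    then have "aug_map (*) taylor_cpx (of_faces 0 ?F) = p" using dF by (simp add: aug_map_taylor)
    then show "p \<in> ?L"
      by (intro image_eqI[OF _ of_faces_comp[OF F]]) (rule sym)
  qed
qed

theorem taylor_resolution: "graded_free_resolution V (*) mon_ideal_comp (taylor_cpx :: ('v, 'k::field, ('v, 'k) mpoly) free_cpx)"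
  unfolding graded_free_resolution_def
proof (intro conjI allI impI)
  let ?T = "taylor_cpx :: ('v, 'k, ('v, 'k) mpoly) free_cpx"
  fix d :: int
  show "aug_map (*) ?T ` free_comp V ?T 0 d = mon_ideal_comp d" by (rule aug_image)
  show "{f \<in> free_comp V ?T 0 d. aug_map (*) ?T f = 0} = free_map ?T 0 ` free_comp V ?T 1 d"
  proof
    show "{f \<in> free_comp V ?T 0 d. aug_map (*) ?T f = 0} \<subseteq> free_map ?T 0 ` free_comp V ?T 1 d"
    proof
      fix f assume "f \<in> {f \<in> free_comp V ?T 0 d. aug_map (*) ?T f = 0}"
      then have f: "f \<in> free_comp V ?T 0 d" "taylor_diff (to_faces 0 f) {} = 0" by (auto simp: aug_map_taylor)
      have "taylor_diff (to_faces 0 f) B = 0" for B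
      proof (cases "B = {}")
        case False
        then have "B \<notin> faces 0" using finite_subset[OF _ fin_I, of B] by (auto simp: faces_def)
        then show ?thesis by (intro taylor_diff_outside[of 0] to_faces_outside)
      qed (use f(2) in simp)
      then show "f \<in> free_map ?T 0 ` free_comp V ?T 1 d" using taylor_exact_faces[OF f(1)] by auto
    qed
    show "free_map ?T 0 ` free_comp V ?T 1 d \<subseteq> {f \<in> free_comp V ?T 0 d. aug_map (*) ?T f = 0}"
    proof
      fix f assume "f \<in> free_map ?T 0 ` free_comp V ?T 1 d"
      then obtain h where h: "h \<in> free_comp V ?T (Suc 0) d" "f = free_map ?T 0 h" by auto
      then show "f \<in> {f \<in> free_comp V ?T 0 d. aug_map (*) ?T f = 0}"
        using free_map_comp[OF h(1)] taylor_diff_diff[OF to_faces_comp[OF h(1)]]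
        by (simp add: aug_map_taylor to_faces_free_map)
    qed
  qed
  fix i
  show "{f \<in> free_comp V ?T (Suc i) d. free_map ?T i f = (\<lambda>_. 0)} = free_map ?T (Suc i) ` free_comp V ?T (Suc (Suc i)) d"
  proof
    show "{f \<in> free_comp V ?T (Suc i) d. free_map ?T i f = (\<lambda>_. 0)} \<subseteq> free_map ?T (Suc i) ` free_comp V ?T (Suc (Suc i)) d"
    proof
      fix f assume "f \<in> {f \<in> free_comp V ?T (Suc i) d. free_map ?T i f = (\<lambda>_. 0)}"
      then have f: "f \<in> free_comp V ?T (Suc i) d" "free_map ?T i f = (\<lambda>_. 0)" by auto
      have "taylor_diff (to_faces (Suc i) f) = (\<lambda>_. 0)"
        unfolding to_faces_free_map[symmetric] f(2) by (auto simp: to_faces_def)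
      then show "f \<in> free_map ?T (Suc i) ` free_comp V ?T (Suc (Suc i)) d" by (rule taylor_exact_faces[OF f(1)])
    qed
    show "free_map ?T (Suc i) ` free_comp V ?T (Suc (Suc i)) d \<subseteq> {f \<in> free_comp V ?T (Suc i) d. free_map ?T i f = (\<lambda>_. 0)}"
    proof
      fix f assume "f \<in> free_map ?T (Suc i) ` free_comp V ?T (Suc (Suc i)) d"
      then obtain h where h: "h \<in> free_comp V ?T (Suc (Suc i)) d" "f = free_map ?T (Suc i) h" by auto
      have "to_faces i (free_map ?T i f) = to_faces i (\<lambda>_. 0)"
        using taylor_diff_diff[OF to_faces_comp[OF h(1)]] unfolding h(2)
        by (auto simp: to_faces_free_map to_faces_def)
      then have "free_map ?T i f = (\<lambda>_. 0)" by (rule to_faces_inj) (auto intro: free_map_cut)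
      then show "f \<in> {f \<in> free_comp V ?T (Suc i) d. free_map ?T i f = (\<lambda>_. 0)}"
        using free_map_comp[OF h(1)] h(2) by simp
    qed
  qed
next
  let ?T = "taylor_cpx :: ('v, 'k, ('v, 'k) mpoly) free_cpx"
  fix b assume "b < rk ?T 0"
  then have b: "face 0 b \<in> faces (Suc 0)" by (simp add: rk_taylor face_mem)
  then have fin: "finite (supp (face 0 b))" "supp (face 0 b) \<subseteq> V" 
    using fin_supp[OF facesD(1)[OF b]] supp_V[OF facesD(1)[OF b]] by simp_all
  have "face 0 b \<noteq> {}" using facesD(2)[OF b] by auto
  then obtain a where "a \<in> face 0 b" by blast
  then have "a \<in> I" "g a \<subseteq> supp (face 0 b)" using facesD(1)[OF b] by (auto simp: supp_def)
  then show "aug ?T b \<in> mon_ideal_comp (bdeg ?T 0 b)"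
    using fin by (auto simp: taylor_cpx_def mon_ideal_comp_def hom_comp_def poly_ring_def monom_deg_sqf)
next
  let ?T = "taylor_cpx :: ('v, 'k, ('v, 'k) mpoly) free_cpx"
  fix i b c assume "b < rk ?T i" "c < rk ?T (Suc i)"
  then have f: "face i b \<subseteq> I" "face (Suc i) c \<subseteq> I"
    using facesD(1)[OF face_mem[of b i]] facesD(1)[OF face_mem[of c "Suc i"]] by (simp_all add: rk_taylor)
  show "dmat ?T i b c \<in> hom_comp V (bdeg ?T (Suc i) c - bdeg ?T i b)"
  proof (cases "face i b \<subseteq> face (Suc i) c")
    case True
    let ?W = "supp (face (Suc i) c) - supp (face i b)"
    have fin: "finite ?W" "?W \<subseteq> V" using fin_supp[OF f(2)] supp_V[OF f(2)] by auto
    have le: "supp (face i b) \<subseteq> supp (face (Suc i) c)" by (rule supp_mono[OF True])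
    have "int (card ?W) = int (card (supp (face (Suc i) c))) - int (card (supp (face i b)))"
      using card_Diff_subset[OF fin_supp[OF f(1)] le] card_mono[OF fin_supp[OF f(2)] le] by simp
    then show ?thesis
      using True fin by (auto simp: taylor_cpx_def hom_comp_def poly_ring_def monom_deg_sqf split: if_splits)
  qed (simp add: taylor_cpx_def)
qed

text \<open>The entry \<open>sqf (g a - supp B)\<close> has a constant term only if
  \<open>g a\<close> adds nothing to the support. So over the field the complex splits into one
  piece per support.\<close>

lemma tensor_map_taylor:
  assumes b: "b < card (faces (Suc i))"
  shows "tensor_map taylor_cpx i t b = (\<Sum>a\<in>I - face i b. if g a \<subseteq> supp (face i b)
    then rem_sign a (face i b) * to_faces (Suc i) t (insert a (face i b)) else 0)"
proof -
  let ?B = "face i b" and ?A = "\<lambda>c. face (Suc i) c"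
  have B: "?B \<in> faces (Suc i)" by (rule face_mem[OF b])
  let ?\<psi> = "\<lambda>a A. if supp A \<subseteq> supp ?B then rem_sign a ?B * to_faces (Suc i) t A else 0"
  have "tensor_map taylor_cpx i t b = (\<Sum>c<card (faces (Suc (Suc i))). if ?B \<subseteq> ?A c then ?\<psi> (the_elem (?A c - ?B)) (?A c) else 0)"
    unfolding tensor_map_def rk_taylor if_P[OF b]
  proof (rule sum.cong)
    fix c assume c: "c \<in> {..<card (faces (Suc (Suc i)))}"
    then have A: "?A c \<in> faces (Suc (Suc i))" by (simp add: face_mem)
    have "finite (supp (?A c) - supp ?B)" using fin_supp[OF facesD(1)[OF A]] by simp
    then show "Poly_Mapping.lookup (dmat taylor_cpx i b c) 0 * t c = (if ?B \<subseteq> ?A c then ?\<psi> (the_elem (?A c - ?B)) (?A c) else 0)"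
      using c by (simp add: taylor_cpx_def lookup_single to_faces_face sqf_eq_0 when_def)
  qed simp
  also have "\<dots> = (\<Sum>a\<in>I - ?B. ?\<psi> a (insert a ?B))" by (rule face_sum[OF B])
  finally show ?thesis by simp
qed

text \<open>Sets with support exactly \<open>S\<close> are the covers of \<open>S\<close> by
  generators inside \<open>S\<close>; so each piece of the split complex is a cover complex.\<close>

lemma cov_bd_supp:
  assumes "B \<subseteq> I" "supp B = S"
  shows "cov_bd g {a \<in> I. g a \<subseteq> S} S c B
    = (\<Sum>a\<in>I - B. if g a \<subseteq> supp B then rem_sign a B * c (insert a B) else 0)"
proof -
  have "B \<subseteq> {a \<in> I. g a \<subseteq> S}" "S \<subseteq> \<Union> (g ` B)" using assms by (auto simp: supp_def)
  then have "cov_bd g {a \<in> I. g a \<subseteq> S} S c B = (\<Sum>a\<in>{a \<in> I. g a \<subseteq> S} - B. rem_sign a B * c (insert a B))"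
    by (simp add: cov_bd_def)
  also have "{a \<in> I. g a \<subseteq> S} - B = {a \<in> I - B. g a \<subseteq> supp B}" using assms by auto
  also have "(\<Sum>a\<in>{a \<in> I - B. g a \<subseteq> supp B}. rem_sign a B * c (insert a B))
      = (\<Sum>a\<in>I - B. if g a \<subseteq> supp B then rem_sign a B * c (insert a B) else 0)"
    by (rule sum.inter_filter) (use fin_I in simp)
  finally show ?thesis .
qed

section \<open>Splitting tensor homology by supports\<close>

lemma cov_bd_not_supp:
  assumes "\<not> (B \<subseteq> I \<and> supp B = S)"
  shows "cov_bd g {a \<in> I. g a \<subseteq> S} S c B = 0"
  using assms by (auto simp: cov_bd_def supp_def)

definition restrict_supp :: "'v set \<Rightarrow> (nat set \<Rightarrow> 'k::field) \<Rightarrow> nat set \<Rightarrow> 'k" where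
  "restrict_supp S c A = (if supp A = S then c A else 0)"

lemma restrict_supp_chain:
  "restrict_supp S (to_faces i t) \<in> cov_chain g {a \<in> I. g a \<subseteq> S} S (int i + 1)"
  by (auto simp: cov_chain_def restrict_supp_def to_faces_def faces_def supp_def split: if_splits)

lemma cov_chain_supp:
  assumes "c \<in> cov_chain g {a \<in> I. g a \<subseteq> S} S (int n)" "c A \<noteq> 0"
  shows "A \<in> faces n" "supp A = S"
proof -
  have "A \<subseteq> {a \<in> I. g a \<subseteq> S}" "S \<subseteq> \<Union> (g ` A)" "card A = n" using assms unfolding cov_chain_def by auto
  then show "A \<in> faces n" "supp A = S" by (auto simp: faces_def supp_def)
qed

text \<open>The piece of a cycle on a fixed support is again a cycle. If every piece were a
  boundary, the bounding chains would assemble to one that bounds the whole cycle.\<close>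

lemma tensor_nonzero_taylor_imp:
  assumes "tensor_nonzero (taylor_cpx :: ('v, 'k::field, ('v, 'k) mpoly) free_cpx) i j"
  shows "\<exists>S \<subseteq> V. int (card S) = j \<and> cov_hom TYPE('k) g {a \<in> I. g a \<subseteq> S} S (int i + 1)"
proof (rule ccontr)
  assume none: "\<not> ?thesis"
  let ?T = "taylor_cpx :: ('v, 'k, ('v, 'k) mpoly) free_cpx"
  let ?J = "\<lambda>S. {a \<in> I. g a \<subseteq> S}"
  obtain t where t: "t \<in> tensor_cycles ?T i j" "t \<notin> tensor_boundaries ?T i j"
    using assms unfolding tensor_nonzero_def by blast
  have tc: "t \<in> tensor_comp ?T i j" using t(1) by (simp add: tensor_cycles_def)
  have deg: "int (card (supp (face i b))) = j" "b < card (faces (Suc i))" if "t b \<noteq> 0" for b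
    using tc that by (auto simp: tensor_comp_def taylor_cpx_def)
  let ?c = "\<lambda>S. restrict_supp S (to_faces i t)"
  have cyc: "cov_bd g (?J S) S (?c S) = (\<lambda>_. 0)" for S
  proof
    fix B
    show "cov_bd g (?J S) S (?c S) B = 0"
    proof (cases "B \<subseteq> I \<and> supp B = S")
      case False
      then show ?thesis by (rule cov_bd_not_supp)
    next
      case True
      then have B: "B \<subseteq> I" "supp B = S" by auto
      have sum: "cov_bd g (?J S) S (?c S) B = (\<Sum>a\<in>I - B. if g a \<subseteq> supp B then rem_sign a B * to_faces i t (insert a B) else 0)"
        unfolding cov_bd_supp[OF B] by (rule sum.cong) (use B(2) in \<open>auto simp: restrict_supp_def\<close>)
      show ?thesis
      proof (cases i)
        case 0
        \<comment> \<open>In degree 0 there is no cycle condition to use. Instead, a contributing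
          set would be a singleton with \<open>B = {}\<close>, and then the nonempty
          \<open>g a\<close> is not contained in \<open>supp B\<close>.\<close>
        have "to_faces i t (insert a B) = 0" if "a \<in> I - B" "g a \<subseteq> supp B" for a
        proof -
          have "B \<noteq> {}" using that g_ne[of a] by auto
          then have "B \<notin> faces 0" using finite_subset[OF B(1) fin_I] by (auto simp: faces_def)
          then show ?thesis using insert_faces[OF B(1) that(1), of 0] 0 by (simp add: to_faces_outside)
        qed
        then have "(\<Sum>a\<in>I - B. if g a \<subseteq> supp B then rem_sign a B * to_faces i t (insert a B) else 0) = (\<Sum>a\<in>I - B. 0)"
          by (intro sum.cong) auto
        then show ?thesis unfolding sum by simp
      next
        case (Suc i')
        show ?thesis
        proof (cases "B \<in> faces (Suc i')")
          case True
          then obtain b where b: "b < card (faces (Suc i'))" "B = face i' b" by (rule face_obtain)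
          have "tensor_map ?T i' t b = 0" using t(1) Suc by (simp add: tensor_cycles_def)
          then show ?thesis unfolding sum unfolding b(2) tensor_map_taylor[OF b(1)] Suc .
        next
          case False
          then have "to_faces i t (insert a B) = 0" if "a \<in> I - B" for a
            using insert_faces[OF B(1) that, of "Suc i'"] Suc by (simp add: to_faces_outside)
          then have "(\<Sum>a\<in>I - B. if g a \<subseteq> supp B then rem_sign a B * to_faces i t (insert a B) else 0) = (\<Sum>a\<in>I - B. 0)"
            by (intro sum.cong) auto
          then show ?thesis unfolding sum by simp
        qed
      qed
    qed
  qed
  have "\<forall>S. \<exists>y. S \<subseteq> V \<and> int (card S) = j \<longrightarrow> y \<in> cov_chain g (?J S) S (int i + 1 + 1) \<and> ?c S = cov_bd g (?J S) S y"
  proof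
    fix S
    show "\<exists>y. S \<subseteq> V \<and> int (card S) = j \<longrightarrow> y \<in> cov_chain g (?J S) S (int i + 1 + 1) \<and> ?c S = cov_bd g (?J S) S y"
    proof (cases "S \<subseteq> V \<and> int (card S) = j")
      case True
      then have "\<not> cov_hom TYPE('k) g (?J S) S (int i + 1)" using none by blast
      then show ?thesis using restrict_supp_chain[of S i t] cyc[of S] unfolding cov_hom_def by blast
    qed blast
  qed
  from choice[OF this] obtain y where y': "\<forall>S. S \<subseteq> V \<and> int (card S) = j \<longrightarrow>
    y S \<in> cov_chain g (?J S) S (int i + 1 + 1) \<and> ?c S = cov_bd g (?J S) S (y S)" by (rule exE)
  have y: "?c S = cov_bd g (?J S) S (y S)" if "S \<subseteq> V" "int (card S) = j" for S
    using y'[rule_format, of S] that by simp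
  \<comment> \<open>Each set takes its coefficient from the bounding chain chosen for its own
    support.\<close>
  define Y where "Y A = (if A \<in> faces (Suc (Suc i)) \<and> int (card (supp A)) = j then y (supp A) A else 0)" for A
  define u where "u = of_faces (Suc i) Y"
  have uY: "to_faces (Suc i) u = Y" unfolding u_def by (rule to_of_faces) (simp add: Y_def)
  have "u \<in> tensor_comp ?T (Suc i) j"
    by (auto simp: u_def tensor_comp_def of_faces_def taylor_cpx_def Y_def split: if_splits)
  moreover have "tensor_map ?T i u = t"
  proof
    fix b
    show "tensor_map ?T i u b = t b"
    proof (cases "b < card (faces (Suc i))")
      case False
      then show ?thesis using deg(2)[of b] by (auto simp: tensor_map_def rk_taylor)
    next
      case True
      let ?B = "face i b"
      have B: "?B \<in> faces (Suc i)" by (rule face_mem[OF True])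
      note BI = facesD(1)[OF B]
      have eq: "tensor_map ?T i u b = (\<Sum>a\<in>I - ?B. if g a \<subseteq> supp ?B then rem_sign a ?B * Y (insert a ?B) else 0)"
        unfolding tensor_map_taylor[OF True] uY ..
      show ?thesis
      proof (cases "int (card (supp ?B)) = j")
        case False
        have "(\<Sum>a\<in>I - ?B. if g a \<subseteq> supp ?B then rem_sign a ?B * Y (insert a ?B) else 0) = (\<Sum>a\<in>I - ?B. 0)"
          using False by (intro sum.cong) (auto simp: Y_def Un_absorb1)
        then show ?thesis using deg(1)[of b] False unfolding eq by auto
      next
        case j: True
        let ?S = "supp ?B"
        have "(\<Sum>a\<in>I - ?B. if g a \<subseteq> supp ?B then rem_sign a ?B * Y (insert a ?B) else 0)
          = (\<Sum>a\<in>I - ?B. if g a \<subseteq> supp ?B then rem_sign a ?B * y ?S (insert a ?B) else 0)"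
          using insert_faces[OF BI, of _ "Suc i"] B j by (intro sum.cong) (auto simp: Y_def Un_absorb1)
        also have "\<dots> = cov_bd g (?J ?S) ?S (y ?S) ?B" by (rule cov_bd_supp[OF BI refl, symmetric])
        also have "\<dots> = ?c ?S ?B" using y[OF supp_V[OF BI] j] by simp
        also have "\<dots> = t b" using True by (simp add: restrict_supp_def to_faces_face)
        finally show ?thesis unfolding eq .
      qed
    qed
  qed
  ultimately show False using t(2) unfolding tensor_boundaries_def by blast
qed

text \<open>A cover cycle is read as a tensor cycle concentrated on support \<open>S\<close>;
  restricting a bounding chain to this support would bound it among the covers.\<close>

lemma tensor_nonzero_taylorI:
  assumes S: "S \<subseteq> V" "int (card S) = j" and h: "cov_hom TYPE('k::field) g {a \<in> I. g a \<subseteq> S} S (int i + 1)"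
  shows "tensor_nonzero (taylor_cpx :: ('v, 'k, ('v, 'k) mpoly) free_cpx) i j"
proof -
  let ?T = "taylor_cpx :: ('v, 'k, ('v, 'k) mpoly) free_cpx"
  let ?J = "{a \<in> I. g a \<subseteq> S}"
  obtain c :: "nat set \<Rightarrow> 'k" where c: "c \<in> cov_chain g ?J S (int i + 1)" "cov_bd g ?J S c = (\<lambda>_. 0)"
    "c \<notin> cov_bd g ?J S ` cov_chain g ?J S (int i + 1 + 1)"
    using h unfolding cov_hom_def by blast
  have cS: "A \<in> faces (Suc i)" "supp A = S" if "c A \<noteq> 0" for A
    using cov_chain_supp[of c S "Suc i" A] c(1) that by (simp_all add: add.commute)
  define t where "t = of_faces i c"
  have tc: "to_faces i t = c" unfolding t_def by (rule to_of_faces) (use cS in blast)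
  have tcomp: "t \<in> tensor_comp ?T i j"
    unfolding tensor_comp_def
  proof (intro CollectI allI impI)
    fix b assume "t b \<noteq> 0"
    then have "b < card (faces (Suc i))" "c (face i b) \<noteq> 0" by (auto simp: t_def of_faces_def split: if_splits)
    then show "b < rk ?T i \<and> bdeg ?T i b = j" using cS(2) S(2) by (simp add: taylor_cpx_def)
  qed
  have sums: "(\<Sum>a\<in>I - B. if g a \<subseteq> supp B then rem_sign a B * c (insert a B) else 0) = 0" if B: "B \<subseteq> I" for B
  proof (cases "supp B = S")
    case True
    show ?thesis unfolding cov_bd_supp[OF B True, symmetric] c(2) ..
  next
    case False
    then have "c (insert a B) = 0" if "g a \<subseteq> supp B" for a using cS(2)[of "insert a B"] that by (auto simp: Un_absorb1)
    then have "(\<Sum>a\<in>I - B. if g a \<subseteq> supp B then rem_sign a B * c (insert a B) else 0) = (\<Sum>a\<in>I - B. 0)"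
      by (intro sum.cong) auto
    then show ?thesis by simp
  qed
  have "tensor_map ?T i' t = (\<lambda>_. 0)" if i: "i = Suc i'" for i'
  proof
    fix b show "tensor_map ?T i' t b = 0"
    proof (cases "b < card (faces (Suc i'))")
      case True
      show ?thesis unfolding tensor_map_taylor[OF True] tc[unfolded i]
        by (rule sums) (rule facesD(1)[OF face_mem[OF True]])
    qed (simp add: tensor_map_def rk_taylor)
  qed
  then have "t \<in> tensor_cycles ?T i j" using tcomp by (simp add: tensor_cycles_def split: nat.split)
  moreover have "t \<notin> tensor_boundaries ?T i j"
  proof
    assume "t \<in> tensor_boundaries ?T i j"
    then obtain u where u: "u \<in> tensor_comp ?T (Suc i) j" "t = tensor_map ?T i u"
      unfolding tensor_boundaries_def by blast
    let ?y = "restrict_supp S (to_faces (Suc i) u)"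
    have "c = cov_bd g ?J S ?y"
    proof
      fix B
      show "c B = cov_bd g ?J S ?y B"
      proof (cases "B \<subseteq> I \<and> supp B = S")
        case False
        have "c B = 0" using cS[of B] facesD(1)[of B "Suc i"] False by blast
        then show ?thesis unfolding cov_bd_not_supp[OF False] .
      next
        case True
        then have B: "B \<subseteq> I" "supp B = S" by auto
        have sum: "cov_bd g ?J S ?y B = (\<Sum>a\<in>I - B. if g a \<subseteq> supp B then rem_sign a B * to_faces (Suc i) u (insert a B) else 0)"
          unfolding cov_bd_supp[OF B] by (rule sum.cong) (use B(2) in \<open>auto simp: restrict_supp_def\<close>)
        show ?thesis
        proof (cases "B \<in> faces (Suc i)")
          case True
          then obtain b where b: "b < card (faces (Suc i))" "B = face i b" by (rule face_obtain)
          have "c B = t b" unfolding tc[symmetric] b(2) by (rule to_faces_face[OF b(1)])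
          also have "\<dots> = cov_bd g ?J S ?y B" unfolding u(2) sum unfolding b(2) by (rule tensor_map_taylor[OF b(1)])
          finally show ?thesis .
        next
          case False
          then have "to_faces (Suc i) u (insert a B) = 0" if "a \<in> I - B" for a
            using insert_faces[OF B(1) that, of "Suc i"] by (simp add: to_faces_outside)
          then have "(\<Sum>a\<in>I - B. if g a \<subseteq> supp B then rem_sign a B * to_faces (Suc i) u (insert a B) else 0) = (\<Sum>a\<in>I - B. 0)"
            by (intro sum.cong) auto
          then show ?thesis using False cS(1)[of B] unfolding sum by auto
        qed
      qed
    qed
    moreover have "?y \<in> cov_chain g ?J S (int i + 1 + 1)"
      using restrict_supp_chain[of S "Suc i" u] by (simp add: add.commute)
    ultimately show False using c(3) by blast
  qed
  ultimately show ?thesis unfolding tensor_nonzero_def by blast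
qed

text \<open>All least common multiples are squarefree, so a vertex set records the whole multidegree
  of a basis element.\<close>

theorem Tor_nonzero_mon_ideal:
  "Tor_nonzero V (*) (mon_ideal_comp :: int \<Rightarrow> ('v, 'k::field) mpoly set) i j \<longleftrightarrow>
    (\<exists>S \<subseteq> V. int (card S) = j \<and> cov_hom TYPE('k) g {a \<in> I. g a \<subseteq> S} S (int i + 1))"
  unfolding Tor_nonzero_eq[OF taylor_resolution]
  using tensor_nonzero_taylor_imp tensor_nonzero_taylorI by blast

end

section \<open>Closed paths in unicyclic graphs\<close>

text \<open>Cycles as vertex lists without the repeated base point, a form in which segments and
  concatenations are easy to take.\<close>

definition closed_path :: "'v set set \<Rightarrow> 'v list \<Rightarrow> bool" where
  "closed_path E xs \<longleftrightarrow> distinct xs \<and> 3 \<le> length xs \<and> successively (\<lambda>u v. {u, v} \<in> E) xs \<and> {last xs, hd xs} \<in> E"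

definition cyc_edges :: "'v list \<Rightarrow> 'v set set" where
  "cyc_edges xs = (\<lambda>i. {xs ! i, xs ! (Suc i mod length xs)}) ` {..<length xs}"

lemma successively_iff_nth: "successively P xs \<longleftrightarrow> (\<forall>i. Suc i < length xs \<longrightarrow> P (xs ! i) (xs ! Suc i))"
proof (induction P xs rule: successively.induct)
  case (3 P x y xs)
  show ?case
  proof
    assume *: "successively P (x # y # xs)"
    show "\<forall>i. Suc i < length (x # y # xs) \<longrightarrow> P ((x # y # xs) ! i) ((x # y # xs) ! Suc i)"
    proof (intro allI impI)
      fix i assume "Suc i < length (x # y # xs)"
      then show "P ((x # y # xs) ! i) ((x # y # xs) ! Suc i)" using * 3 by (cases i) auto
    qed
  next
    assume *: "\<forall>i. Suc i < length (x # y # xs) \<longrightarrow> P ((x # y # xs) ! i) ((x # y # xs) ! Suc i)"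
    have "P x y" using *[rule_format, of 0] by simp
    moreover have "P ((y # xs) ! i) ((y # xs) ! Suc i)" if "Suc i < length (y # xs)" for i
      using *[rule_format, of "Suc i"] that by simp
    ultimately show "successively P (x # y # xs)" using 3 by simp
  qed
qed simp_all

lemma image_set_nth: "f ` set p = (\<lambda>i. f (p ! i)) ` {..<length p}"
  by (auto simp: set_conv_nth)

lemma Union_cyc_edges:
  assumes "xs \<noteq> []" shows "\<Union> (cyc_edges xs) = set xs"
proof
  show "\<Union> (cyc_edges xs) \<subseteq> set xs" using assms by (auto simp: cyc_edges_def)
  show "set xs \<subseteq> \<Union> (cyc_edges xs)" by (auto simp: cyc_edges_def in_set_conv_nth)
qed

lemma closed_path_edge:
  assumes "closed_path E xs" "i < length xs"
  shows "{xs ! i, xs ! (Suc i mod length xs)} \<in> E"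
proof (cases "Suc i < length xs")
  case True
  then show ?thesis using assms by (simp add: closed_path_def successively_iff_nth)
next
  case False
  then have "Suc i = length xs" using assms(2) by simp
  then have "xs ! i = last xs" "xs ! (Suc i mod length xs) = hd xs"
    by (metis diff_Suc_1 last_conv_nth length_0_conv nat.distinct(1), metis hd_conv_nth length_0_conv mod_self nat.distinct(1))
  then show ?thesis using assms(1) by (simp add: closed_path_def)
qed

lemma closed_pathI:
  assumes "distinct xs" "3 \<le> length xs" "\<And>i. i < length xs \<Longrightarrow> {xs ! i, xs ! (Suc i mod length xs)} \<in> E"
  shows "closed_path E xs"
proof -
  have ne: "xs \<noteq> []" using assms(2) by auto
  have "{xs ! i, xs ! Suc i} \<in> E" if "Suc i < length xs" for i using assms(3)[of i] that by simp
  moreover have "{last xs, hd xs} \<in> E"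
    using assms(3)[of "length xs - 1"] ne by (simp add: last_conv_nth hd_conv_nth)
  ultimately show ?thesis using assms(1,2) by (simp add: closed_path_def successively_iff_nth)
qed

lemma last_hd_cyc_edge: "xs \<noteq> [] \<Longrightarrow> {last xs, hd xs} \<in> cyc_edges xs"
  unfolding cyc_edges_def by (rule image_eqI[of _ _ "length xs - 1"]) (simp_all add: last_conv_nth hd_conv_nth)

definition list_segment :: "'v list \<Rightarrow> nat \<Rightarrow> nat \<Rightarrow> 'v list" where
  "list_segment xs i j = take (Suc j - i) (drop i xs)"

lemma list_segment:
  assumes "i \<le> j" "j < length xs" "distinct xs" "successively P xs"
  shows "length (list_segment xs i j) = Suc j - i" "list_segment xs i j \<noteq> []" "hd (list_segment xs i j) = xs ! i"
    "last (list_segment xs i j) = xs ! j" "set (list_segment xs i j) \<subseteq> set xs" "distinct (list_segment xs i j)"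
    "successively P (list_segment xs i j)"
proof -
  show len: "length (list_segment xs i j) = Suc j - i" using assms by (simp add: list_segment_def)
  then show ne: "list_segment xs i j \<noteq> []" using assms by auto
  have nth: "list_segment xs i j ! k = xs ! (i + k)" if "k < Suc j - i" for k
    using that assms by (simp add: list_segment_def)
  show "hd (list_segment xs i j) = xs ! i" using nth[of 0] assms(1) ne by (simp add: hd_conv_nth)
  show "last (list_segment xs i j) = xs ! j" using nth[of "j - i"] assms(1) ne len by (simp add: last_conv_nth Suc_diff_le)
  show "set (list_segment xs i j) \<subseteq> set xs" unfolding list_segment_def by (meson order_trans set_drop_subset set_take_subset)
  show "distinct (list_segment xs i j)" using assms(3) by (simp add: list_segment_def)
  show "successively P (list_segment xs i j)"
    unfolding successively_iff_nth len
  proof (intro allI impI)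
    fix k assume k: "Suc k < Suc j - i"
    then show "P (list_segment xs i j ! k) (list_segment xs i j ! Suc k)"
      using assms(2,4) nth[of k] nth[of "Suc k"] by (simp add: successively_iff_nth)
  qed
qed

locale unique_closed_path =
  fixes V :: "'v set" and E :: "'v set set" and xs :: "'v list"
  assumes fin: "finite V" and E_pair: "e \<in> E \<Longrightarrow> \<exists>u v. u \<noteq> v \<and> e = {u, v} \<and> u \<in> V \<and> v \<in> V"
    and xs: "closed_path E xs" and unique: "closed_path E ys \<Longrightarrow> cyc_edges ys = cyc_edges xs"
begin

lemma xs_facts: "distinct xs" "3 \<le> length xs" "xs \<noteq> []" "successively (\<lambda>u v. {u, v} \<in> E) xs"
  using xs by (auto simp: closed_path_def)

lemma closed_path_set:
  assumes "closed_path E ys" shows "set ys = set xs"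
proof -
  have "ys \<noteq> []" using assms by (auto simp: closed_path_def)
  then show ?thesis using Union_cyc_edges[of ys] Union_cyc_edges[OF xs_facts(3)] unique[OF assms] by simp
qed

lemma E_neq: "{u, v} \<in> E \<Longrightarrow> u \<noteq> v"
  using E_pair[of "{u, v}"] by (auto simp: doubleton_eq_iff)

lemma E_swap: "{u, v} \<in> E \<Longrightarrow> {v, u} \<in> E"
  by (simp add: insert_commute)

lemma xs_V: "set xs \<subseteq> V"
proof
  fix x assume "x \<in> set xs"
  then obtain i where i: "i < length xs" "x = xs ! i" by (auto simp: in_set_conv_nth)
  then obtain u v where "{x, xs ! (Suc i mod length xs)} = {u, v}" "u \<in> V" "v \<in> V"
    using E_pair[OF closed_path_edge[OF xs i(1)]] by blast
  moreover have "x \<in> {x, xs ! (Suc i mod length xs)}" by blast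
  ultimately show "x \<in> V" by auto
qed

text \<open>A chord closes the segment between its ends to a closed path. By uniqueness this path
  has the same edges as \<open>xs\<close>, and the chord is one of them.\<close>

lemma chord_in_cycle:
  assumes "{xs ! i, xs ! j} \<in> E" "i < j" "j < length xs"
  shows "{xs ! i, xs ! j} \<in> cyc_edges xs"
proof (cases "j = Suc i")
  case True
  then have "{xs ! i, xs ! j} = {xs ! i, xs ! (Suc i mod length xs)}" "i < length xs" using assms by simp_all
  then show ?thesis unfolding cyc_edges_def by blast
next
  case False
  let ?ys = "list_segment xs i j"
  note seg = list_segment[OF less_imp_le[OF assms(2)] assms(3) xs_facts(1,4)]
  have "closed_path E ?ys"
    unfolding closed_path_def using seg assms False E_swap[OF assms(1)] by auto
  then have "cyc_edges ?ys = cyc_edges xs" by (rule unique)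
  then show ?thesis using last_hd_cyc_edge[OF seg(2)] seg(3,4) by (simp add: insert_commute)
qed

lemma chordless_xs:
  assumes "e \<in> E" "e \<subseteq> set xs"
  shows "e \<in> cyc_edges xs"
proof -
  obtain u v where uv: "u \<noteq> v" "e = {u, v}" using E_pair[OF assms(1)] by blast
  then obtain i j where ij: "i < length xs" "j < length xs" "u = xs ! i" "v = xs ! j"
    using assms(2) by (auto simp: in_set_conv_nth)
  then consider "i < j" | "j < i" using uv by fastforce
  then show ?thesis
  proof cases
    case 1
    then show ?thesis using chord_in_cycle[of i j] assms(1) uv ij by simp
  next
    case 2
    then show ?thesis using chord_in_cycle[of j i] assms(1) uv ij by (simp add: insert_commute)
  qed
qed

text \<open>Some vertex of \<open>S\<close> has its cyclic successor outside \<open>S\<close>;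
  without chords it can only be adjacent to its predecessor.\<close>

lemma leaf_in_cycle:
  assumes "S \<subset> set xs" "S \<noteq> {}"
  shows "\<exists>u \<in> S. card {v \<in> S. {u, v} \<in> E} \<le> 1"
proof -
  let ?n = "length xs"
  have n: "3 \<le> ?n" by (rule xs_facts(2))
  have nth_eq: "xs ! i = xs ! j \<longleftrightarrow> i = j" if "i < ?n" "j < ?n" for i j
    using nth_eq_iff_index_eq[OF xs_facts(1)] that by blast
  have "\<exists>i < ?n. xs ! i \<in> S \<and> xs ! (Suc i mod ?n) \<notin> S"
  proof (rule ccontr)
    assume *: "\<not> ?thesis"
    obtain i where i: "i < ?n" "xs ! i \<in> S" using assms by (metis ex_in_conv in_set_conv_nth psubsetD)
    have st: "xs ! ((i + k) mod ?n) \<in> S" for k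
    proof (induction k)
      case (Suc k)
      have "0 < ?n" using n by linarith
      then have "(i + k) mod ?n < ?n" by (rule mod_less_divisor)
      then have "xs ! (Suc ((i + k) mod ?n) mod ?n) \<in> S" using Suc * by blast
      then show ?case by (simp add: mod_Suc_eq)
    qed (use i in simp)
    have "xs ! j \<in> S" if j: "j < ?n" for j
    proof -
      have "(i + (j + ?n - i)) mod ?n = j" using i(1) j by simp
      then show ?thesis using st[of "j + ?n - i"] by simp
    qed
    then have "set xs \<subseteq> S" by (auto simp: in_set_conv_nth)
    then show False using assms(1) by blast
  qed
  then obtain i where i: "i < ?n" "xs ! i \<in> S" "xs ! (Suc i mod ?n) \<notin> S" by blast
  define p where "p = (if i = 0 then ?n - 1 else i - 1)"
  have "{v \<in> S. {xs ! i, v} \<in> E} \<subseteq> {xs ! p}"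
  proof
    fix v assume "v \<in> {v \<in> S. {xs ! i, v} \<in> E}"
    then have v: "v \<in> S" "{xs ! i, v} \<in> E" by auto
    then have "{xs ! i, v} \<in> cyc_edges xs" using chordless_xs[OF v(2)] i(2) assms(1) by blast
    then obtain k where k: "k < ?n" "{xs ! i, v} = {xs ! k, xs ! (Suc k mod ?n)}" by (auto simp: cyc_edges_def)
    have lt: "Suc k mod ?n < ?n" by (rule mod_less_divisor) (use n in linarith)
    consider "xs ! i = xs ! k" "v = xs ! (Suc k mod ?n)" | "xs ! i = xs ! (Suc k mod ?n)" "v = xs ! k"
      using k(2) by (auto simp: doubleton_eq_iff)
    then show "v \<in> {xs ! p}"
    proof cases
      case 1
      then have "i = k" using nth_eq i(1) k(1) by blast
      then show ?thesis using 1 i(3) v(1) by simp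
    next
      case 2
      then have "i = Suc k mod ?n" using nth_eq i(1) lt by blast
      then have "k = p" using k(1) n unfolding p_def by (auto simp: mod_Suc split: if_splits)
      then show ?thesis using 2 by simp
    qed
  qed
  then have "card {v \<in> S. {xs ! i, v} \<in> E} \<le> card {xs ! p}" by (rule card_mono[rotated]) simp
  then show ?thesis using i(2) by auto
qed

section \<open>Paths off the cycle\<close>

definition outer_path :: "'v set \<Rightarrow> 'v list \<Rightarrow> bool" where
  "outer_path S p \<longleftrightarrow> p \<noteq> [] \<and> distinct p \<and> set p \<subseteq> S - set xs \<and> successively (\<lambda>u v. {u, v} \<in> E) p"

lemma outer_path_rev: "outer_path S p \<Longrightarrow> outer_path S (rev p)"
  by (auto simp: outer_path_def insert_commute)

text \<open>A further neighbour off the cycle would either prolong the longest path or close part of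
  it to a cycle that misses \<open>xs\<close>.\<close>

lemma maximal_end:
  assumes p: "outer_path S p" and max: "\<And>q. outer_path S q \<Longrightarrow> length q \<le> length p"
    and x: "x \<in> S" "{hd p, x} \<in> E" "x \<notin> set xs"
  shows "length p \<ge> 2 \<and> x = p ! 1"
proof -
  have p': "p \<noteq> []" "distinct p" "set p \<subseteq> S - set xs" "successively (\<lambda>u v. {u, v} \<in> E) p"
    using p by (auto simp: outer_path_def)
  have "x \<in> set p"
  proof (rule ccontr)
    assume "x \<notin> set p"
    then have "outer_path S (x # p)"
      unfolding outer_path_def using p' x E_swap[OF x(2)] by (auto simp: successively_Cons)
    then show False using max[of "x # p"] by simp
  qed
  then obtain k where k: "k < length p" "x = p ! k" by (auto simp: in_set_conv_nth)
  have "k \<noteq> 0" using E_neq[OF x(2)] k p'(1) by (metis hd_conv_nth)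
  have "\<not> k \<ge> 2"
  proof
    assume k2: "k \<ge> 2"
    note seg = list_segment[of 0 k p, OF _ k(1) p'(2,4)]
    have "closed_path E (list_segment p 0 k)"
      unfolding closed_path_def using seg k2 E_swap[OF x(2)] k(2) p'(1) by (simp add: hd_conv_nth)
    then have "set (list_segment p 0 k) = set xs" by (rule closed_path_set)
    moreover have "hd (list_segment p 0 k) \<in> set (list_segment p 0 k)" by (rule hd_in_set) (use seg(2) in simp)
    ultimately show False using seg(5) p'(3) by blast
  qed
  with \<open>k \<noteq> 0\<close> have "k = 1" by linarith
  then show ?thesis using k by simp
qed

text \<open>Together with an arc of the cycle from \<open>y\<close> to \<open>x\<close>, the path
  forms a closed path with a vertex off \<open>xs\<close>. If \<open>x = y\<close>, the arc is a
  single vertex and \<open>length p \<ge> 2\<close> makes the result long enough.\<close>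

lemma outer_path_ends:
  assumes p: "outer_path S p" and x: "x \<in> set xs" "{hd p, x} \<in> E" and y: "y \<in> set xs" "{last p, y} \<in> E"
    and "x \<noteq> y \<or> length p \<ge> 2"
  shows False
proof -
  have p': "p \<noteq> []" "distinct p" "set p \<inter> set xs = {}" "successively (\<lambda>u v. {u, v} \<in> E) p"
    using p by (auto simp: outer_path_def)
  have contra: False if "closed_path E (q @ p)" for q
    using closed_path_set[OF that] p'(1,3) by (cases p) auto
  show False
  proof (cases "x = y")
    case True
    then have "closed_path E ([x] @ p)"
      unfolding closed_path_def using p' assms(6) x y E_swap[OF x(2)]
      by (auto simp: successively_Cons)
    then show False by (rule contra)
  next
    case False
    obtain i j where ij: "i < length xs" "j < length xs" "x = xs ! i" "y = xs ! j"
      using x y by (auto simp: in_set_conv_nth)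
    \<comment> \<open>Of the two arcs the one that does not wrap around the list is taken, reversed
      if necessary.\<close>
    have "\<exists>q. q \<noteq> [] \<and> hd q = y \<and> last q = x \<and> set q \<subseteq> set xs \<and> distinct q \<and> successively (\<lambda>u v. {u, v} \<in> E) q"
    proof (cases "j \<le> i")
      case True
      show ?thesis using list_segment[OF True ij(1) xs_facts(1,4)] ij by blast
    next
      case False
      then have "i \<le> j" by simp
      note seg = list_segment[OF this ij(2) xs_facts(1,4)]
      show ?thesis
        by (rule exI[of _ "rev (list_segment xs i j)"])
          (use seg ij in \<open>simp add: hd_rev last_rev insert_commute\<close>)
    qed
    then obtain q where q: "q \<noteq> []" "hd q = y" "last q = x" "set q \<subseteq> set xs" "distinct q" "successively (\<lambda>u v. {u, v} \<in> E) q"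
      by blast
    have "length q \<ge> 2"
    proof (rule ccontr)
      assume "\<not> length q \<ge> 2"
      moreover have "length q \<noteq> 0" using q(1) by simp
      ultimately have "length q = 1" by linarith
      then have "hd q = last q" by (auto simp: length_Suc_conv)
      then show False using q False by simp
    qed
    moreover have "length p \<ge> 1" using p'(1) by (cases p) auto
    ultimately have "closed_path E (q @ p)"
      unfolding closed_path_def using q p' E_swap[OF x(2)] y(2)
      by (auto simp: successively_append_iff)
    then show False by (rule contra)
  qed
qed

text \<open>If all vertices of \<open>S\<close> off the cycle had degree at least two in
  \<open>S\<close>, both ends of a longest outer path would be adjacent to the cycle, which
  \<open>outer_path_ends\<close> excludes.\<close>

lemma leaf_outside_cycle:
  assumes S: "S \<subseteq> V" "\<not> S \<subseteq> set xs"
  shows "\<exists>u \<in> S - set xs. card {v \<in> S. {u, v} \<in> E} \<le> 1"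
proof (rule ccontr)
  assume "\<not> ?thesis"
  then have deg: "card {v \<in> S. {u, v} \<in> E} \<ge> 2" if "u \<in> S - set xs" for u using that by force
  have finS: "finite S" using S(1) fin finite_subset by blast
  obtain u where u: "u \<in> S" "u \<notin> set xs" using S(2) by blast
  have "outer_path S [u]" using u by (simp add: outer_path_def)
  moreover have "\<forall>q. outer_path S q \<longrightarrow> length q < Suc (card S)"
  proof (intro allI impI)
    fix q assume "outer_path S q"
    then have "length q = card (set q)" "set q \<subseteq> S" by (auto simp: outer_path_def distinct_card)
    then show "length q < Suc (card S)" using card_mono[OF finS, of "set q"] by linarith
  qed
  ultimately have "\<exists>p. outer_path S p \<and> (\<forall>q. outer_path S q \<longrightarrow> length q \<le> length p)"
    by (rule Lattices_Big.ex_has_greatest_nat)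
  then obtain p where p: "outer_path S p" and max: "\<And>q. outer_path S q \<Longrightarrow> length q \<le> length p" by blast
  have pne: "p \<noteq> []" and pS: "set p \<subseteq> S - set xs" using p by (auto simp: outer_path_def)
  have pr: "outer_path S (rev p)" by (rule outer_path_rev[OF p])
  have maxr: "length q \<le> length (rev p)" if "outer_path S q" for q using max[OF that] by simp
  have two: "\<exists>a b. a \<noteq> b \<and> a \<in> S \<and> b \<in> S \<and> {hd q, a} \<in> E \<and> {hd q, b} \<in> E" if "outer_path S q" for q
  proof -
    have "hd q \<in> S - set xs" using that hd_in_set[of q] unfolding outer_path_def by blast
    then have "card {v \<in> S. {hd q, v} \<in> E} \<ge> 2" by (rule deg)
    moreover have "finite {v \<in> S. {hd q, v} \<in> E}" using finS by simp
    ultimately show ?thesis by (auto simp: card_le_Suc_iff numeral_2_eq_2)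
  qed
  have cyc_nbr: "\<exists>x \<in> set xs. {hd q, x} \<in> E"
    if q: "outer_path S q" "\<And>r. outer_path S r \<Longrightarrow> length r \<le> length q" for q
  proof -
    obtain a b where ab: "a \<noteq> b" "a \<in> S" "b \<in> S" "{hd q, a} \<in> E" "{hd q, b} \<in> E" using two[OF q(1)] by blast
    then show ?thesis using maximal_end[OF q, of a] maximal_end[OF q, of b] by blast
  qed
  obtain x where x: "x \<in> set xs" "{hd p, x} \<in> E" using cyc_nbr[OF p max] by blast
  obtain y where y: "y \<in> set xs" "{last p, y} \<in> E" using cyc_nbr[OF pr maxr] pne by (auto simp: hd_rev)
  show False
  proof (cases "length p \<ge> 2")
    case True
    then show False using outer_path_ends[OF p x y] by blast
  next
    \<comment> \<open>A path with a single vertex: both of its distinct neighbours lie on the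
      cycle.\<close>
    case False
    obtain a b where ab: "a \<noteq> b" "a \<in> S" "b \<in> S" "{hd p, a} \<in> E" "{hd p, b} \<in> E" using two[OF p] by blast
    have "a \<in> set xs" "b \<in> set xs" using maximal_end[OF p max, of a] maximal_end[OF p max, of b] ab False by blast+
    moreover have "last p = hd p" using False pne by (cases p; cases "tl p") auto
    ultimately show False using outer_path_ends[OF p, of a b] ab by simp
  qed
qed

lemma leaf_exists:
  assumes "S \<subseteq> V" "S \<noteq> {}" "S \<noteq> set xs"
  shows "\<exists>u \<in> S. card {v \<in> S. {u, v} \<in> E} \<le> 1 \<and> (set xs \<subseteq> S \<longrightarrow> u \<notin> set xs)"
proof (cases "S \<subseteq> set xs")
  case True
  then have "S \<subset> set xs" using assms by blast
  then show ?thesis using leaf_in_cycle[OF _ assms(2)] by (metis psubsetE)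
next
  case False
  then show ?thesis using leaf_outside_cycle[OF assms(1)] by blast
qed

end

section \<open>Translation between vertex lists and arc walks\<close>

context graph
begin

lemma uedges_iff: "{u, v} \<in> uedges G \<longleftrightarrow> u \<rightarrow>\<^bsub>G\<^esub> v"
proof
  assume "{u, v} \<in> uedges G"
  then obtain a b where ab: "{u, v} = {a, b}" "a \<rightarrow>\<^bsub>G\<^esub> b" unfolding uedges_def by blast
  then show "u \<rightarrow>\<^bsub>G\<^esub> v" using arcs_ends_symmetric[OF sym_arcs ab(2)] by (auto simp: doubleton_eq_iff)
qed (auto simp: uedges_def)

fun path_arcs :: "'a list \<Rightarrow> 'b list" where
  "path_arcs (u # v # vs) = (SOME e. e \<in> arcs G \<and> tail G e = u \<and> head G e = v) # path_arcs (v # vs)"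
| "path_arcs _ = []"

lemma path_arcs:
  assumes "successively (\<lambda>u v. u \<rightarrow>\<^bsub>G\<^esub> v) (u # vs)"
  shows "set (path_arcs (u # vs)) \<subseteq> arcs G \<and> cas u (path_arcs (u # vs)) (last (u # vs)) \<and>
    awalk_verts u (path_arcs (u # vs)) = u # vs \<and> length (path_arcs (u # vs)) = length vs \<and>
    (\<forall>i < length vs. tail G (path_arcs (u # vs) ! i) = (u # vs) ! i \<and> head G (path_arcs (u # vs) ! i) = vs ! i)"
  using assms
proof (induction vs arbitrary: u)
  case (Cons v vs)
  let ?e = "SOME e. e \<in> arcs G \<and> tail G e = u \<and> head G e = v"
  have "u \<rightarrow>\<^bsub>G\<^esub> v" using Cons.prems by simp
  then have "\<exists>e. e \<in> arcs G \<and> tail G e = u \<and> head G e = v" by (auto elim: reachableE)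
  then have e: "?e \<in> arcs G" "tail G ?e = u" "head G ?e = v" using someI_ex[of "\<lambda>e. e \<in> arcs G \<and> tail G e = u \<and> head G e = v"] by auto
  have IH: "set (path_arcs (v # vs)) \<subseteq> arcs G \<and> cas v (path_arcs (v # vs)) (last (v # vs)) \<and>
    awalk_verts v (path_arcs (v # vs)) = v # vs \<and> length (path_arcs (v # vs)) = length vs \<and>
    (\<forall>i < length vs. tail G (path_arcs (v # vs) ! i) = (v # vs) ! i \<and> head G (path_arcs (v # vs) ! i) = vs ! i)"
    by (rule Cons.IH) (use Cons.prems in simp)
  have "tail G (path_arcs (u # v # vs) ! i) = (u # v # vs) ! i \<and> head G (path_arcs (u # v # vs) ! i) = (v # vs) ! i"
    if "i < length (v # vs)" for i
    using IH e that by (cases i) simp_all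
  then show ?case using IH e by simp
qed simp

lemma closed_path_graph_cycle:
  assumes "closed_path (uedges G) xs"
  shows "cyc_edges xs \<in> graph_cycles G"
proof -
  let ?n = "length xs"
  have xs: "distinct xs" "3 \<le> ?n" "successively (\<lambda>u v. u \<rightarrow>\<^bsub>G\<^esub> v) xs" "last xs \<rightarrow>\<^bsub>G\<^esub> hd xs"
    using assms by (auto simp: closed_path_def uedges_iff)
  obtain u vs where uvs: "xs = u # vs" using xs(2) by (cases xs) auto
  \<comment> \<open>The walk returns to its base point, which \<open>xs\<close> lists only
    once.\<close>
  define ws where "ws = vs @ [u]"
  have "successively (\<lambda>u v. u \<rightarrow>\<^bsub>G\<^esub> v) (xs @ [u])"
  proof -
    have "hd xs = u" by (simp add: uvs)
    then show ?thesis using xs(3) xs(4) by (simp add: successively_append_iff)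
  qed
  then have "successively (\<lambda>u v. u \<rightarrow>\<^bsub>G\<^esub> v) (u # ws)" by (simp add: ws_def uvs)
  note p = path_arcs[OF this]
  let ?p = "path_arcs (u # ws)"
  have lw: "length ws = ?n" by (simp add: ws_def uvs)
  have "u \<in> verts G" using xs(4) adj_in_verts(2) uvs by auto
  then have "awalk u ?p u" using p by (simp add: awalk_def ws_def)
  moreover have "distinct (tl (awalk_verts u ?p))" using p xs(1) uvs by (simp add: ws_def)
  moreover have "3 \<le> length ?p" using p lw xs(2) by simp
  ultimately have cyc: "cycle ?p" "3 \<le> length ?p" unfolding cycle_def by auto
  have nth: "{tail G (?p ! i), head G (?p ! i)} = {xs ! i, xs ! (Suc i mod ?n)}" if i: "i < ?n" for i
  proof -
    have "(u # ws) ! i = xs ! i" using i by (simp add: ws_def uvs nth_append nth_Cons split: nat.split)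
    moreover have "ws ! i = xs ! (Suc i mod ?n)"
      using i by (cases "Suc i = ?n") (auto simp: ws_def uvs nth_append)
    ultimately show ?thesis using p i lw by auto
  qed
  have "(\<lambda>e. {tail G e, head G e}) ` set ?p = (\<lambda>i. {tail G (?p ! i), head G (?p ! i)}) ` {..<?n}"
    unfolding image_set_nth using p lw by simp
  also have "\<dots> = cyc_edges xs" unfolding cyc_edges_def by (rule image_cong) (use nth in auto)
  finally show ?thesis using cyc unfolding graph_cycles_def by blast
qed

lemma cas_verts: "cas u p v \<Longrightarrow> awalk_verts u p = u # map (head G) p"
  by (induction p arbitrary: u) auto

lemma cas_tail:
  assumes "cas u p v" "i < length p"
  shows "tail G (p ! i) = (if i = 0 then u else head G (p ! (i - 1)))"
  using assms
proof (induction p arbitrary: u i)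
  case (Cons e p)
  then show ?case
  proof (cases i)
    case (Suc j)
    have "tail G (p ! j) = (if j = 0 then head G e else head G (p ! (j - 1)))"
      by (rule Cons.IH) (use Cons.prems Suc in auto)
    then show ?thesis using Suc by (cases j) auto
  qed simp
qed simp

lemma cas_last: "cas u p v \<Longrightarrow> p \<noteq> [] \<Longrightarrow> head G (last p) = v"
  by (induction p arbitrary: u) (auto split: if_splits)

text \<open>The heads of the arcs serve as vertices. Since the head of an arc is the tail of the
  next one, pair \<open>i\<close> belongs to arc \<open>i + 1\<close>, and \<open>surj\<close>
  undoes this rotation.\<close>

lemma graph_cycle_closed_path:
  assumes "C \<in> graph_cycles G"
  shows "\<exists>xs. closed_path (uedges G) xs \<and> C = cyc_edges xs"
proof -
  obtain p where p: "cycle p" "3 \<le> length p" "C = (\<lambda>e. {tail G e, head G e}) ` set p"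
    using assms unfolding graph_cycles_def by blast
  then obtain u where u: "awalk u p u" "distinct (tl (awalk_verts u p))" unfolding cycle_def by blast
  have cas: "cas u p u" and arcs: "set p \<subseteq> arcs G" using u(1) by (auto simp: awalk_def)
  let ?n = "length p"
  let ?xs = "map (head G) p"
  have n: "0 < ?n" using p(2) by linarith
  have "distinct ?xs" using u(2) cas_verts[OF cas] by simp
  have pair: "{?xs ! i, ?xs ! (Suc i mod ?n)} = {tail G (p ! (Suc i mod ?n)), head G (p ! (Suc i mod ?n))}" if i: "i < ?n" for i
  proof (cases "Suc i = ?n")
    case True
    then have "i = ?n - 1" by simp
    then have "?xs ! i = u" using cas_last[OF cas] n i by (simp add: last_conv_nth)
    moreover have "tail G (p ! 0) = u" using cas_tail[OF cas n] by simp
    ultimately show ?thesis using True n by simp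
  next
    case False
    then show ?thesis using cas_tail[OF cas, of "Suc i"] i by simp
  qed
  have surj: "(\<lambda>i. Suc i mod ?n) ` {..<?n} = {..<?n}"
  proof
    show "{..<?n} \<subseteq> (\<lambda>i. Suc i mod ?n) ` {..<?n}"
    proof
      fix j assume "j \<in> {..<?n}"
      then show "j \<in> (\<lambda>i. Suc i mod ?n) ` {..<?n}"
        by (cases j) (auto intro: image_eqI[of _ _ "?n - 1"] image_eqI[of _ _ "j - 1"])
    qed
  qed (use n in auto)
  have "closed_path (uedges G) ?xs"
  proof (rule closed_pathI)
    show "distinct ?xs" "3 \<le> length ?xs" using \<open>distinct ?xs\<close> p(2) by auto
    fix i assume "i < length ?xs"
    then have i: "i < ?n" by simp
    have "p ! (Suc i mod ?n) \<in> arcs G" using arcs n by (meson mod_less_divisor nth_mem subsetD)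
    then have "tail G (p ! (Suc i mod ?n)) \<rightarrow>\<^bsub>G\<^esub> head G (p ! (Suc i mod ?n))" by (simp add: arcs_ends_conv)
    then show "{?xs ! i, ?xs ! (Suc i mod length ?xs)} \<in> uedges G"
      using pair[OF i] unfolding uedges_iff[symmetric] by simp
  qed
  moreover have "C = cyc_edges ?xs"
  proof -
    have "cyc_edges ?xs = (\<lambda>i. {tail G (p ! (Suc i mod ?n)), head G (p ! (Suc i mod ?n))}) ` {..<?n}"
      unfolding cyc_edges_def length_map by (rule image_cong) (use pair in auto)
    also have "\<dots> = (\<lambda>j. {tail G (p ! j), head G (p ! j)}) ` ((\<lambda>i. Suc i mod ?n) ` {..<?n})"
      by (simp only: image_image)
    also have "\<dots> = C" unfolding surj p(3) image_set_nth ..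
    finally show ?thesis by simp
  qed
  ultimately show ?thesis by blast
qed

end

section \<open>Regularity of edge ideals\<close>

lemma poly_sum_monomials: "p = (\<Sum>m\<in>Poly_Mapping.keys p. Poly_Mapping.single m (Poly_Mapping.lookup p m))"
proof (rule poly_mapping_eqI)
  fix m
  have "(\<Sum>k\<in>Poly_Mapping.keys p. Poly_Mapping.lookup (Poly_Mapping.single k (Poly_Mapping.lookup p k)) m)
      = (\<Sum>k\<in>Poly_Mapping.keys p. if k = m then Poly_Mapping.lookup p m else 0)"
    by (rule sum.cong) (auto simp: lookup_single when_def)
  also have "\<dots> = Poly_Mapping.lookup p m" by (simp add: sum.delta in_keys_iff)
  finally show "Poly_Mapping.lookup p m
      = Poly_Mapping.lookup (\<Sum>m\<in>Poly_Mapping.keys p. Poly_Mapping.single m (Poly_Mapping.lookup p m)) m"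
    by (simp add: lookup_sum)
qed

lemma pvar_mult:
  assumes "u \<noteq> v"
  shows "pvar u * pvar v = (Poly_Mapping.single (sqf {u, v}) 1 :: ('v, 'k::field) mpoly)"
  using assms by (simp add: pvar_def mult_single sqf_def)

lemma ideal_sum:
  assumes "is_ideal R t" "\<And>x. x \<in> X \<Longrightarrow> f x \<in> t"
  shows "sum f X \<in> t"
  using assms(2)
proof (induction X rule: infinite_finite_induct)
  case (insert x X)
  have "f x \<in> t" "sum f X \<in> t" using insert by auto
  then have "f x + sum f X \<in> t" using assms(1) unfolding is_ideal_def by blast
  then show ?case using insert.hyps by simp
qed (use assms(1) in \<open>auto simp: is_ideal_def\<close>)

text \<open>The right-hand side is itself an ideal containing the generators. Conversely, each term
  of such a polynomial is a multiple of an edge monomial, hence lies in every ideal that contains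
  the generators.\<close>

lemma edge_ideal_eq:
  assumes G: "graph G" and h: "h ` I = uedges G"
  shows "edge_ideal G = {p \<in> poly_ring (verts G) :: ('v, 'k::field) mpoly set.
    \<forall>m \<in> Poly_Mapping.keys p. \<exists>a \<in> I. h a \<subseteq> Poly_Mapping.keys m}" (is "_ = ?J")
proof
  interpret graph G by (rule G)
  let ?R = "poly_ring (verts G) :: ('v, 'k) mpoly set"
  let ?gens = "{pvar u * pvar v | u v. u \<rightarrow>\<^bsub>G\<^esub> v} :: ('v, 'k) mpoly set"
  have neq: "u \<noteq> v" if "u \<rightarrow>\<^bsub>G\<^esub> v" for u v using adj_not_same that by blast
  show "edge_ideal G \<subseteq> ?J"
    unfolding edge_ideal_def
  proof (rule hull_minimal)
    show "?gens \<subseteq> ?J"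
    proof
      fix p :: "('v, 'k) mpoly" assume "p \<in> ?gens"
      then obtain u v where uv: "p = pvar u * pvar v" "u \<rightarrow>\<^bsub>G\<^esub> v" by blast
      have keys: "Poly_Mapping.keys p = {sqf {u, v}}" unfolding uv(1) pvar_mult[OF neq[OF uv(2)]] by simp
      have "{u, v} \<in> h ` I" unfolding h using uv(2) by (simp add: uedges_iff)
      then obtain a where "a \<in> I" "h a = {u, v}" by auto
      then show "p \<in> ?J" using adj_in_verts[OF uv(2)] by (auto simp: keys poly_ring_def)
    qed
    show "is_ideal ?R ?J"
      unfolding is_ideal_def
    proof (intro conjI ballI)
      show "?J \<subseteq> ?R" "0 \<in> ?J" by (auto simp: poly_ring_zero)
      fix p q assume p: "p \<in> ?J" and q: "q \<in> ?J"
      then show "p + q \<in> ?J" using poly_ring_add[of p "verts G" q] keys_add[of p q] by blast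
    next
      fix r p assume r: "r \<in> ?R" and p: "p \<in> ?J"
      have "\<exists>a\<in>I. h a \<subseteq> Poly_Mapping.keys m" if m: "m \<in> Poly_Mapping.keys (r * p)" for m
      proof -
        obtain k l where kl: "m = k + l" "l \<in> Poly_Mapping.keys p" using m keys_mult[of r p] by blast
        then obtain a where "a \<in> I" "h a \<subseteq> Poly_Mapping.keys l" using p by blast
        then show ?thesis using kl(1) keys_add_nat[of k l] by blast
      qed
      then show "r * p \<in> ?J" using poly_ring_mult[OF r, of p] p by blast
    qed
  qed
  show "?J \<subseteq> edge_ideal G"
    unfolding edge_ideal_def hull_def
  proof (intro subsetI InterI)
    fix p t assume p: "p \<in> ?J" and "t \<in> {t. is_ideal ?R t \<and> ?gens \<subseteq> t}"
    then have t: "is_ideal ?R t" "?gens \<subseteq> t" by auto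
    have "Poly_Mapping.single m (Poly_Mapping.lookup p m) \<in> t" if m: "m \<in> Poly_Mapping.keys p" for m
    proof -
      obtain a where a: "a \<in> I" "h a \<subseteq> Poly_Mapping.keys m" using p m by blast
      then have "h a \<in> uedges G" using h by blast
      then obtain u v where uv: "h a = {u, v}" "u \<rightarrow>\<^bsub>G\<^esub> v" unfolding uedges_def by blast
      let ?r = "Poly_Mapping.single (m - sqf {u, v}) (Poly_Mapping.lookup p m)"
      have e: "m - sqf {u, v} + sqf {u, v} = m" by (rule monom_diff_add) (use a(2) uv(1) in auto)
      have "Poly_Mapping.keys (m - sqf {u, v}) \<subseteq> Poly_Mapping.keys m"
        using keys_add_nat[of "m - sqf {u, v}" "sqf {u, v}"] unfolding e by blast
      moreover have "Poly_Mapping.keys m \<subseteq> verts G" using p m by (auto simp: poly_ring_def)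
      ultimately have "?r \<in> ?R" by (auto simp: poly_ring_def split: if_splits)
      moreover have "pvar u * pvar v \<in> t" using t(2) uv(2) by blast
      ultimately have "?r * (pvar u * pvar v) \<in> t" using t(1) unfolding is_ideal_def by blast
      then show ?thesis unfolding pvar_mult[OF neq[OF uv(2)]] by (simp add: mult_single e)
    qed
    then have "(\<Sum>m\<in>Poly_Mapping.keys p. Poly_Mapping.single m (Poly_Mapping.lookup p m)) \<in> t" by (rule ideal_sum[OF t(1)])
    then show "p \<in> t" using poly_sum_monomials[of p] by simp
  qed
qed

text \<open>Bounds the degrees with homology, so that \<open>Max\<close> is taken over a finite
  set.\<close>

lemma cov_hom_le:
  fixes T :: "'k::field itself"
  assumes "finite I" "cov_hom T g I S n"
  shows "n \<le> int (card I)"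
proof -
  obtain c :: "nat set \<Rightarrow> 'k" where c: "c \<in> cov_chain g I S n" "c \<notin> cov_bd g I S ` cov_chain g I S (n + 1)"
    using assms(2) unfolding cov_hom_def by blast
  from c(2) obtain A where "c A \<noteq> 0" by (rule cov_bd_nonzero)
  then have "A \<subseteq> I" "int (card A) = n" using c(1) unfolding cov_chain_def by blast+
  then show ?thesis using card_mono[OF assms(1)] by auto
qed

context unicyclic_edges
begin

text \<open>With \<open>d = i + 1\<close> the difference \<open>card S - i\<close> is
  \<open>card S - d + 1\<close>, which accounts for the summand 1 next to the matching
  number.\<close>

lemma Max_ind_hom:
  fixes T :: "'k::field itself"
  defines "R \<equiv> {int (card S) - int i | S i. S \<subseteq> V \<and> ind_hom T S (int i + 1)}"
  shows "Max R = int (ind_match_num V) + 1 \<longleftrightarrow>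
    n mod 3 = 0 \<or> n mod 3 = 1 \<or> ind_match_num (V - cyc_nbrs) < ind_match_num V"
proof -
  have "R \<subseteq> (\<lambda>(a, i). int a - int i) ` ({..card V} \<times> {..card I})"
  proof
    fix x assume "x \<in> R"
    then obtain S i where S: "x = int (card S) - int i" "S \<subseteq> V" "ind_hom T S (int i + 1)" unfolding R_def by blast
    have "int i + 1 \<le> int (card (edges_in S))"
      using cov_hom_le[OF fin_edges_in] S(3) unfolding ind_hom_def by blast
    moreover have "card (edges_in S) \<le> card I" by (rule card_mono[OF fin_I]) (auto simp: edges_in_def)
    ultimately have "i \<le> card I" by linarith
    moreover have "card S \<le> card V" by (rule card_mono[OF fin_V S(2)])
    ultimately show "x \<in> (\<lambda>(a, i). int a - int i) ` ({..card V} \<times> {..card I})" using S(1) by force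
  qed
  then have fin: "finite R" by (rule finite_subset) simp
  \<comment> \<open>The homological degree \<open>d - 1\<close> is a natural number only for
    \<open>d \<ge> 1\<close>.\<close>
  have mem: "int (card S) - d + 1 \<in> R" if "S \<subseteq> V" "d \<ge> 1" "ind_hom T S d" for S d
  proof -
    have "int (nat (d - 1)) + 1 = d" using that(2) by simp
    then have "ind_hom T S (int (nat (d - 1)) + 1)" "int (card S) - d + 1 = int (card S) - int (nat (d - 1))"
      using that(2,3) by simp_all
    then show ?thesis unfolding R_def using that(1) by blast
  qed
  obtain S d where "S \<subseteq> V" "d \<ge> 1" "ind_hom T S d" "int (card S) - d = int (ind_match_num V)"
    using ind_hom_ge[of T] by blast
  then have nu: "int (ind_match_num V) + 1 \<in> R" using mem[of S d] by simp
  show ?thesis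
  proof
    assume cond: "n mod 3 = 0 \<or> n mod 3 = 1 \<or> ind_match_num (V - cyc_nbrs) < ind_match_num V"
    show "Max R = int (ind_match_num V) + 1"
    proof (rule Max_eqI[OF fin _ nu])
      fix x assume "x \<in> R"
      then obtain S i where "x = int (card S) - int i" "S \<subseteq> V" "ind_hom T S (int i + 1)" unfolding R_def by blast
      then show "x \<le> int (ind_match_num V) + 1" using ind_hom_le[OF _ _ cond, of S T "int i + 1"] by simp
    qed
  next
    assume max: "Max R = int (ind_match_num V) + 1"
    show "n mod 3 = 0 \<or> n mod 3 = 1 \<or> ind_match_num (V - cyc_nbrs) < ind_match_num V"
    proof (rule ccontr)
      assume neg: "\<not> ?thesis"
      have "ind_match_num (V - cyc_nbrs) \<le> ind_match_num V" by (rule ind_match_num_mono) blast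
      then have "ind_match_num (V - cyc_nbrs) = ind_match_num V" using neg by linarith
      moreover have "n mod 3 = 2" using neg by linarith
      ultimately obtain S d where "S \<subseteq> V" "d \<ge> 1" "ind_hom T S d" "int (card S) - d > int (ind_match_num V)"
        using ind_hom_gt[of T] by blast
      then have "int (card S) - d + 1 \<le> Max R" using mem[of S d] fin by (intro Max_ge) auto
      then show False using max \<open>int (card S) - d > int (ind_match_num V)\<close> by linarith
    qed
  qed
qed

end

section \<open>Induced subgraphs, and assembly of the result\<close>

lemma (in graph) uedges_induce: "uedges (G \<restriction> X) = {e \<in> uedges G. e \<subseteq> X}"
proof
  show "uedges (G \<restriction> X) \<subseteq> {e \<in> uedges G. e \<subseteq> X}"
    by (auto simp: uedges_def arcs_ends_conv)
  show "{e \<in> uedges G. e \<subseteq> X} \<subseteq> uedges (G \<restriction> X)"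
  proof
    fix e assume "e \<in> {e \<in> uedges G. e \<subseteq> X}"
    then obtain u v where "e = {u, v}" "u \<rightarrow>\<^bsub>G\<^esub> v" "u \<in> X" "v \<in> X" by (auto simp: uedges_def)
    moreover from this have "u \<rightarrow>\<^bsub>G \<restriction> X\<^esub> v" by (force simp: arcs_ends_conv)
    ultimately show "e \<in> uedges (G \<restriction> X)" unfolding uedges_def by blast
  qed
qed

lemma (in graph) induced_matching_induce:
  "induced_matching (G \<restriction> X) M \<longleftrightarrow> M \<subseteq> uedges G \<and> pairwise disjnt M \<and>
     (\<forall>e \<in> uedges G. e \<subseteq> \<Union> M \<longrightarrow> e \<in> M) \<and> \<Union> M \<subseteq> X"
proof -
  have "(G \<restriction> X) \<restriction> \<Union> M = G \<restriction> \<Union> M" if "\<Union> M \<subseteq> X"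
    using that by (auto simp: induce_subgraph_def)
  then show ?thesis
    unfolding induced_matching_def uedges_induce by (cases "\<Union> M \<subseteq> X") (auto simp: uedges_induce)
qed

theorem corollary3p11:
  fixes G :: "('v, 'e) pre_digraph" and C :: "'v set set"
  assumes "Digraph.graph G"
    and "Digraph_Component.connected G"
    and "unicyclic G"
    and "\<not> is_cycle_graph G"
    and "C \<in> graph_cycles G"
  shows "ideal_regularity (verts G) (edge_ideal G :: ('v, 'k::field) mpoly set)
           = int (induced_matching_number G) + 1
         \<longleftrightarrow> card C mod 3 = 0 \<or> card C mod 3 = 1
           \<or> induced_matching_number (delete_verts G (cycle_nbrs G C)) < induced_matching_number G"
proof -
  interpret graph G by (rule assms(1))
  let ?V = "verts G" and ?E = "uedges G"
  obtain xs where xs: "closed_path ?E xs" "C = cyc_edges xs" using graph_cycle_closed_path[OF assms(5)] by blast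
  let ?n = "length xs"
  have E_pair: "\<exists>u v. u \<noteq> v \<and> e = {u, v} \<and> u \<in> ?V \<and> v \<in> ?V" if e: "e \<in> ?E" for e
  proof -
    obtain u v where uv: "e = {u, v}" "u \<rightarrow>\<^bsub>G\<^esub> v" using e unfolding uedges_def by blast
    then have "u \<noteq> v" using adj_not_same by blast
    then show ?thesis using uv(1) adj_in_verts[OF uv(2)] by blast
  qed
  interpret U: unique_closed_path ?V ?E xs
  proof
    show "cyc_edges ys = cyc_edges xs" if "closed_path ?E ys" for ys
      using closed_path_graph_cycle[OF that] assms(3,5) xs(2) unfolding unicyclic_def by blast
  qed (use E_pair xs(1) in auto)
  have "?E \<subseteq> (\<lambda>e. {tail G e, head G e}) ` arcs G" by (auto simp: uedges_def arcs_ends_conv)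
  then have "finite ?E" by (rule finite_subset) simp
  \<comment> \<open>An arbitrary labelling of the edges; the signs depend on it, the homology
    classes are only asked to exist.\<close>
  then obtain h where h: "bij_betw h {..<card ?E} ?E"
    using ex_bij_betw_nat_finite[of ?E] by (auto simp: lessThan_atLeast0)
  let ?I = "{..<card ?E}"
  have set_xs: "(!) xs ` {..<?n} = set xs" by (auto simp: set_conv_nth)
  interpret F: unicyclic_edges ?I h ?E ?V ?n "(!) xs"
  proof unfold_locales
    show "inj_on h ?I" "h ` ?I = ?E" using h by (auto simp: bij_betw_def)
    show "\<exists>u v. u \<noteq> v \<and> e = {u, v}" "e \<subseteq> ?V" if "e \<in> ?E" for e using E_pair[OF that] by auto
    show "3 \<le> ?n" by (rule U.xs_facts)
    show "inj_on ((!) xs) {..<?n}" using U.xs_facts(1) by (simp add: inj_on_nth)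
    show "(!) xs ` {..<?n} \<subseteq> ?V" unfolding set_xs by (rule U.xs_V)
    show "{xs ! i, xs ! (Suc i mod ?n)} \<in> ?E" if "i < ?n" for i by (rule closed_path_edge[OF xs(1) that])
    show "\<exists>i<?n. e = {xs ! i, xs ! (Suc i mod ?n)}" if "e \<in> ?E" "e \<subseteq> (!) xs ` {..<?n}" for e
      using U.chordless_xs[OF that(1)] that(2) unfolding set_xs by (auto simp: cyc_edges_def)
    show "\<exists>u\<in>S. card (edge_family.nbrs ?E S u) \<le> 1 \<and> ((!) xs ` {..<?n} \<subseteq> S \<longrightarrow> u \<notin> (!) xs ` {..<?n})"
      if "S \<subseteq> ?V" "S \<noteq> {}" "S \<noteq> (!) xs ` {..<?n}" for S
    proof -
      have "\<exists>u v. u \<noteq> v \<and> e = {u, v}" if "e \<in> ?E" for e using E_pair[OF that] by blast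
      then interpret edge_family ?I h ?E
        using h by unfold_locales (auto simp: bij_betw_def)
      show ?thesis using U.leaf_exists[of S] that unfolding set_xs nbrs_def by blast
    qed
  qed simp_all
  interpret M: sqf_monomials ?V ?I h
  proof
    show "h a \<subseteq> ?V" "h a \<noteq> {}" if "a \<in> ?I" for a
      using E_pair[OF F.g_in_E[OF that]] by auto
  qed simp_all
  have comp: "(\<lambda>d. (edge_ideal G :: ('v, 'k) mpoly set) \<inter> hom_comp ?V d) = M.mon_ideal_comp"
    unfolding edge_ideal_eq[OF assms(1) F.g_image] M.mon_ideal_comp_def by (auto simp: hom_comp_def)
  have hom: "cov_hom TYPE('k) h {a \<in> ?I. h a \<subseteq> S} S m \<longleftrightarrow> F.ind_hom TYPE('k) S m" for S m
    unfolding F.ind_hom_def F.edges_in_def ..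
  have "ideal_regularity ?V (edge_ideal G :: ('v, 'k) mpoly set)
      = Max {j - int i | i j. \<exists>S\<subseteq>?V. int (card S) = j \<and> F.ind_hom TYPE('k) S (int i + 1)}"
    unfolding ideal_regularity_def regularity_def comp M.Tor_nonzero_mon_ideal hom ..
  also have "{j - int i | i j. \<exists>S\<subseteq>?V. int (card S) = j \<and> F.ind_hom TYPE('k) S (int i + 1)}
      = {int (card S) - int i | S i. S \<subseteq> ?V \<and> F.ind_hom TYPE('k) S (int i + 1)}" by blast
  finally have reg: "ideal_regularity ?V (edge_ideal G :: ('v, 'k) mpoly set)
      = Max {int (card S) - int i | S i. S \<subseteq> ?V \<and> F.ind_hom TYPE('k) S (int i + 1)}" .
  have im: "induced_matching_number (G \<restriction> X) = F.ind_match_num X" for X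
    unfolding induced_matching_number_def F.ind_match_num_def induced_matching_induce F.ind_match_def by (simp only: conj_assoc)
  have "{e \<in> arcs G. tail G e \<in> ?V \<and> head G e \<in> ?V} = arcs G" by auto
  then have "G \<restriction> ?V = G" by (simp add: induce_subgraph_def)
  then have nG: "induced_matching_number G = F.ind_match_num ?V" using im[of ?V] by simp
  have "\<Union> C = set xs" unfolding xs(2) by (rule Union_cyc_edges[OF U.xs_facts(3)])
  then have "cycle_nbrs G C = F.cyc_nbrs"
    unfolding cycle_nbrs_def F.cyc_nbrs_def set_xs uedges_iff by simp
  then have nD: "induced_matching_number (delete_verts G (cycle_nbrs G C)) = F.ind_match_num (?V - F.cyc_nbrs)"
    unfolding delete_verts_def im by simp
  have cC: "card C = ?n"
  proof -
    have "inj_on (\<lambda>i. {xs ! i, xs ! (Suc i mod ?n)}) {..<?n}"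
      by (rule inj_onI) (use F.cycle_edge_eq in auto)
    then show ?thesis unfolding xs(2) cyc_edges_def by (simp add: card_image)
  qed
  show ?thesis unfolding reg nG nD cC by (rule F.Max_ind_hom)
qed

end
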